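(* Let $\gamma \colon [0,2\pi) \to S^{2}$ be the curve $\gamma(\theta) = \tfrac{1}{\sqrt{2}}(\cos\theta,\sin\theta,1)$, and for $\theta \in [0,2\pi)$ let $\rho_{\theta} \colon \mathbb{R}^{3} \to \mathbb{R}$ be the map $\rho_{\theta}(z) = \gamma(\theta)\cdot z$. Let $K \subset \mathbb{R}^{3}$ be an analytic set with $0 < \dim_{\mathrm{H}} K \leq 1$, and let $0 \leq t < \dim_{\mathrm{H}} K$. Then there is a set $E \subset [0,2\pi)$ with $$\dim_{\mathrm{H}} E \leq \frac{\dim_{\mathrm{H}} K + t}{2\dim_{\mathrm{H}} K} < 1$$ such that $\dim_{\mathrm{H}} \rho_{\theta}(K) \geq t$ for all $\theta \in [0,2\pi)\setminus E$.
   Context: $S^{2}$ is the unit sphere in $\mathbb{R}^{3}$, $\cdot$ is the Euclidean inner product, and $\dim_{\mathrm{H}}$ denotes Hausdorff dimension. "Analytic" means analytic (Suslin) set in the sense of descriptive set theory. *)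

theory Defs
  imports "HOL-Analysis.Analysis"
begin

(* The weight (diam U)^s of a covering set, with the conventions that the empty set has
   weight 0 and that 0^0 = 1, so that the 0-dimensional measure is counting measure.
   The cases are needed because 0 powr 0 = 0 in HOL. *)
definition diam_weight :: "real \<Rightarrow> 'a::metric_space set \<Rightarrow> ennreal" where
  "diam_weight s U =
     (if U = {} then 0 else if s = 0 then 1 else ennreal (diameter U powr s))"

(* The condition "bounded" is essential: diameter is a real supremum and carries no
   information on unbounded sets.  Finite covers are included, as U i may be empty. *)
definition delta_covers :: "real \<Rightarrow> 'a::metric_space set \<Rightarrow> (nat \<Rightarrow> 'a set) set" where
  "delta_covers \<delta> A =
     {U. A \<subseteq> (\<Union>i. U i) \<and> (\<forall>i. bounded (U i) \<and> diameter (U i) \<le> \<delta>)}"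

definition hausdorff_premeasure :: "real \<Rightarrow> real \<Rightarrow> 'a::metric_space set \<Rightarrow> ennreal" where
  "hausdorff_premeasure s \<delta> A = (INF U\<in>delta_covers \<delta> A. \<Sum>i. diam_weight s (U i))"

definition hausdorff_measure :: "real \<Rightarrow> 'a::metric_space set \<Rightarrow> ennreal" where
  "hausdorff_measure s A = (SUP \<delta>\<in>{0<..}. hausdorff_premeasure s \<delta> A)"

definition hausdorff_dim :: "'a::metric_space set \<Rightarrow> ennreal" where
  "hausdorff_dim A = (INF s\<in>{s. 0 \<le> s \<and> hausdorff_measure s A = 0}. ennreal s)"

(* Analytic (Suslin) sets: the empty set and the continuous images of the Baire space,
   i.e. of nat \<Rightarrow> nat with the product of the discrete topologies. *)
definition analytic_set :: "'a::polish_space set \<Rightarrow> bool" where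
  "analytic_set A \<longleftrightarrow>
     A = {} \<or> (\<exists>f :: (nat \<Rightarrow> nat) \<Rightarrow> 'a. continuous_on UNIV f \<and> A = range f)"

definition gamma_curve :: "real \<Rightarrow> real ^ 3" where
  "gamma_curve \<theta> = (1 / sqrt 2) *\<^sub>R vector [cos \<theta>, sin \<theta>, 1]"

definition rho :: "real \<Rightarrow> real ^ 3 \<Rightarrow> real" where
  "rho \<theta> z = gamma_curve \<theta> \<bullet> z"

lemma gamma_curve_in_sphere: "gamma_curve \<theta> \<in> sphere 0 1"
proof -
  have "(norm (vector [cos \<theta>, sin \<theta>, 1] :: real ^ 3))\<^sup>2 = 2"
    unfolding power2_norm_eq_inner
    by (simp add: inner_vec_def sum_3 power2_eq_square[symmetric])
  then have "norm (vector [cos \<theta>, sin \<theta>, 1] :: real ^ 3) = sqrt 2"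
    by (metis norm_ge_zero real_sqrt_unique)
  then show ?thesis
    by (simp add: gamma_curve_def)
qed

lemma hausdorff_measure_empty [simp]: "hausdorff_measure s {} = 0"
proof -
  have "hausdorff_premeasure s \<delta> ({} :: 'a set) = 0" if "\<delta> > 0" for \<delta>
  proof -
    have "(\<lambda>_. {}) \<in> delta_covers \<delta> ({} :: 'a set)"
      using that by (simp add: delta_covers_def)
    then have "hausdorff_premeasure s \<delta> ({} :: 'a set) \<le> (\<Sum>i::nat. diam_weight s ({} :: 'a set))"
      unfolding hausdorff_premeasure_def by (rule INF_lower)
    then show ?thesis
      by (simp add: diam_weight_def)
  qed
  then show ?thesis
    by (simp add: hausdorff_measure_def)
qed

lemma hausdorff_measure_0_ge_1:
  assumes "A \<noteq> {}"
  shows "1 \<le> hausdorff_measure 0 A"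
proof -
  have "1 \<le> (\<Sum>i. diam_weight 0 (U i))" if U: "U \<in> delta_covers 1 A" for U
  proof -
    obtain i where "U i \<noteq> {}"
      using U assms by (fastforce simp: delta_covers_def)
    then have "1 = (\<Sum>j\<in>{i}. diam_weight 0 (U j))"
      by (simp add: diam_weight_def)
    also have "\<dots> \<le> (\<Sum>j. diam_weight 0 (U j))"
      by (rule sum_le_suminf) auto
    finally show ?thesis .
  qed
  then have "1 \<le> hausdorff_premeasure 0 1 A"
    unfolding hausdorff_premeasure_def by (intro INF_greatest)
  also have "\<dots> \<le> hausdorff_measure 0 A"
    unfolding hausdorff_measure_def by (rule SUP_upper) simp
  finally show ?thesis .
qed

end

theory Submission
  imports Defs "HOL-Real_Asymp.Real_Asymp"
begin

text \<open>
  Write $f_z(t) = z_1 \cos t + z_2 \sin t + z_3$, which is $\sqrt 2$ times the projection of $z$ in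
  direction $t$. If the projection of $K$ is small, then many of the curves $f_z$ run together above $t$.
  Two such curves stay together on a long arc only if they are nearly tangent. Since the difference of two
  curves changes sign at most twice, the tangency points of two curves with two others lying above them
  occur in reversed order, unless they are on different sides. Following the idea of Marcus and
  Tardos for pairwise reversed sequences, the positivity of a quadratic form built from the order signs
  turns this into a bound for the total weight of tangencies, with logarithmic losses only. Fed with Frostman
  weights on $K$ and on the set of directions, it gives an exceptional set of dimension at most $t$,
  and $t \le (s + t) / 2 s$ for $t < s = \dim K \le 1$.

  All measures are weights on finite sets. This avoids measurability questions for the set of
  exceptional directions: the passage from positive Hausdorff measure to finite weights only uses that
  the dyadic content is continuous along arbitrary increasing sequences of sets.
\<close>

section \<open>A weighted bound for nearly tangent curves\<close>

text \<open>What makes all classes of pairs equally cheap is a cancellation of scales. For pairs at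
  distance about r and defect about r / 4^L, the angles at which the curves are D-close have mass at
  most a constant times (D 2^L / r)^e, an arc of length 2 pi / 2^L has mass at most a constant times
  2^(-L e), and a ball of radius comparable to r has mass at most a constant times r^e. The tangency
  bound contains these only through their product, which is D^e for every r and L. At D = 2 / 2^k
  there are at most k^2 classes, so summation costs a polynomial in k. If the projections are
  covered by 2^(k t) intervals at that scale, the coincidences have a definite total weight, and
  comparison leaves 1 \<le> poly(k) 2^(-k (e - t) / 2), false for e > t and large k. The exponent e
  must be admissible for points and directions at once, so it is taken strictly between t and both
  dimensions. The scale k is found by pigeonholing up to a finest level n that is not under control;
  hence every loss has to depend on k alone.\<close>

definition osign :: "nat \<Rightarrow> nat \<Rightarrow> real" where
  "osign i j = (if i < j then -1 else if i = j then 0 else 1)"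

text \<open>Grouping by the key makes the kernel block diagonal with all-ones blocks, hence one
  square per fibre. It is applied with the dyadic block as key and weights signed by
  \<open>side\<close>.\<close>

lemma sum_same_key:
  fixes g :: "'x \<Rightarrow> real"
  assumes "finite X"
  shows "(\<Sum>x\<in>X. \<Sum>y\<in>X. g x * g y * of_bool (\<kappa> x = \<kappa> y)) =
    (\<Sum>k\<in>\<kappa> ` X. (\<Sum>x | x \<in> X \<and> \<kappa> x = k. g x)\<^sup>2)"
proof -
  have 1: "(\<Sum>y\<in>X. g x * g y * of_bool (\<kappa> x = \<kappa> y)) = g x * (\<Sum>y | y \<in> X \<and> \<kappa> y = \<kappa> x. g y)" for x
  proof -
    have "(\<Sum>y\<in>X. g x * g y * of_bool (\<kappa> x = \<kappa> y)) = (\<Sum>y\<in>X. if \<kappa> y = \<kappa> x then g x * g y else 0)"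
      by (intro sum.cong) auto
    also have "\<dots> = (\<Sum>y | y \<in> X \<and> \<kappa> y = \<kappa> x. g x * g y)"
      using assms by (simp add: sum.inter_filter)
    finally show ?thesis by (simp add: sum_distrib_left)
  qed
  have "(\<Sum>x\<in>X. \<Sum>y\<in>X. g x * g y * of_bool (\<kappa> x = \<kappa> y)) =
     (\<Sum>x\<in>X. g x * (\<Sum>y | y \<in> X \<and> \<kappa> y = \<kappa> x. g y))"
    using 1 by simp
  also have "\<dots> = (\<Sum>k\<in>\<kappa> ` X. \<Sum>x | x \<in> X \<and> \<kappa> x = k. g x * (\<Sum>y | y \<in> X \<and> \<kappa> y = \<kappa> x. g y))"
    using assms by (rule sum.image_gen)
  also have "\<dots> = (\<Sum>k\<in>\<kappa> ` X. (\<Sum>x | x \<in> X \<and> \<kappa> x = k. g x)\<^sup>2)"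
    by (intro sum.cong refl) (simp add: power2_eq_square sum_distrib_right)
  finally show ?thesis .
qed

declare sum_of_bool_mult_eq [simp del] sum_mult_of_bool_eq [simp del]

text \<open>An index \<open>i < 2^L\<close> stands for an arc, \<open>Om a b i\<close> is the weight with which the curve of \<open>b\<close>
  touches that of \<open>a\<close> from above on this arc, and \<open>near\<close> relates arcs that cannot be told apart.\<close>

locale tangency =
  fixes A B :: "'p set" and w :: "'p \<Rightarrow> real" and L :: nat
    and Om :: "'p \<Rightarrow> 'p \<Rightarrow> nat \<Rightarrow> real" and F G :: "'p \<Rightarrow> nat \<Rightarrow> real"
    and near :: "nat \<Rightarrow> nat \<Rightarrow> bool" and \<epsilon> N0 U V R W :: real
  assumes finA: "finite A" and finB: "finite B"
    and w0: "\<And>x. 0 \<le> w x" and Om0: "\<And>a b i. 0 \<le> Om a b i"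
    and edge: "\<And>a b i. \<lbrakk>a \<in> A; b \<in> B; i < 2^L; Om a b i > 0\<rbrakk> \<Longrightarrow> G b i - F a i \<le> \<epsilon>"
    and far: "\<And>a b i j. \<lbrakk>a \<in> A; b \<in> B; i < 2^L; Om a b i > 0; j < 2^L; \<not> near i j\<rbrakk> \<Longrightarrow> G b j - F a j > \<epsilon>"
    and altF: "\<And>a a' i1 i2 i3 i4. \<lbrakk>a \<in> A; a' \<in> A; i1 < i2; i2 < i3; i3 < i4; i4 < 2^L;
        F a i1 < F a' i1; F a' i2 < F a i2; F a i3 < F a' i3; F a' i4 < F a i4\<rbrakk> \<Longrightarrow> False"
    and altG: "\<And>b b' i1 i2 i3 i4. \<lbrakk>b \<in> B; b' \<in> B; i1 < i2; i2 < i3; i3 < i4; i4 < 2^L;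
        G b i1 < G b' i1; G b' i2 < G b i2; G b i3 < G b' i3; G b' i4 < G b i4\<rbrakk> \<Longrightarrow> False"
    and near_refl: "\<And>i. near i i" and near_sym: "\<And>i j. near i j \<Longrightarrow> near j i"
    and near_card: "\<And>i. i < 2^L \<Longrightarrow> real (card {j. j < 2^L \<and> near i j}) \<le> N0"
    and U: "\<And>a b. \<lbrakk>a \<in> A; b \<in> B\<rbrakk> \<Longrightarrow> (\<Sum>i<2^L. Om a b i) \<le> U"
    and Vrow: "\<And>a i. \<lbrakk>a \<in> A; i < 2^L\<rbrakk> \<Longrightarrow> (\<Sum>b\<in>B. w b * Om a b i) \<le> V"
    and Vcol: "\<And>b i. \<lbrakk>b \<in> B; i < 2^L\<rbrakk> \<Longrightarrow> (\<Sum>a\<in>A. w a * Om a b i) \<le> V"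
    and RA: "\<And>a. a \<in> A \<Longrightarrow> (\<Sum>a' | a' \<in> A \<and> (\<exists>b\<in>B. \<exists>i<2^L. \<exists>j<2^L. Om a b i > 0 \<and> Om a' b j > 0). w a') \<le> R"
    and RB: "\<And>b. b \<in> B \<Longrightarrow> (\<Sum>b' | b' \<in> B \<and> (\<exists>a\<in>A. \<exists>i<2^L. \<exists>j<2^L. Om a b i > 0 \<and> Om a b' j > 0). w b') \<le> R"
    and RAB: "\<And>a. a \<in> A \<Longrightarrow> (\<Sum>b | b \<in> B \<and> (\<exists>i<2^L. Om a b i > 0). w b) \<le> R"
    and RBA: "\<And>b. b \<in> B \<Longrightarrow> (\<Sum>a | a \<in> A \<and> (\<exists>i<2^L. Om a b i > 0). w a) \<le> R"
    and WA: "(\<Sum>a\<in>A. w a) \<le> W" and WB: "(\<Sum>b\<in>B. w b) \<le> W"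
    and pos: "U > 0" "V > 0" "R \<ge> 0" "W \<ge> 0" "N0 > 0"
begin

text \<open>Negating all curves exchanges above and below, so the lower family \<open>A\<close> and
  the upper family \<open>B\<close> play symmetric roles. This is what allows
  \<open>SA \<le> SB\<close> to be assumed when the estimate is closed.\<close>

lemma swapped: "tangency B A w L (\<lambda>b a. Om a b) (\<lambda>b i. - G b i) (\<lambda>a i. - F a i) near \<epsilon> N0 U V R W"
proof
  show "finite B" "finite A" by (fact finB finA)+
  show "0 \<le> w x" for x by (fact w0)
  show "0 \<le> Om a b i" for b a i by (fact Om0)
  show "- F b i - - G a i \<le> \<epsilon>" if "a \<in> B" "b \<in> A" "i < 2^L" "0 < Om b a i" for a b i
    using edge[OF that(2,1,3,4)] by simp
  show "\<epsilon> < - F b j - - G a j" if "a \<in> B" "b \<in> A" "i < 2^L" "0 < Om b a i" "j < 2^L" "\<not> near i j" for a b i j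
    using far[OF that(2,1,3,4,5,6)] by simp
  show False if "a \<in> B" "a' \<in> B" "i1 < i2" "i2 < i3" "i3 < i4" "i4 < 2^L"
      "- G a i1 < - G a' i1" "- G a' i2 < - G a i2" "- G a i3 < - G a' i3" "- G a' i4 < - G a i4" for a a' i1 i2 i3 i4
    using altG[OF that(2,1,3,4,5,6)] that by auto
  show False if "a \<in> A" "a' \<in> A" "i1 < i2" "i2 < i3" "i3 < i4" "i4 < 2^L"
      "- F a i1 < - F a' i1" "- F a' i2 < - F a i2" "- F a i3 < - F a' i3" "- F a' i4 < - F a i4" for a a' i1 i2 i3 i4
    using altF[OF that(2,1,3,4,5,6)] that by auto
  show "near i i" "near i j \<Longrightarrow> near j i" for i j by (fact near_refl near_sym)+
  show "real (card {j. j < 2^L \<and> near i j}) \<le> N0" if "i < 2^L" for i using near_card[OF that] .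
  show "(\<Sum>i<2^L. Om b a i) \<le> U" if "a \<in> B" "b \<in> A" for a b using U that by blast
  show "(\<Sum>b\<in>A. w b * Om b a i) \<le> V" if "a \<in> B" "i < 2^L" for a i using Vcol that by blast
  show "(\<Sum>a\<in>B. w a * Om b a i) \<le> V" if "b \<in> A" "i < 2^L" for b i using Vrow that by blast
qed (use RA RB RAB RBA WA WB pos in auto)

abbreviation I :: "nat set" where "I \<equiv> {..<2^L}"

definition tot :: "'p \<Rightarrow> 'p \<Rightarrow> real" where "tot a b = (\<Sum>i\<in>I. Om a b i)"
definition dA :: "'p \<Rightarrow> real" where "dA a = (\<Sum>b\<in>B. w b * tot a b)"
definition dB :: "'p \<Rightarrow> real" where "dB b = (\<Sum>a\<in>A. w a * tot a b)"
definition SA :: real where "SA = (\<Sum>a\<in>A. w a * (dA a)\<^sup>2)"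
definition SB :: real where "SB = (\<Sum>b\<in>B. w b * (dB b)\<^sup>2)"
definition T :: real where "T = (\<Sum>a\<in>A. \<Sum>b\<in>B. w a * w b * tot a b)"

text \<open>A triple \<open>(b, i, j)\<close> records that \<open>b\<close> touches \<open>a\<close>
  on arc \<open>i\<close> and \<open>a'\<close> on arc \<open>j\<close>. Summed over all triples
  and, with weights, over all pairs \<open>a\<close>, \<open>a'\<close>, this gives back the second
  moment \<open>SB\<close>.\<close>

definition joint :: "'p \<Rightarrow> 'p \<Rightarrow> 'p \<times> nat \<times> nat \<Rightarrow> real" where
  "joint a a' = (\<lambda>(b, i, j). w b * Om a b i * Om a' b j)"

abbreviation X :: "('p \<times> nat \<times> nat) set" where "X \<equiv> B \<times> I \<times> I"

definition quad :: "('p \<Rightarrow> 'p \<Rightarrow> 'p \<times> nat \<times> nat \<Rightarrow> 'p \<times> nat \<times> nat \<Rightarrow> real) \<Rightarrow> real" where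
  "quad K = (\<Sum>a\<in>A. \<Sum>a'\<in>A. w a * w a' * (\<Sum>x\<in>X. \<Sum>y\<in>X. joint a a' x * joint a a' y * K a a' x y))"

lemma finite_X: "finite X" using finB by simp

lemma tot_nonneg: "0 \<le> tot a b" unfolding tot_def by (simp add: sum_nonneg Om0)

lemma joint_nonneg: "0 \<le> joint a a' x" unfolding joint_def by (auto split: prod.splits simp: w0 Om0)

lemma joint_pos_D:
  assumes "joint a a' (b,i,j) \<noteq> 0" shows "w b > 0" "Om a b i > 0" "Om a' b j > 0"
  using assms unfolding joint_def by (auto simp: w0 Om0 less_le)

text \<open>The sign rule behind the whole argument: tangency points of two curves with two others
  appear in reversed order unless they lie on different sides.\<close>

lemma reversal:
  assumes "a \<in> A" "a' \<in> A" "b \<in> B" "b' \<in> B"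
    and lt: "i1 < 2^L" "j1 < 2^L" "i2 < 2^L" "j2 < 2^L"
    and O: "Om a b i1 > 0" "Om a' b j1 > 0" "Om a b' i2 > 0" "Om a' b' j2 > 0"
    and nn: "\<not> near i1 j1" "\<not> near i2 j2" "\<not> near i1 i2" "\<not> near j1 j2"
  shows "osign i1 i2 * osign j1 j2 \<le> - (osign j1 i1 * osign j2 i2)"
proof -
  have nn': "\<not> near j1 i1" "\<not> near j2 i2" "\<not> near i2 i1" "\<not> near j2 j1"
    using nn near_sym by blast+
  \<comment> \<open>On the arc where \<open>b\<close> touches \<open>a\<close> the gap of
    \<open>b\<close> is at most \<open>\<epsilon>\<close> while that of \<open>b'\<close> exceeds
    it, so comparison with the common curve \<open>a\<close> orders \<open>b\<close> and
    \<open>b'\<close> there. The eight inequalities record both orders on each of the four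
    arcs.\<close>
  have k1: "G b i1 < G b' i1" using edge[OF assms(1,3) lt(1) O(1)] far[OF assms(1,4) lt(3) O(3) lt(1) nn'(3)] by simp
  have k2: "G b' i2 < G b i2" using edge[OF assms(1,4) lt(3) O(3)] far[OF assms(1,3) lt(1) O(1) lt(3) nn(3)] by simp
  have k3: "G b j1 < G b' j1" using edge[OF assms(2,3) lt(2) O(2)] far[OF assms(2,4) lt(4) O(4) lt(2) nn'(4)] by simp
  have k4: "G b' j2 < G b j2" using edge[OF assms(2,4) lt(4) O(4)] far[OF assms(2,3) lt(2) O(2) lt(4) nn(4)] by simp
  have h1: "F a' i1 < F a i1" using edge[OF assms(1,3) lt(1) O(1)] far[OF assms(2,3) lt(2) O(2) lt(1) nn'(1)] by simp
  have h2: "F a j1 < F a' j1" using edge[OF assms(2,3) lt(2) O(2)] far[OF assms(1,3) lt(1) O(1) lt(2) nn(1)] by simp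
  have h3: "F a' i2 < F a i2" using edge[OF assms(1,4) lt(3) O(3)] far[OF assms(2,4) lt(4) O(4) lt(3) nn'(2)] by simp
  have h4: "F a j2 < F a' j2" using edge[OF assms(2,4) lt(4) O(4)] far[OF assms(1,4) lt(3) O(3) lt(4) nn(2)] by simp
  have ne: "i1 \<noteq> i2" "j1 \<noteq> j2" "i1 \<noteq> j1" "i2 \<noteq> j2" "i1 \<noteq> j2" "i2 \<noteq> j1"
    using nn near_refl k1 k2 k3 k4 by auto
  \<comment> \<open>Same side and same order is impossible: depending on how the middle two arcs
    interleave, four alternations appear in the lower pair or in the upper pair.\<close>
  have "False" if "i1 < i2" "j1 < j2" "j1 < i1" "j2 < i2"
  proof (cases "i1 < j2")
    case True
    then show False using altF[OF assms(1,2) that(3) True that(4) lt(3)] h1 h2 h3 h4 by blast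
  next
    case False
    then have "j2 < i1" using ne by auto
    then show False using altG[OF assms(3,4) that(2) _ that(1) lt(3)] k1 k2 k3 k4 by blast
  qed
  moreover have "False" if "i2 < i1" "j2 < j1" "j1 < i1" "j2 < i2"
  proof (cases "i2 < j1")
    case True
    then show False using altF[OF assms(1,2) that(4) True that(3) lt(1)] h1 h2 h3 h4 by blast
  next
    case False
    then have "j1 < i2" using ne by auto
    then show False using altG[OF assms(4,3) that(2) _ that(1) lt(1)] k1 k2 k3 k4 by blast
  qed
  moreover have "False" if "i1 < i2" "j1 < j2" "i1 < j1" "i2 < j2"
  proof (cases "j1 < i2")
    case True
    then show False using altF[OF assms(2,1) that(3) True that(4) lt(4)] h1 h2 h3 h4 by blast
  next
    case False
    then have "i2 < j1" using ne by auto
    then show False using altG[OF assms(3,4) that(1) _ that(2) lt(4)] k1 k2 k3 k4 by blast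
  qed
  moreover have "False" if "i2 < i1" "j2 < j1" "i1 < j1" "i2 < j2"
  proof (cases "j2 < i1")
    case True
    then show False using altF[OF assms(2,1) that(4) True that(3) lt(2)] h1 h2 h3 h4 by blast
  next
    case False
    then have "i1 < j2" using ne by auto
    then show False using altG[OF assms(4,3) that(1) _ that(2) lt(2)] k1 k2 k3 k4 by blast
  qed
  ultimately show ?thesis
    using ne by (cases "i1 < i2"; cases "j1 < j2"; cases "i1 < j1"; cases "i2 < j2") (auto simp: osign_def)
qed

section \<open>Positivity of the order form and the off-diagonal blocks\<close>

definition deg :: "'p \<times> nat \<times> nat \<Rightarrow> 'p \<times> nat \<times> nat \<Rightarrow> bool" where
  "deg = (\<lambda>(b, i, j) (b', i', j'). near i j \<or> near i' j' \<or> near i i' \<or> near j j')"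

definition blk :: "nat \<Rightarrow> 'p \<times> nat \<times> nat \<Rightarrow> nat \<times> nat" where
  "blk m = (\<lambda>(b, i, j). (i div 2^m, j div 2^m))"

definition side :: "'p \<times> nat \<times> nat \<Rightarrow> real" where "side = (\<lambda>(b, i, j). osign j i)"
definition same_order :: "'p \<times> nat \<times> nat \<Rightarrow> 'p \<times> nat \<times> nat \<Rightarrow> real" where
  "same_order = (\<lambda>(b, i, j) (b', i', j'). osign i i' * osign j j')"

lemma quad_mono:
  assumes "\<And>a a' x y. \<lbrakk>a \<in> A; a' \<in> A; x \<in> X; y \<in> X; joint a a' x \<noteq> 0; joint a a' y \<noteq> 0\<rbrakk> \<Longrightarrow> K a a' x y \<le> K' a a' x y"
  shows "quad K \<le> quad K'"
  unfolding quad_def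
proof (rule sum_mono, rule sum_mono, rule mult_left_mono, rule sum_mono, rule sum_mono)
  fix a a' x y assume "a \<in> A" "a' \<in> A" "x \<in> X" "y \<in> X"
  note in_sets = this
  show "joint a a' x * joint a a' y * K a a' x y \<le> joint a a' x * joint a a' y * K' a a' x y"
  proof (cases "joint a a' x = 0 \<or> joint a a' y = 0")
    case True
    then show ?thesis by (elim disjE) simp_all
  next
    case False
    with in_sets show ?thesis
      by (intro mult_left_mono mult_nonneg_nonneg joint_nonneg assms) auto
  qed
qed (simp add: w0)

lemma quad_add: "quad (\<lambda>a a' x y. K a a' x y + K' a a' x y) = quad K + quad K'"
  unfolding quad_def by (simp add: algebra_simps sum.distrib)

lemma quad_scale: "quad (\<lambda>a a' x y. c * K a a' x y) = c * quad K"
  unfolding quad_def by (simp add: algebra_simps sum_distrib_left)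

text \<open>The block condition and the order signs both factor into a part in
  \<open>(i, i')\<close> and a part in \<open>(j, j')\<close>. For fixed \<open>b\<close>,
  \<open>b'\<close> the sum over \<open>a\<close>, \<open>a'\<close> is therefore the square of a
  single sum over \<open>a\<close>, which is why the form runs over all ordered pairs, equal ones
  included.\<close>

lemma quad_same_order_nonneg: "0 \<le> quad (\<lambda>_ _ x y. of_bool (blk m x = blk m y) * same_order x y)"
proof -
  define M where "M a b b' = (\<Sum>i\<in>I. \<Sum>i'\<in>I. Om a b i * Om a b' i' * (osign i i' * of_bool (i div 2^m = i' div 2^m)))" for a b b'
  have 1: "(\<Sum>x\<in>X. \<Sum>y\<in>X. joint a a' x * joint a a' y * (of_bool (blk m x = blk m y) * same_order x y)) =
     (\<Sum>b\<in>B. \<Sum>b'\<in>B. w b * w b' * (M a b b' * M a' b b'))" (is "?l = ?r") for a a'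
  proof -
    let ?g = "\<lambda>b b' i i' j j'. w b * w b' * (Om a b i * Om a b' i' * (osign i i' * of_bool (i div 2^m = i' div 2^m))) * (Om a' b j * Om a' b' j' * (osign j j' * of_bool (j div 2^m = j' div 2^m)))"
    have "?l = (\<Sum>b\<in>B. \<Sum>i\<in>I. \<Sum>j\<in>I. \<Sum>b'\<in>B. \<Sum>i'\<in>I. \<Sum>j'\<in>I. ?g b b' i i' j j')"
      unfolding sum.cartesian_product'
      by (intro sum.cong refl) (auto simp: joint_def blk_def same_order_def split: prod.splits)
    also have "\<dots> = (\<Sum>b\<in>B. \<Sum>i\<in>I. \<Sum>b'\<in>B. \<Sum>j\<in>I. \<Sum>i'\<in>I. \<Sum>j'\<in>I. ?g b b' i i' j j')"
      by (intro sum.cong refl sum.swap)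
    also have "\<dots> = (\<Sum>b\<in>B. \<Sum>b'\<in>B. \<Sum>i\<in>I. \<Sum>j\<in>I. \<Sum>i'\<in>I. \<Sum>j'\<in>I. ?g b b' i i' j j')"
      by (intro sum.cong refl sum.swap)
    also have "\<dots> = (\<Sum>b\<in>B. \<Sum>b'\<in>B. \<Sum>i\<in>I. \<Sum>i'\<in>I. \<Sum>j\<in>I. \<Sum>j'\<in>I. ?g b b' i i' j j')"
      by (intro sum.cong refl sum.swap)
    also have "\<dots> = ?r"
    proof (intro sum.cong refl)
      fix b b'
      have "w b * w b' * (M a b b' * M a' b b') = w b * w b' * M a b b' * M a' b b'" by simp
      also have "w b * w b' * M a b b' = (\<Sum>i\<in>I. \<Sum>i'\<in>I. w b * w b' * (Om a b i * Om a b' i' * (osign i i' * of_bool (i div 2^m = i' div 2^m))))"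
        unfolding M_def sum_distrib_left ..
      also have "\<dots> * M a' b b' = (\<Sum>i\<in>I. \<Sum>i'\<in>I. \<Sum>j\<in>I. \<Sum>j'\<in>I. ?g b b' i i' j j')"
        unfolding sum_distrib_right unfolding M_def sum_distrib_left ..
      finally show "(\<Sum>i\<in>I. \<Sum>i'\<in>I. \<Sum>j\<in>I. \<Sum>j'\<in>I. ?g b b' i i' j j') = w b * w b' * (M a b b' * M a' b b')" by simp
    qed
    finally show ?thesis .
  qed
  have "quad (\<lambda>_ _ x y. of_bool (blk m x = blk m y) * same_order x y) =
      (\<Sum>a\<in>A. \<Sum>a'\<in>A. \<Sum>b\<in>B. \<Sum>b'\<in>B. w b * w b' * (w a * M a b b' * (w a' * M a' b b')))"
    unfolding quad_def 1 sum_distrib_left by (intro sum.cong refl) (simp add: algebra_simps)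
  also have "\<dots> = (\<Sum>a\<in>A. \<Sum>b\<in>B. \<Sum>a'\<in>A. \<Sum>b'\<in>B. w b * w b' * (w a * M a b b' * (w a' * M a' b b')))"
    by (intro sum.cong refl sum.swap)
  also have "\<dots> = (\<Sum>b\<in>B. \<Sum>a\<in>A. \<Sum>a'\<in>A. \<Sum>b'\<in>B. w b * w b' * (w a * M a b b' * (w a' * M a' b b')))"
    by (rule sum.swap)
  also have "\<dots> = (\<Sum>b\<in>B. \<Sum>a\<in>A. \<Sum>b'\<in>B. \<Sum>a'\<in>A. w b * w b' * (w a * M a b b' * (w a' * M a' b b')))"
    by (intro sum.cong refl sum.swap)
  also have "\<dots> = (\<Sum>b\<in>B. \<Sum>b'\<in>B. \<Sum>a\<in>A. \<Sum>a'\<in>A. w b * w b' * (w a * M a b b' * (w a' * M a' b b')))"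
    by (intro sum.cong refl sum.swap)
  also have "\<dots> = (\<Sum>b\<in>B. \<Sum>b'\<in>B. w b * w b' * (\<Sum>a\<in>A. w a * M a b b')\<^sup>2)"
    unfolding power2_eq_square sum_product by (simp add: sum_distrib_left)
  also have "\<dots> \<ge> 0" by (intro sum_nonneg mult_nonneg_nonneg w0) auto
  finally show ?thesis by simp
qed

text \<open>Outside \<open>deg\<close>, reversal dominates the order kernel by minus the kernel of
  sides, so positivity of the former bounds the latter by the degenerate pairs. Off the diagonal of
  the block grid the side of a triple is determined by its block; no cancellation occurs there and
  the full block weight is squared.\<close>

lemma offdiag_blocks:
  "(\<Sum>a\<in>A. \<Sum>a'\<in>A. w a * w a' * (\<Sum>k | k \<in> blk m ` X \<and> fst k \<noteq> snd k. (\<Sum>x | x \<in> X \<and> blk m x = k. joint a a' x)\<^sup>2))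
    \<le> 2 * quad (\<lambda>_ _ x y. of_bool (deg x y))" (is "?l \<le> _")
proof -
  let ?B = "\<lambda>x y. of_bool (blk m x = blk m y) :: real"
  have "0 \<le> quad (\<lambda>_ _ x y. ?B x y * same_order x y)" by (rule quad_same_order_nonneg)
  also have "\<dots> \<le> quad (\<lambda>_ _ x y. (-1) * (side x * side y * ?B x y) + 2 * of_bool (deg x y))"
  proof (rule quad_mono)
    fix a a' x y assume aa: "a \<in> A" "a' \<in> A" and x: "x \<in> X" and y: "y \<in> X" and m: "joint a a' x \<noteq> 0" "joint a a' y \<noteq> 0"
    obtain b i j where xe: "x = (b,i,j)" by (cases x) auto
    obtain b' i' j' where ye: "y = (b',i',j')" by (cases y) auto
    note mD = joint_pos_D[OF m(1)[unfolded xe]] joint_pos_D[OF m(2)[unfolded ye]]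
    show "?B x y * same_order x y \<le> (-1) * (side x * side y * ?B x y) + 2 * of_bool (deg x y)"
    proof (cases "deg x y")
      case True
      \<comment> \<open>On degenerate pairs both kernels lie between -1 and 1, which accounts for
        the coefficient 2.\<close>
      have "\<bar>same_order x y\<bar> \<le> 1" "\<bar>side x * side y\<bar> \<le> 1" unfolding xe ye same_order_def side_def
        by (auto simp: osign_def)
      then show ?thesis using True by (auto simp: of_bool_def)
    next
      case False
      then have "same_order x y \<le> - (side x * side y)"
        using reversal[OF aa, of b b' i j i' j'] x y mD unfolding xe ye same_order_def side_def deg_def by auto
      then show ?thesis using False by (auto simp: of_bool_def)
    qed
  qed
  also have "\<dots> = - quad (\<lambda>_ _ x y. side x * side y * ?B x y) + 2 * quad (\<lambda>_ _ x y. of_bool (deg x y))"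
    unfolding quad_add quad_scale by simp
  finally have *: "quad (\<lambda>_ _ x y. side x * side y * ?B x y) \<le> 2 * quad (\<lambda>_ _ x y. of_bool (deg x y))" by simp
  have "?l \<le> quad (\<lambda>_ _ x y. side x * side y * ?B x y)"
    unfolding quad_def
  proof (intro sum_mono mult_left_mono)
    fix a a' assume aa: "a \<in> A" "a' \<in> A"
    let ?m = "\<lambda>x. joint a a' x"
    have "(\<Sum>x\<in>X. \<Sum>y\<in>X. ?m x * ?m y * (side x * side y * ?B x y)) = (\<Sum>x\<in>X. \<Sum>y\<in>X. (?m x * side x) * (?m y * side y) * ?B x y)"
      by (intro sum.cong refl) (simp add: algebra_simps)
    also have "\<dots> = (\<Sum>k\<in>blk m ` X. (\<Sum>x | x \<in> X \<and> blk m x = k. ?m x * side x)\<^sup>2)"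
      by (rule sum_same_key[OF finite_X])
    \<comment> \<open>Diagonal blocks, in which the sign may vary, are dropped: they enter as
      squares.\<close>
    also have "\<dots> \<ge> (\<Sum>k | k \<in> blk m ` X \<and> fst k \<noteq> snd k. (\<Sum>x | x \<in> X \<and> blk m x = k. ?m x * side x)\<^sup>2)"
      by (rule sum_mono2) (use finite_X in auto)
    also have "(\<Sum>k | k \<in> blk m ` X \<and> fst k \<noteq> snd k. (\<Sum>x | x \<in> X \<and> blk m x = k. ?m x * side x)\<^sup>2) =
       (\<Sum>k | k \<in> blk m ` X \<and> fst k \<noteq> snd k. (\<Sum>x | x \<in> X \<and> blk m x = k. ?m x)\<^sup>2)"
    proof (intro sum.cong refl)
      fix k assume "k \<in> {k \<in> blk m ` X. fst k \<noteq> snd k}"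
      then have ne: "fst k \<noteq> snd k" by auto
      have tyc: "side x = osign (snd k) (fst k)" if "blk m x = k" for x
      proof -
        obtain b i j where xe: "x = (b,i,j)" by (cases x) auto
        have k: "k = (i div 2^m, j div 2^m)" using that unfolding xe blk_def by auto
        have "i div 2^m \<le> j div 2^m" if "i \<le> j" using that by (simp add: div_le_mono)
        moreover have "j div 2^m \<le> i div 2^m" if "j \<le> i" using that by (simp add: div_le_mono)
        ultimately show ?thesis using ne unfolding k xe side_def osign_def by fastforce
      qed
      have "(\<Sum>x | x \<in> X \<and> blk m x = k. ?m x * side x) = (\<Sum>x | x \<in> X \<and> blk m x = k. ?m x * osign (snd k) (fst k))"
        using tyc by (intro sum.cong) auto
      also have "\<dots> = (\<Sum>x | x \<in> X \<and> blk m x = k. ?m x) * osign (snd k) (fst k)" by (simp add: sum_distrib_right)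
      finally show "(\<Sum>x | x \<in> X \<and> blk m x = k. ?m x * side x)\<^sup>2 = (\<Sum>x | x \<in> X \<and> blk m x = k. ?m x)\<^sup>2"
        using ne by (auto simp: osign_def)
    qed
    finally show "(\<Sum>k | k \<in> blk m ` X \<and> fst k \<noteq> snd k. (\<Sum>x | x \<in> X \<and> blk m x = k. joint a a' x)\<^sup>2)
        \<le> (\<Sum>x\<in>X. \<Sum>y\<in>X. joint a a' x * joint a a' y * (side x * side y * ?B x y))" .
  qed (simp add: w0)
  then show ?thesis using * by linarith
qed

lemma tot_le: "a \<in> A \<Longrightarrow> b \<in> B \<Longrightarrow> tot a b \<le> U"
  unfolding tot_def by (rule U)

lemma dA_nonneg: "0 \<le> dA a" unfolding dA_def by (intro sum_nonneg mult_nonneg_nonneg w0 tot_nonneg)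
lemma SA_nonneg: "0 \<le> SA" unfolding SA_def by (intro sum_nonneg mult_nonneg_nonneg w0) auto
lemma SB_nonneg: "0 \<le> SB" unfolding SB_def by (intro sum_nonneg mult_nonneg_nonneg w0) auto

lemma T_dA: "T = (\<Sum>a\<in>A. w a * dA a)"
  unfolding T_def dA_def sum_distrib_left by (simp add: mult_ac)

lemma T_dB: "T = (\<Sum>b\<in>B. w b * dB b)"
  unfolding T_def dB_def sum_distrib_left by (subst sum.swap) (simp add: mult_ac)

section \<open>Weight of the degenerate configurations\<close>

lemma near_sum:
  assumes "i < 2^L" and f: "\<And>j. j < 2^L \<Longrightarrow> f j \<le> V"
  shows "(\<Sum>j\<in>I. of_bool (near i j) * f j) \<le> N0 * V"
proof -
  have "(\<Sum>j\<in>I. of_bool (near i j) * f j) = (\<Sum>j | j < 2^L \<and> near i j. f j)"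
    by (rule sum.mono_neutral_cong_right) auto
  also have "\<dots> \<le> (\<Sum>j | j < 2^L \<and> near i j. V)" by (rule sum_mono) (use f in auto)
  also have "\<dots> \<le> N0 * V"
    using near_card[OF assms(1)] pos by (simp add: mult_right_mono)
  finally show ?thesis .
qed

lemma near_row:
  assumes "a \<in> A" "i < 2^L"
  shows "(\<Sum>b\<in>B. \<Sum>j\<in>I. of_bool (near i j) * (w b * Om a b j)) \<le> N0 * V"
proof -
  have "(\<Sum>b\<in>B. \<Sum>j\<in>I. of_bool (near i j) * (w b * Om a b j)) =
      (\<Sum>j\<in>I. of_bool (near i j) * (\<Sum>b\<in>B. w b * Om a b j))"
    by (subst sum.swap) (simp add: sum_distrib_left)
  also have "\<dots> \<le> N0 * V" by (rule near_sum[OF assms(2)]) (rule Vrow[OF assms(1)])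
  finally show ?thesis .
qed

lemma near_col:
  assumes "b \<in> B" "i < 2^L"
  shows "(\<Sum>a\<in>A. \<Sum>j\<in>I. of_bool (near i j) * (w a * Om a b j)) \<le> N0 * V"
proof -
  have "(\<Sum>a\<in>A. \<Sum>j\<in>I. of_bool (near i j) * (w a * Om a b j)) =
      (\<Sum>j\<in>I. of_bool (near i j) * (\<Sum>a\<in>A. w a * Om a b j))"
    by (subst sum.swap) (simp add: sum_distrib_left)
  also have "\<dots> \<le> N0 * V" by (rule near_sum[OF assms(2)]) (rule Vcol[OF assms(1)])
  finally show ?thesis .
qed

lemma sum_joint: "(\<Sum>x\<in>X. joint a a' x) = (\<Sum>b\<in>B. w b * tot a b * tot a' b)"
  unfolding sum.cartesian_product' joint_def tot_def prod.case
  by (simp add: sum_distrib_left sum_distrib_right mult_ac)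

lemma sum_joint_near: "(\<Sum>(b,i,j)\<in>X. joint a a' (b,i,j) * of_bool (near i j)) =
   (\<Sum>b\<in>B. \<Sum>i\<in>I. w b * Om a b i * (\<Sum>j\<in>I. of_bool (near i j) * Om a' b j))"
  unfolding sum.cartesian_product' joint_def prod.case
  by (simp add: sum_distrib_left mult_ac)

lemma sum_near_A:
  assumes "a \<in> A"
  shows "(\<Sum>a'\<in>A. w a' * (\<Sum>(b,i,j)\<in>X. joint a a' (b,i,j) * of_bool (near i j))) \<le> N0 * V * dA a"
proof -
  have "(\<Sum>a'\<in>A. w a' * (\<Sum>(b,i,j)\<in>X. joint a a' (b,i,j) * of_bool (near i j))) =
      (\<Sum>a'\<in>A. \<Sum>b\<in>B. \<Sum>i\<in>I. w b * Om a b i * (\<Sum>j\<in>I. of_bool (near i j) * (w a' * Om a' b j)))"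
    unfolding sum_joint_near by (simp add: sum_distrib_left mult_ac)
  also have "\<dots> = (\<Sum>b\<in>B. \<Sum>a'\<in>A. \<Sum>i\<in>I. w b * Om a b i * (\<Sum>j\<in>I. of_bool (near i j) * (w a' * Om a' b j)))"
    by (rule sum.swap)
  also have "\<dots> = (\<Sum>b\<in>B. \<Sum>i\<in>I. \<Sum>a'\<in>A. w b * Om a b i * (\<Sum>j\<in>I. of_bool (near i j) * (w a' * Om a' b j)))"
    by (intro sum.cong refl sum.swap)
  also have "\<dots> = (\<Sum>b\<in>B. \<Sum>i\<in>I. w b * Om a b i * (\<Sum>a'\<in>A. \<Sum>j\<in>I. of_bool (near i j) * (w a' * Om a' b j)))"
    unfolding sum_distrib_left[symmetric] ..
  also have "\<dots> \<le> (\<Sum>b\<in>B. \<Sum>i\<in>I. w b * Om a b i * (N0 * V))"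
    by (intro sum_mono mult_left_mono near_col mult_nonneg_nonneg w0 Om0) auto
  also have "\<dots> = N0 * V * dA a" unfolding dA_def tot_def by (simp add: sum_distrib_left sum_distrib_right mult_ac)
  finally show ?thesis .
qed

lemma sum_near_total:
  "(\<Sum>a\<in>A. \<Sum>a'\<in>A. w a * w a' * (\<Sum>(b,i,j)\<in>X. joint a a' (b,i,j) * of_bool (near i j))) \<le> N0 * V * T"
proof -
  have "(\<Sum>a\<in>A. \<Sum>a'\<in>A. w a * w a' * (\<Sum>(b,i,j)\<in>X. joint a a' (b,i,j) * of_bool (near i j)))
     = (\<Sum>a\<in>A. w a * (\<Sum>a'\<in>A. w a' * (\<Sum>(b,i,j)\<in>X. joint a a' (b,i,j) * of_bool (near i j))))"
    by (simp add: sum_distrib_left mult_ac)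
  also have "\<dots> \<le> (\<Sum>a\<in>A. w a * (N0 * V * dA a))"
    by (intro sum_mono mult_left_mono sum_near_A w0)
  also have "\<dots> = N0 * V * T" unfolding T_dA by (simp add: sum_distrib_left mult_ac)
  finally show ?thesis .
qed

lemma quad_swap_xy: "quad (\<lambda>a a' x y. K a a' y x) = quad K"
proof -
  have "(\<Sum>x\<in>X. \<Sum>y\<in>X. joint a a' x * joint a a' y * K a a' y x) = (\<Sum>x\<in>X. \<Sum>y\<in>X. joint a a' x * joint a a' y * K a a' x y)" for a a'
    by (subst sum.swap) (intro sum.cong refl, simp add: mult_ac)
  then show ?thesis unfolding quad_def by simp
qed

text \<open>Closeness of \<open>i\<close> and \<open>j\<close> gives \<open>N0 * V * dA a\<close>
  after summation over \<open>a'\<close>, and the unconstrained second triple gives at most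
  \<open>U * dA a\<close>; the two factors \<open>dA a\<close> make up the second moment over
  \<open>A\<close>.\<close>

lemma quad_near_ij: "quad (\<lambda>_ _ x y. case x of (b,i,j) \<Rightarrow> of_bool (near i j)) \<le> N0 * U * V * SA"
proof -
  have 1: "(\<Sum>y\<in>X. joint a a' y) \<le> U * dA a" if "a \<in> A" "a' \<in> A" for a a'
  proof -
    have "(\<Sum>y\<in>X. joint a a' y) \<le> (\<Sum>b\<in>B. w b * tot a b * U)"
      unfolding sum_joint by (intro sum_mono mult_left_mono mult_nonneg_nonneg w0 tot_nonneg tot_le) (use that in auto)
    also have "\<dots> = U * dA a" unfolding dA_def by (simp add: sum_distrib_left mult_ac)
    finally show ?thesis .
  qed
  have "quad (\<lambda>_ _ x y. case x of (b,i,j) \<Rightarrow> of_bool (near i j)) =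
     (\<Sum>a\<in>A. \<Sum>a'\<in>A. w a * w a' * ((\<Sum>(b,i,j)\<in>X. joint a a' (b,i,j) * of_bool (near i j)) * (\<Sum>y\<in>X. joint a a' y)))"
    unfolding quad_def
    by (intro sum.cong refl arg_cong[where f="(*) _"]) (auto simp: sum_product intro!: sum.cong)
  also have "\<dots> \<le> (\<Sum>a\<in>A. \<Sum>a'\<in>A. w a * w a' * ((\<Sum>(b,i,j)\<in>X. joint a a' (b,i,j) * of_bool (near i j)) * (U * dA a)))"
    by (rule sum_mono, rule sum_mono, rule mult_left_mono, rule mult_left_mono)
      (auto intro!: 1 sum_nonneg joint_nonneg w0 mult_nonneg_nonneg simp: split_beta)
  also have "\<dots> = (\<Sum>a\<in>A. w a * (U * dA a) * (\<Sum>a'\<in>A. w a' * (\<Sum>(b,i,j)\<in>X. joint a a' (b,i,j) * of_bool (near i j))))"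
    unfolding sum_distrib_left by (intro sum.cong refl) (simp add: mult_ac sum_distrib_left)
  also have "\<dots> \<le> (\<Sum>a\<in>A. w a * (U * dA a) * (N0 * V * dA a))"
    by (intro sum_mono mult_left_mono sum_near_A mult_nonneg_nonneg w0 dA_nonneg) (use pos in auto)
  also have "\<dots> = N0 * U * V * SA" unfolding SA_def by (simp add: sum_distrib_left power2_eq_square mult_ac)
  finally show ?thesis .
qed

text \<open>Here the constraint links the two triples. The second one is summed out by
  \<open>near_row\<close> at \<open>a\<close> together with \<open>tot a' b' \<le> U\<close>, and
  what remains of the first is the expansion of the square of \<open>dB b\<close>; hence
  \<open>SB\<close> in place of \<open>SA\<close>.\<close>

lemma quad_near_ii: "quad (\<lambda>_ _ x y. case x of (b,i,j) \<Rightarrow> case y of (b',i',j') \<Rightarrow> of_bool (near i i')) \<le> N0 * U * V * SB"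
proof -
  have 1: "(\<Sum>x\<in>X. \<Sum>y\<in>X. joint a a' x * joint a a' y * (case x of (b,i,j) \<Rightarrow> case y of (b',i',j') \<Rightarrow> of_bool (near i i'))) \<le>
     (\<Sum>b\<in>B. w b * tot a b * tot a' b) * (N0 * U * V)" (is "?l \<le> _") if a: "a \<in> A" "a' \<in> A" for a a'
  proof -
    have "?l = (\<Sum>b\<in>B. \<Sum>i\<in>I. \<Sum>j\<in>I. \<Sum>b'\<in>B. \<Sum>i'\<in>I. \<Sum>j'\<in>I. 
        w b * Om a b i * Om a' b j * (w b' * Om a b' i' * of_bool (near i i') * Om a' b' j'))"
      unfolding sum.cartesian_product' by (intro sum.cong refl) (auto simp: joint_def)
    also have "\<dots> = (\<Sum>b\<in>B. \<Sum>i\<in>I. \<Sum>j\<in>I. w b * Om a b i * Om a' b j * 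
        (\<Sum>b'\<in>B. \<Sum>i'\<in>I. of_bool (near i i') * (w b' * Om a b' i') * tot a' b'))"
      unfolding tot_def by (simp add: sum_distrib_left mult_ac)
    also have "\<dots> \<le> (\<Sum>b\<in>B. \<Sum>i\<in>I. \<Sum>j\<in>I. w b * Om a b i * Om a' b j * 
        (\<Sum>b'\<in>B. \<Sum>i'\<in>I. of_bool (near i i') * (w b' * Om a b' i') * U))"
      by (rule sum_mono, rule sum_mono, rule sum_mono, rule mult_left_mono, rule sum_mono, rule sum_mono, rule mult_left_mono)
        (auto intro!: tot_le mult_nonneg_nonneg w0 Om0 a)
    also have "\<dots> = (\<Sum>b\<in>B. \<Sum>i\<in>I. \<Sum>j\<in>I. w b * Om a b i * Om a' b j * 
        ((\<Sum>b'\<in>B. \<Sum>i'\<in>I. of_bool (near i i') * (w b' * Om a b' i')) * U))"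
      by (simp add: sum_distrib_right)
    also have "\<dots> \<le> (\<Sum>b\<in>B. \<Sum>i\<in>I. \<Sum>j\<in>I. w b * Om a b i * Om a' b j * (N0 * V * U))"
      by (rule sum_mono, rule sum_mono, rule sum_mono, rule mult_left_mono, rule mult_right_mono)
        (auto intro!: near_row mult_nonneg_nonneg w0 Om0 a simp: pos less_imp_le)
    also have "\<dots> = (\<Sum>b\<in>B. w b * tot a b * tot a' b) * (N0 * U * V)"
      unfolding tot_def by (simp add: sum_distrib_left sum_distrib_right mult_ac)
    finally show ?thesis .
  qed
  have "quad (\<lambda>_ _ x y. case x of (b,i,j) \<Rightarrow> case y of (b',i',j') \<Rightarrow> of_bool (near i i')) \<le>
     (\<Sum>a\<in>A. \<Sum>a'\<in>A. w a * w a' * ((\<Sum>b\<in>B. w b * tot a b * tot a' b) * (N0 * U * V)))"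
    unfolding quad_def by (rule sum_mono, rule sum_mono, rule mult_left_mono) (auto intro!: 1 w0 mult_nonneg_nonneg)
  also have "\<dots> = (\<Sum>a\<in>A. \<Sum>a'\<in>A. \<Sum>b\<in>B. N0 * U * V * (w b * (w a * tot a b) * (w a' * tot a' b)))"
    by (simp add: sum_distrib_left sum_distrib_right mult_ac)
  also have "\<dots> = (\<Sum>a\<in>A. \<Sum>b\<in>B. \<Sum>a'\<in>A. N0 * U * V * (w b * (w a * tot a b) * (w a' * tot a' b)))"
    by (intro sum.cong refl sum.swap)
  also have "\<dots> = (\<Sum>b\<in>B. \<Sum>a\<in>A. \<Sum>a'\<in>A. N0 * U * V * (w b * (w a * tot a b) * (w a' * tot a' b)))"
    by (rule sum.swap)
  also have "\<dots> = N0 * U * V * SB"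
    unfolding SB_def dB_def power2_eq_square sum_product by (simp add: sum_distrib_left mult_ac)
  finally show ?thesis .
qed

text \<open>Exchanging \<open>a\<close> with \<open>a'\<close> and \<open>i\<close> with
  \<open>j\<close> leaves \<open>joint\<close> unchanged and turns this form into the previous
  one.\<close>

lemma quad_near_jj: "quad (\<lambda>_ _ x y. case x of (b,i,j) \<Rightarrow> case y of (b',i',j') \<Rightarrow> of_bool (near j j')) \<le> N0 * U * V * SB"
proof -
  have sw: "(\<Sum>x\<in>X. \<Sum>y\<in>X. joint a' a x * joint a' a y * (case x of (b,i,j) \<Rightarrow> case y of (b',i',j') \<Rightarrow> of_bool (near j j'))) =
      (\<Sum>x\<in>X. \<Sum>y\<in>X. joint a a' x * joint a a' y * (case x of (b,i,j) \<Rightarrow> case y of (b',i',j') \<Rightarrow> of_bool (near i i')))" for a a'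
  proof -
    let ?s = "\<lambda>(b,i,j). (b,j,i) :: 'p \<times> nat \<times> nat"
    have bij: "bij_betw ?s X X"
      by (rule bij_betwI[where g = ?s]) auto
    have m: "joint a' a (?s x) = joint a a' x" for x by (cases x) (simp add: joint_def)
    show ?thesis
      by (subst sum.reindex_bij_betw[OF bij, symmetric], subst sum.reindex_bij_betw[OF bij, symmetric])
        (simp add: m, simp add: split_beta)
  qed
  have "quad (\<lambda>_ _ x y. case x of (b,i,j) \<Rightarrow> case y of (b',i',j') \<Rightarrow> of_bool (near j j')) =
    quad (\<lambda>_ _ x y. case x of (b,i,j) \<Rightarrow> case y of (b',i',j') \<Rightarrow> of_bool (near i i'))"
    unfolding quad_def by (subst sum.swap) (simp only: sw mult.commute[of "w _" "w _"])
  then show ?thesis using quad_near_ii by simp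
qed

lemma quad_deg: "quad (\<lambda>_ _ x y. of_bool (deg x y)) \<le> 2 * N0 * U * V * (SA + SB)"
proof -
  let ?f = "\<lambda>x. (case x of (b::'p,i,j) \<Rightarrow> of_bool (near i j)) :: real"
  let ?g = "\<lambda>x y. (case x of (b::'p,i,j::nat) \<Rightarrow> case y of (b'::'p,i',j'::nat) \<Rightarrow> of_bool (near i i')) :: real"
  let ?h = "\<lambda>x y. (case x of (b::'p,i::nat,j) \<Rightarrow> case y of (b'::'p,i'::nat,j') \<Rightarrow> of_bool (near j j')) :: real"
  have "quad (\<lambda>_ _ x y. of_bool (deg x y)) \<le> quad (\<lambda>_ _ x y. (?f x + ?f y) + (?g x y + ?h x y))"
    by (rule quad_mono) (auto simp: deg_def of_bool_def split: if_splits)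
  also have "\<dots> = (quad (\<lambda>_ _ x y. ?f x) + quad (\<lambda>_ _ x y. ?f y)) + (quad (\<lambda>_ _ x y. ?g x y) + quad (\<lambda>_ _ x y. ?h x y))"
    unfolding quad_add ..
  also have "quad (\<lambda>_ _ x y. ?f y) = quad (\<lambda>_ _ x y. ?f x)" by (rule quad_swap_xy)
  also have "(quad (\<lambda>_ _ x y. ?f x) + quad (\<lambda>_ _ x y. ?f x)) + (quad (\<lambda>_ _ x y. ?g x y) + quad (\<lambda>_ _ x y. ?h x y))
     \<le> 2 * N0 * U * V * (SA + SB)"
    using quad_near_ij quad_near_ii quad_near_jj by (simp add: algebra_simps)
  finally show ?thesis .
qed

section \<open>Dyadic separation of the two arcs of a triple\<close>

definition siblings :: "nat \<Rightarrow> 'p \<times> nat \<times> nat \<Rightarrow> bool" where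
  "siblings m = (\<lambda>(b, i, j). i div 2^(m+1) = j div 2^(m+1) \<and> i div 2^m \<noteq> j div 2^m)"

text \<open>\<open>m + 1\<close> is the lowest level at which the two indices share an ancestor. At
  level \<open>L\<close> every index below \<open>2^L\<close> has ancestor 0, which bounds
  \<open>m\<close>.\<close>

lemma ex_siblings:
  assumes "i < 2^L" "j < 2^L" "i \<noteq> j"
  shows "\<exists>m<L. siblings m (b, i, j)"
proof -
  define n where "n = (LEAST n. i div 2^n = j div 2^n)"
  have L: "i div 2^L = j div 2^L" using assms by simp
  then have n: "i div 2^n = j div 2^n" and nL: "n \<le> L"
    unfolding n_def by (rule LeastI, rule Least_le)
  have "n \<noteq> 0" using n assms(3) by (intro notI) simp
  then obtain m where m: "n = Suc m" using not0_implies_Suc by blast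
  have "i div 2^m \<noteq> j div 2^m"
    using not_less_Least[of m "\<lambda>n. i div 2^n = j div 2^n"] m unfolding n_def by auto
  then show ?thesis using n nL unfolding m siblings_def by (intro exI[of _ m]) auto
qed

definition common :: "'p \<Rightarrow> 'p \<Rightarrow> bool" where
  "common a a' = (\<exists>b\<in>B. \<exists>i<2^L. \<exists>j<2^L. Om a b i > 0 \<and> Om a' b j > 0)"

definition active :: "'p \<Rightarrow> 'p \<Rightarrow> nat \<Rightarrow> ('p \<times> nat \<times> nat) set" where
  "active a a' m = {(b, i, j) \<in> X. joint a a' (b, i, j) \<noteq> 0 \<and> \<not> near i j \<and> siblings m (b, i, j)}"

lemma active_signs:
  assumes aa: "a \<in> A" "a' \<in> A" and x: "(b, i, j) \<in> active a a' m"
  shows "F a' i < F a i" "F a j < F a' j"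
proof -
  have *: "b \<in> B" "i < 2^L" "j < 2^L" "\<not> near i j" "joint a a' (b,i,j) \<noteq> 0" using x unfolding active_def by auto
  note O = joint_pos_D[OF *(5)]
  have "\<not> near j i" using *(4) near_sym by blast
  then show "F a' i < F a i"
    using edge[OF aa(1) *(1,2) O(2)] far[OF aa(2) *(1,3) O(3) *(2)] by simp
  show "F a j < F a' j"
    using edge[OF aa(2) *(1,3) O(3)] far[OF aa(1) *(1,2) O(2) *(3,4)] by simp
qed

text \<open>Each block contributes a point where \<open>a\<close> is above \<open>a'\<close> and one
  where it is below. Two blocks with equal internal order already give four alternations; with
  opposite orders the two inner points have the same sign, and a point of the third block supplies
  the missing alternation.\<close>

lemma three_blocks:
  assumes aa: "a \<in> A" "a' \<in> A"
    and i: "i1 \<noteq> j1" "max i1 j1 < min i2 j2" "max i2 j2 < min i3 j3" "i2 \<noteq> j2" "i3 < 2^L" "j3 < 2^L"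
    and s: "F a' i1 < F a i1" "F a j1 < F a' j1" "F a' i2 < F a i2" "F a j2 < F a' j2"
      "F a' i3 < F a i3" "F a j3 < F a' j3"
  shows False
proof (cases "i1 < j1"; cases "i2 < j2")
  assume "i1 < j1" "i2 < j2"
  then show False using altF[OF aa(2,1), of i1 j1 i2 j2] i s by auto
next
  assume "i1 < j1" "\<not> i2 < j2"
  then show False using altF[OF aa(2,1), of i1 j1 i2 j3] i s by auto
next
  assume "\<not> i1 < j1" "i2 < j2"
  then show False using altF[OF aa, of j1 i1 j2 i3] i s by auto
next
  assume "\<not> i1 < j1" "\<not> i2 < j2"
  then show False using altF[OF aa, of j1 i1 j2 i2] i s by auto
qed

lemma div_less_less:
  fixes i :: nat assumes "i div n < j div n" shows "i < j"
  using assms by (metis div_le_mono linorder_not_less)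

lemma card_parents:
  assumes aa: "a \<in> A" "a' \<in> A"
  shows "card ((\<lambda>(b, i, j). i div 2^(m+1)) ` active a a' m) \<le> 2" (is "card ?P \<le> 2")
proof (rule ccontr)
  assume "\<not> card ?P \<le> 2"
  then have "3 \<le> card ?P" by simp
  then obtain P where P: "P \<subseteq> ?P" "card P = 3" by (rule obtain_subset_with_card_n)
  then obtain x y z where xyz: "P = {x, y, z}" "x \<noteq> y" "y \<noteq> z" "x \<noteq> z" by (auto simp: card_3_iff)
  have par: "\<exists>b i j. (b,i,j) \<in> active a a' m \<and> x = i div 2^(m+1)" if x: "x \<in> ?P" for x
  proof -
    obtain p where "p \<in> active a a' m" "x = (\<lambda>(b, i, j). i div 2^(m+1)) p" using x by blast
    then show ?thesis by (cases p) auto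
  qed
  have *: False if h: "x \<in> ?P" "y \<in> ?P" "z \<in> ?P" "x < y" "y < z" for x y z
  proof -
    obtain b1 i1 j1 where 1: "(b1,i1,j1) \<in> active a a' m" "x = i1 div 2^(m+1)" using par[OF h(1)] by blast
    obtain b2 i2 j2 where 2: "(b2,i2,j2) \<in> active a a' m" "y = i2 div 2^(m+1)" using par[OF h(2)] by blast
    obtain b3 i3 j3 where 3: "(b3,i3,j3) \<in> active a a' m" "z = i3 div 2^(m+1)" using par[OF h(3)] by blast
    have e: "x = j1 div 2^(m+1)" "y = j2 div 2^(m+1)" "z = j3 div 2^(m+1)" "i3 < 2^L" "j3 < 2^L"
      using 1 2 3 unfolding active_def siblings_def by auto
    have ne: "i1 \<noteq> j1" "i2 \<noteq> j2" using 1 2 near_refl unfolding active_def by auto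
    have "i1 < i2 \<and> i1 < j2 \<and> j1 < i2 \<and> j1 < j2" "i2 < i3 \<and> i2 < j3 \<and> j2 < i3 \<and> j2 < j3"
      using h(4,5) 1(2) 2(2) 3(2) e(1-3) div_less_less[of _ "2^(m+1)"] by metis+
    then have lt: "max i1 j1 < min i2 j2" "max i2 j2 < min i3 j3" by auto
    show False
      by (rule three_blocks[OF aa ne(1) lt ne(2) e(4,5) active_signs[OF aa 1(1)] active_signs[OF aa 2(1)] active_signs[OF aa 3(1)]])
  qed
  have "x \<in> ?P" "y \<in> ?P" "z \<in> ?P" using P xyz by auto
  then show False using * xyz(2-4) by (metis linorder_neqE_nat)
qed

lemma finite_active: "finite (active a a' m)"
  unfolding active_def by (rule finite_subset[OF _ finite_X]) auto

lemma card_keys: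
  assumes aa: "a \<in> A" "a' \<in> A"
  shows "card (blk m ` active a a' m) \<le> 4"
proof -
  let ?P = "(\<lambda>(b, i, j). i div 2^(m+1)) ` active a a' m"
  have "blk m ` active a a' m \<subseteq> (\<lambda>p. (2*p, 2*p+1)) ` ?P \<union> (\<lambda>p. (2*p+1, 2*p)) ` ?P"
  proof
    fix k assume "k \<in> blk m ` active a a' m"
    then obtain b i j where x: "(b,i,j) \<in> active a a' m" and k: "k = (i div 2^m, j div 2^m)"
      unfolding blk_def by auto
    define p where "p = i div 2^(m+1)"
    have pP: "p \<in> ?P" unfolding p_def by (rule image_eqI[OF _ x]) simp
    have "i div 2^m div 2 = p" "j div 2^m div 2 = p" "i div 2^m \<noteq> j div 2^m"
      using x unfolding active_def siblings_def p_def by (auto simp: div_mult2_eq[symmetric] mult.commute)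
    then have "k = (2*p, 2*p+1) \<or> k = (2*p+1, 2*p)" unfolding k by auto
    then show "k \<in> (\<lambda>p. (2*p, 2*p+1)) ` ?P \<union> (\<lambda>p. (2*p+1, 2*p)) ` ?P" using pP by blast
  qed
  moreover have fin: "finite ?P" using finite_active by auto
  ultimately have "card (blk m ` active a a' m) \<le> card ((\<lambda>p. (2*p, 2*p+1)) ` ?P \<union> (\<lambda>p. (2*p+1, 2*p)) ` ?P)"
    by (intro card_mono) auto
  also have "\<dots> \<le> card ((\<lambda>p. (2*p, 2*p+1)) ` ?P) + card ((\<lambda>p. (2*p+1, 2*p)) ` ?P)" by (rule card_Un_le)
  also have "\<dots> \<le> card ?P + card ?P" by (intro add_mono card_image_le fin)
  also have "\<dots> \<le> 4" using card_parents[OF aa, of m] by simp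
  finally show ?thesis .
qed

abbreviation off_diagonal :: "'p \<Rightarrow> 'p \<Rightarrow> nat \<Rightarrow> real" where
  "off_diagonal a a' m \<equiv> (\<Sum>k | k \<in> blk m ` X \<and> fst k \<noteq> snd k. (\<Sum>x | x \<in> X \<and> blk m x = k. joint a a' x)\<^sup>2)"

text \<open>Two different indices are separated at exactly one dyadic level, and at most four pairs of sibling
  blocks carry weight at each level. Hence \<open>C \<le> k0 + C\<^sup>2 / k0\<close> turns the bound for the squares of the block
  weights into one for the weights themselves.\<close>

lemma active_sum:
  assumes aa: "a \<in> A" "a' \<in> A" and k0: "k0 > 0"
  shows "(\<Sum>x\<in>active a a' m. joint a a' x) \<le> 4 * k0 * of_bool (common a a') + (1/k0) * off_diagonal a a' m"
proof -
  let ?K = "blk m ` active a a' m"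
  let ?C = "\<lambda>k. (\<Sum>x | x \<in> X \<and> blk m x = k. joint a a' x)"
  have sub: "active a a' m \<subseteq> X" unfolding active_def by auto
  have "(\<Sum>x\<in>active a a' m. joint a a' x) = (\<Sum>k\<in>?K. \<Sum>x | x \<in> active a a' m \<and> blk m x = k. joint a a' x)"
    by (rule sum.image_gen[OF finite_active])
  also have "\<dots> \<le> (\<Sum>k\<in>?K. ?C k)"
    by (intro sum_mono sum_mono2) (use finite_X sub joint_nonneg in auto)
  also have "\<dots> \<le> (\<Sum>k\<in>?K. k0 + (1/k0) * (?C k)\<^sup>2)"
  proof (rule sum_mono)
    fix k
    have "0 \<le> ?C k" by (intro sum_nonneg joint_nonneg)
    moreover have "?C k * k0 \<le> k0 * k0 + (?C k)\<^sup>2"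
      using \<open>0 \<le> ?C k\<close> k0 by (cases "?C k \<le> k0") (auto simp: power2_eq_square intro: add_increasing add_increasing2 mult_mono)
    ultimately show "?C k \<le> k0 + (1/k0) * (?C k)\<^sup>2" using k0 by (simp add: field_simps power2_eq_square)
  qed
  also have "\<dots> = k0 * card ?K + (1/k0) * (\<Sum>k\<in>?K. (?C k)\<^sup>2)"
    by (simp add: sum.distrib sum_distrib_left)
  also have "\<dots> \<le> 4 * k0 * of_bool (common a a') + (1/k0) * off_diagonal a a' m"
  proof (rule add_mono)
    show "k0 * card ?K \<le> 4 * k0 * of_bool (common a a')"
    \<comment> \<open>There are no blocks at all unless \<open>a\<close> and \<open>a'\<close> have
      a common neighbour. Keeping this indicator is what later yields \<open>W * R\<close> instead
      of the square of \<open>W\<close>.\<close>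
    proof (cases "active a a' m = {}")
      case True then show ?thesis using k0 by simp
    next
      case False
      then obtain b i j where "(b,i,j) \<in> active a a' m" by auto
      then have "common a a'" unfolding active_def common_def using joint_pos_D by blast
      then show ?thesis using card_keys[OF aa, of m] k0 by simp
    qed
    have "(\<Sum>k\<in>?K. (?C k)\<^sup>2) \<le> off_diagonal a a' m"
    proof (rule sum_mono2)
      show "?K \<subseteq> {k \<in> blk m ` X. fst k \<noteq> snd k}"
      proof
        fix k assume "k \<in> ?K"
        then obtain x where "x \<in> active a a' m" "k = blk m x" by blast
        moreover have "fst k \<noteq> snd k" using calculation by (cases x) (auto simp: active_def siblings_def blk_def)
        ultimately show "k \<in> {k \<in> blk m ` X. fst k \<noteq> snd k}" using sub by blast
      qed
    qed (use finite_X in auto)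
    then show "(1/k0) * (\<Sum>k\<in>?K. (?C k)\<^sup>2) \<le> (1/k0) * off_diagonal a a' m"
      using k0 by (intro mult_left_mono) auto
  qed
  finally show ?thesis .
qed

lemma sum_joint_decomp:
  assumes aa: "a \<in> A" "a' \<in> A"
  shows "(\<Sum>x\<in>X. joint a a' x) \<le> (\<Sum>(b,i,j)\<in>X. joint a a' (b,i,j) * of_bool (near i j)) + (\<Sum>m<L. \<Sum>x\<in>active a a' m. joint a a' x)"
proof -
  have "(\<Sum>m<L. \<Sum>x\<in>active a a' m. joint a a' x) = (\<Sum>m<L. \<Sum>x\<in>X. joint a a' x * of_bool (x \<in> active a a' m))"
    by (intro sum.cong refl sum.mono_neutral_cong_left) (auto simp: finite_X active_def)
  also have "\<dots> = (\<Sum>x\<in>X. \<Sum>m<L. joint a a' x * of_bool (x \<in> active a a' m))" by (rule sum.swap)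
  finally have e: "(\<Sum>m<L. \<Sum>x\<in>active a a' m. joint a a' x) = (\<Sum>x\<in>X. \<Sum>m<L. joint a a' x * of_bool (x \<in> active a a' m))" .
  have "(\<Sum>x\<in>X. joint a a' x) \<le> (\<Sum>x\<in>X. (case x of (b,i,j) \<Rightarrow> joint a a' (b,i,j) * of_bool (near i j)) + (\<Sum>m<L. joint a a' x * of_bool (x \<in> active a a' m)))"
  proof (rule sum_mono)
    fix x assume x: "x \<in> X"
    obtain b i j where xe: "x = (b,i,j)" by (cases x) auto
    have nn: "0 \<le> (\<Sum>m<L. joint a a' x * of_bool (x \<in> active a a' m))" by (intro sum_nonneg mult_nonneg_nonneg joint_nonneg) auto
    show "joint a a' x \<le> (case x of (b,i,j) \<Rightarrow> joint a a' (b,i,j) * of_bool (near i j)) + (\<Sum>m<L. joint a a' x * of_bool (x \<in> active a a' m))"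
    proof (cases "near i j \<or> joint a a' x = 0")
      case True
      then show ?thesis using nn joint_nonneg[of a a' x] unfolding xe by auto
    next
      case False
      then have "i \<noteq> j" using near_refl by auto
      then obtain m where m: "m < L" "siblings m (b,i,j)" using ex_siblings[of i j b] x unfolding xe by auto
      then have "x \<in> active a a' m" using False x unfolding xe active_def by auto
      then have "joint a a' x \<le> (\<Sum>m\<in>{m}. joint a a' x * of_bool (x \<in> active a a' m))" by simp
      also have "\<dots> \<le> (\<Sum>m<L. joint a a' x * of_bool (x \<in> active a a' m))"
        by (rule sum_mono2) (use m joint_nonneg in auto)
      finally show ?thesis using False unfolding xe by auto
    qed
  qed
  then show ?thesis unfolding e by (simp add: sum.distrib)
qed

lemma SB_eq: "SB = (\<Sum>a\<in>A. \<Sum>a'\<in>A. w a * w a' * (\<Sum>x\<in>X. joint a a' x))"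
proof -
  have "SB = (\<Sum>b\<in>B. \<Sum>a\<in>A. \<Sum>a'\<in>A. w a * w a' * (w b * tot a b * tot a' b))"
    unfolding SB_def dB_def power2_eq_square sum_product by (simp add: sum_distrib_left mult_ac)
  also have "\<dots> = (\<Sum>a\<in>A. \<Sum>b\<in>B. \<Sum>a'\<in>A. w a * w a' * (w b * tot a b * tot a' b))" by (rule sum.swap)
  also have "\<dots> = (\<Sum>a\<in>A. \<Sum>a'\<in>A. \<Sum>b\<in>B. w a * w a' * (w b * tot a b * tot a' b))"
    by (intro sum.cong refl sum.swap)
  finally show ?thesis unfolding sum_joint by (simp add: sum_distrib_left)
qed

lemma common_sum: "(\<Sum>a\<in>A. \<Sum>a'\<in>A. w a * w a' * of_bool (common a a')) \<le> W * R"
proof -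
  have "(\<Sum>a\<in>A. \<Sum>a'\<in>A. w a * w a' * of_bool (common a a')) = (\<Sum>a\<in>A. w a * (\<Sum>a' | a' \<in> A \<and> common a a'. w a'))"
    unfolding sum_distrib_left by (intro sum.cong refl sum.mono_neutral_cong_right) (auto simp: finA)
  also have "\<dots> \<le> (\<Sum>a\<in>A. w a * R)"
    by (intro sum_mono mult_left_mono w0) (use RA in \<open>auto simp: common_def\<close>)
  also have "\<dots> \<le> W * R" unfolding sum_distrib_right[symmetric] using WA pos by (intro mult_right_mono)
  finally show ?thesis .
qed

text \<open>The free parameter trades the number of contributing block pairs, each charged
  \<open>k0\<close>, against the quadratic bound divided by \<open>k0\<close>. A large
  \<open>k0\<close> lets the second moments on the right be absorbed.\<close>

lemma SB_bound:
  assumes k0: "k0 > 0"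
  shows "SB \<le> N0 * V * T + L * (4 * k0 * (W * R) + (1/k0) * (4 * N0 * U * V * (SA + SB)))"
proof -
  have "SB \<le> (\<Sum>a\<in>A. \<Sum>a'\<in>A. w a * w a' * ((\<Sum>(b,i,j)\<in>X. joint a a' (b,i,j) * of_bool (near i j)) + (\<Sum>m<L. \<Sum>x\<in>active a a' m. joint a a' x)))"
    unfolding SB_eq by (rule sum_mono, rule sum_mono, rule mult_left_mono) (auto intro!: sum_joint_decomp w0 mult_nonneg_nonneg)
  also have "\<dots> = (\<Sum>a\<in>A. \<Sum>a'\<in>A. w a * w a' * (\<Sum>(b,i,j)\<in>X. joint a a' (b,i,j) * of_bool (near i j)))
       + (\<Sum>a\<in>A. \<Sum>a'\<in>A. w a * w a' * (\<Sum>m<L. \<Sum>x\<in>active a a' m. joint a a' x))"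
    by (simp only: distrib_left sum.distrib)
  also have "\<dots> \<le> N0 * V * T + L * (4 * k0 * (W * R) + (1/k0) * (4 * N0 * U * V * (SA + SB)))"
  proof (rule add_mono[OF sum_near_total])
    have "(\<Sum>a\<in>A. \<Sum>a'\<in>A. w a * w a' * (\<Sum>m<L. \<Sum>x\<in>active a a' m. joint a a' x)) \<le>
       (\<Sum>a\<in>A. \<Sum>a'\<in>A. w a * w a' * (\<Sum>m<L. 4 * k0 * of_bool (common a a') + (1/k0) * off_diagonal a a' m))"
      by (rule sum_mono, rule sum_mono, rule mult_left_mono, rule sum_mono) (rule active_sum[OF _ _ k0], auto intro!: w0 mult_nonneg_nonneg)
    also have "\<dots> = (\<Sum>a\<in>A. \<Sum>a'\<in>A. \<Sum>m<L. 4 * k0 * (w a * w a' * of_bool (common a a')) + (1/k0) * (w a * w a' * off_diagonal a a' m))"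
    proof (rule sum.cong[OF refl], rule sum.cong[OF refl])
      fix a a'
      have "w a * w a' * (4 * k0 * x + (1/k0) * y) = 4 * k0 * (w a * w a' * x) + (1/k0) * (w a * w a' * y)" for x y
        by (simp add: algebra_simps)
      then show "w a * w a' * (\<Sum>m<L. 4 * k0 * of_bool (common a a') + (1/k0) * off_diagonal a a' m) =
          (\<Sum>m<L. 4 * k0 * (w a * w a' * of_bool (common a a')) + (1/k0) * (w a * w a' * off_diagonal a a' m))"
        by (subst sum_distrib_left) (intro sum.cong refl)
    qed
    also have "\<dots> = (\<Sum>a\<in>A. \<Sum>m<L. \<Sum>a'\<in>A. 4 * k0 * (w a * w a' * of_bool (common a a')) + (1/k0) * (w a * w a' * off_diagonal a a' m))"
      by (intro sum.cong refl sum.swap)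
    also have "\<dots> = (\<Sum>m<L. \<Sum>a\<in>A. \<Sum>a'\<in>A. 4 * k0 * (w a * w a' * of_bool (common a a')) + (1/k0) * (w a * w a' * off_diagonal a a' m))"
      by (rule sum.swap)
    also have "\<dots> = (\<Sum>m<L. 4 * k0 * (\<Sum>a\<in>A. \<Sum>a'\<in>A. w a * w a' * of_bool (common a a')) + (1/k0) * (\<Sum>a\<in>A. \<Sum>a'\<in>A. w a * w a' * off_diagonal a a' m))"
      by (rule sum.cong[OF refl]) (simp only: sum.distrib sum_distrib_left)
    also have "\<dots> \<le> (\<Sum>m<L. 4 * k0 * (W * R) + (1/k0) * (4 * N0 * U * V * (SA + SB)))"
    proof (rule sum_mono, rule add_mono)
      fix m
      show "4 * k0 * (\<Sum>a\<in>A. \<Sum>a'\<in>A. w a * w a' * of_bool (common a a')) \<le> 4 * k0 * (W * R)"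
        using common_sum k0 by (intro mult_left_mono) auto
      show "(1/k0) * (\<Sum>a\<in>A. \<Sum>a'\<in>A. w a * w a' * off_diagonal a a' m) \<le> (1/k0) * (4 * N0 * U * V * (SA + SB))"
        using offdiag_blocks[of m] quad_deg k0 by (intro mult_left_mono) auto
    qed
    also have "\<dots> = L * (4 * k0 * (W * R) + (1/k0) * (4 * N0 * U * V * (SA + SB)))" by simp
    finally show "(\<Sum>a\<in>A. \<Sum>a'\<in>A. w a * w a' * (\<Sum>m<L. \<Sum>x\<in>active a a' m. joint a a' x)) \<le> \<dots>" .
  qed
  finally show ?thesis .
qed

section \<open>Closing the estimate by absorption\<close>

lemma T_le_UWR: "T \<le> U * W * R"
proof -
  have "T = (\<Sum>a\<in>A. w a * dA a)" by (rule T_dA)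
  also have "\<dots> \<le> (\<Sum>a\<in>A. w a * (U * R))"
  proof (intro sum_mono mult_left_mono w0)
    fix a assume a: "a \<in> A"
    have "dA a = (\<Sum>b | b \<in> B \<and> (\<exists>i<2^L. Om a b i > 0). w b * tot a b)"
      unfolding dA_def
    proof (rule sum.mono_neutral_right)
      show "\<forall>b\<in>B - {b \<in> B. \<exists>i<2 ^ L. 0 < Om a b i}. w b * tot a b = 0"
        unfolding tot_def using Om0 by (auto simp: not_less intro!: sum.neutral antisym)
    qed (use finB in auto)
    also have "\<dots> \<le> (\<Sum>b | b \<in> B \<and> (\<exists>i<2^L. Om a b i > 0). w b * U)"
      by (intro sum_mono mult_left_mono w0 tot_le a) auto
    also have "\<dots> \<le> R * U" unfolding sum_distrib_right[symmetric] using RAB[OF a] pos by (intro mult_right_mono) auto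
    finally show "dA a \<le> U * R" by (simp add: mult.commute)
  qed
  also have "\<dots> \<le> W * (U * R)" unfolding sum_distrib_right[symmetric] using WA pos by (intro mult_right_mono) auto
  finally show ?thesis by (simp add: mult_ac)
qed

lemma T_sq_le: "T\<^sup>2 \<le> W * SB"
proof -
  have "T = (\<Sum>b\<in>B. sqrt (w b) * (sqrt (w b) * dB b))" unfolding T_dB by (simp add: w0 mult.assoc[symmetric])
  then have "T\<^sup>2 \<le> (\<Sum>b\<in>B. (sqrt (w b))\<^sup>2) * (\<Sum>b\<in>B. (sqrt (w b) * dB b)\<^sup>2)"
    using Cauchy_Schwarz_ineq_sum[of "\<lambda>b. sqrt (w b)" "\<lambda>b. sqrt (w b) * dB b" B] by simp
  also have "\<dots> = (\<Sum>b\<in>B. w b) * SB" unfolding SB_def by (simp add: w0 power_mult_distrib)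
  also have "\<dots> \<le> W * SB" using WB SB_nonneg by (intro mult_right_mono)
  finally show ?thesis .
qed

lemma T_bound_aux:
  assumes "SA \<le> SB"
  shows "T\<^sup>2 \<le> 130 * N0 * (L + 1)\<^sup>2 * U * V * R * W\<^sup>2"
proof -
  \<comment> \<open>With \<open>SA \<le> SB\<close> the quadratic term is at most
    \<open>8 * L * N0 * U * V * SB / k0\<close>; the factor \<open>16 * (L + 1)\<close> brings this
    below \<open>SB / 2\<close>.\<close>
  define k0 where "k0 = 16 * (real L + 1) * N0 * U * V"
  have k0: "k0 > 0" unfolding k0_def using pos by simp
  define Z where "Z = N0 * U * V"
  have Z: "Z > 0" unfolding Z_def using pos by simp
  have kZ: "k0 = 16 * (real L + 1) * Z" unfolding k0_def Z_def by simp
  have "L * ((1/k0) * (4 * N0 * U * V * (SA + SB))) \<le> SB / 2"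
  proof -
    have "(1/k0) * (4 * N0 * U * V * (SA + SB)) = (4 * Z) / (16 * (real L + 1) * Z) * (SA + SB)"
      unfolding kZ by (simp add: Z_def)
    also have "(4 * Z) / (16 * (real L + 1) * Z) = 1 / (4 * (real L + 1))"
      using nonzero_mult_divide_mult_cancel_right[of "4 * Z" 1 "4 * (real L + 1)"] Z by (simp add: mult_ac)
    finally have "L * ((1/k0) * (4 * N0 * U * V * (SA + SB))) = (L / (4 * (real L + 1))) * (SA + SB)" by simp
    also have "\<dots> \<le> (1/4) * (SA + SB)" using SA_nonneg SB_nonneg by (intro mult_right_mono) (auto simp: field_simps)
    also have "\<dots> \<le> SB / 2" using assms by simp
    finally show ?thesis .
  qed
  then have "SB \<le> N0 * V * T + L * (4 * k0 * (W * R)) + SB / 2" using SB_bound[OF k0] by (simp add: distrib_left)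
  then have SB: "SB \<le> 2 * (N0 * V * T) + 2 * (L * (4 * k0 * (W * R)))" by simp
  have "W * (2 * (N0 * V * T)) \<le> W * (2 * (N0 * V * (U * W * R)))"
    using T_le_UWR pos by (intro mult_left_mono) auto
  also have "\<dots> = 2 * (Z * R * W\<^sup>2)" unfolding Z_def by (simp add: power2_eq_square)
  also have "\<dots> \<le> 2 * ((L + 1)\<^sup>2 * (Z * R * W\<^sup>2))"
    using mult_right_mono[of 1 "(real L + 1)\<^sup>2" "Z * R * W\<^sup>2"] Z pos by (simp add: add.commute)
  finally have 1: "W * (2 * (N0 * V * T)) \<le> 2 * ((L + 1)\<^sup>2 * (Z * R * W\<^sup>2))" .
  have "W * (2 * (L * (4 * k0 * (W * R)))) = 128 * ((real L * (real L + 1)) * (Z * R * W\<^sup>2))"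
    unfolding kZ by (simp add: power2_eq_square)
  also have "\<dots> \<le> 128 * ((L + 1)\<^sup>2 * (Z * R * W\<^sup>2))"
    using Z pos by (intro mult_left_mono mult_right_mono) (auto simp: power2_eq_square algebra_simps)
  finally have 2: "W * (2 * (L * (4 * k0 * (W * R)))) \<le> 128 * ((L + 1)\<^sup>2 * (Z * R * W\<^sup>2))" .
  have "T\<^sup>2 \<le> W * SB" by (rule T_sq_le)
  also have "\<dots> \<le> W * (2 * (N0 * V * T) + 2 * (L * (4 * k0 * (W * R))))"
    using SB pos by (intro mult_left_mono) auto
  \<comment> \<open>130 = 2 + 128: the near pairs give 2, and 128 = 2 * 4 * 16 comes from
    \<open>k0\<close> after doubling for the absorbed half.\<close>
  also have "\<dots> \<le> 130 * ((L + 1)\<^sup>2 * (Z * R * W\<^sup>2))" using 1 2 unfolding distrib_left by linarith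
  finally show ?thesis unfolding Z_def by (simp add: mult_ac)
qed

theorem T_bound: "T\<^sup>2 \<le> 130 * N0 * (L + 1)\<^sup>2 * U * V * R * W\<^sup>2"
proof (cases "SA \<le> SB")
  case True then show ?thesis by (rule T_bound_aux)
next
  case False
  interpret s: tangency B A w L "\<lambda>b a. Om a b" "\<lambda>b i. - G b i" "\<lambda>a i. - F a i" near \<epsilon> N0 U V R W
    by (rule swapped)
  have tot: "s.tot b a = tot a b" for a b unfolding s.tot_def tot_def ..
  have "s.dA = dB" "s.dB = dA" unfolding s.dA_def dB_def s.dB_def dA_def tot by simp_all
  then have "s.SA = SB" "s.SB = SA" unfolding s.SA_def SB_def s.SB_def SA_def by simp_all
  moreover have "s.T = T" unfolding s.T_def T_def tot by (subst sum.swap) (simp add: mult_ac)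
  ultimately show ?thesis using s.T_bound_aux False by simp
qed

end

section \<open>Trigonometric profiles\<close>

text \<open>In half angles \<open>h\<close> is a quadratic form in cosine and sine, an element of a
  three-dimensional space, so its values at four angles satisfy a linear relation. The coefficients
  are products of sines of half differences, positive within one period and taken with alternating
  signs, which excludes four alternating values.\<close>

lemma trig_no_alternation:
  fixes p q r :: real
  defines "h \<equiv> \<lambda>\<theta>. p * cos \<theta> + q * sin \<theta> + r"
  assumes t: "0 \<le> t1" "t1 < t2" "t2 < t3" "t3 < t4" "t4 < 2 * pi"
    and h: "h t1 < 0" "h t2 > 0" "h t3 < 0" "h t4 > 0"
  shows False
proof -
  define s where "s x y = sin (y / 2) * cos (x / 2) - cos (y / 2) * sin (x / 2)" for x y :: real
  have s_pos: "s x y > 0" if "x < y" "0 \<le> x" "y < 2 * pi" for x y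
    using that sin_gt_zero[of "y/2 - x/2"] unfolding s_def by (simp add: sin_diff)
  have h_half: "h x = p * ((cos (x/2))\<^sup>2 - (sin (x/2))\<^sup>2) + q * (2 * sin (x/2) * cos (x/2)) + r * ((cos (x/2))\<^sup>2 + (sin (x/2))\<^sup>2)" for x
    unfolding h_def using cos_double[of "x/2"] sin_double[of "x/2"] by (simp add: add.commute)
  have "s t2 t3 * s t3 t4 * s t2 t4 * h t1 - s t1 t3 * s t3 t4 * s t1 t4 * h t2
      + s t1 t2 * s t2 t4 * s t1 t4 * h t3 - s t1 t2 * s t2 t3 * s t1 t3 * h t4 = 0"
    unfolding h_half s_def by algebra
  moreover have "s t2 t3 * s t3 t4 * s t2 t4 * h t1 < 0" "s t1 t3 * s t3 t4 * s t1 t4 * h t2 > 0"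
      "s t1 t2 * s t2 t4 * s t1 t4 * h t3 < 0" "s t1 t2 * s t2 t3 * s t1 t3 * h t4 > 0"
    using t h s_pos by (auto intro!: mult_pos_pos mult_pos_neg)
  ultimately show False by linarith
qed

text \<open>\<open>t0\<close> is where the sinusoid is minimal, and the squared sine measures the
  quadratic growth away from it. For a difference of two curves this isolates the place of near
  tangency.\<close>

lemma trig_normal_form:
  fixes p q :: real
  assumes "p \<noteq> 0 \<or> q \<noteq> 0"
  obtains t0 where "0 \<le> t0" "t0 < 2 * pi"
    "\<And>\<theta>. p * cos \<theta> + q * sin \<theta> = 2 * sqrt (p\<^sup>2 + q\<^sup>2) * (sin ((\<theta> - t0) / 2))\<^sup>2 - sqrt (p\<^sup>2 + q\<^sup>2)"
proof -
  define P where "P = sqrt (p\<^sup>2 + q\<^sup>2)"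
  have P: "P > 0" unfolding P_def using assms by (auto simp: sum_power2_gt_zero_iff)
  have P2: "P\<^sup>2 = p\<^sup>2 + q\<^sup>2" unfolding P_def by simp
  have "(- p / P)\<^sup>2 + (- q / P)\<^sup>2 = (p\<^sup>2 + q\<^sup>2) / P\<^sup>2" by (simp only: power_divide add_divide_distrib power2_minus)
  also have "\<dots> = P\<^sup>2 / P\<^sup>2" unfolding P2 ..
  also have "\<dots> = 1" using P by simp
  finally have "(- p / P)\<^sup>2 + (- q / P)\<^sup>2 = 1" .
  then obtain t0 where t0: "0 \<le> t0" "t0 < 2 * pi" "- p / P = cos t0" "- q / P = sin t0"
    using sincos_total_2pi by metis
  have pq: "p = - P * cos t0" "q = - P * sin t0" using t0(3,4) P by (auto simp: field_simps)
  have "p * cos \<theta> + q * sin \<theta> = 2 * P * (sin ((\<theta> - t0) / 2))\<^sup>2 - P" for \<theta>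
  proof -
    have "p * cos \<theta> + q * sin \<theta> = - P * cos (\<theta> - t0)" unfolding pq by (simp add: cos_diff algebra_simps)
    also have "cos (\<theta> - t0) = cos (2 * ((\<theta> - t0) / 2))" by (rule arg_cong[where f=cos]) argo
    also have "\<dots> = 1 - 2 * (sin ((\<theta> - t0) / 2))\<^sup>2" by (rule cos_double_sin)
    finally show ?thesis by (simp add: algebra_simps)
  qed
  then show thesis using that[OF t0(1,2)] unfolding P_def by blast
qed

text \<open>Where the sine is at most 3/4 in absolute value, the cosine is at least 1/2, so the mean
  value theorem inverts the sine with constant 2.\<close>

lemma sin_separation:
  fixes x y :: real
  assumes xy: "- (pi/2) \<le> x" "x \<le> pi/2" "- (pi/2) \<le> y" "y \<le> pi/2"
    and s: "\<bar>sin x\<bar> \<le> 3/4" "\<bar>sin y\<bar> \<le> 3/4"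
  shows "\<bar>x - y\<bar> \<le> 2 * \<bar>sin x - sin y\<bar>"
proof -
  have *: "y - x \<le> 2 * \<bar>sin y - sin x\<bar>" if h: "x < y" "- (pi/2) \<le> x" "y \<le> pi/2" "\<bar>sin x\<bar> \<le> 3/4" "\<bar>sin y\<bar> \<le> 3/4" for x y :: real
  proof -
    obtain z where z: "x < z" "z < y" "sin y - sin x = (y - x) * cos z"
      using MVT2[OF h(1), of sin cos] by (auto intro: DERIV_sin)
    have "sin x \<le> sin z" "sin z \<le> sin y"
      using z that by (auto intro!: sin_monotone_2pi_le)
    then have "\<bar>sin z\<bar> \<le> 3/4" using that by auto
    then have "(sin z)\<^sup>2 \<le> (3/4)\<^sup>2" by (subst abs_le_square_iff[symmetric]) simp
    then have "(cos z)\<^sup>2 \<ge> (1/2)\<^sup>2" using sin_cos_squared_add[of z] by (simp add: power2_eq_square)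
    then have "1/2 \<le> \<bar>cos z\<bar>" using abs_le_square_iff[of "1/2" "cos z"] by simp
    then have "(y - x) * (1/2) \<le> (y - x) * \<bar>cos z\<bar>" using that by (intro mult_left_mono) auto
    also have "\<dots> = \<bar>sin y - sin x\<bar>" unfolding z(3) abs_mult using that by simp
    finally show ?thesis by simp
  qed
  show ?thesis
    using *[of x y] *[of y x] assms by (cases x y rule: linorder_cases) (auto simp: abs_minus_commute)
qed

text \<open>Half the chord between two division points of a unit circle cut into \<open>2^L\<close>
  arcs; the sine takes care of wrap-around. The constant 11 is dictated by
  \<open>profile_small\<close>.\<close>

definition near :: "nat \<Rightarrow> nat \<Rightarrow> nat \<Rightarrow> bool" where
  "near L i j \<longleftrightarrow> \<bar>sin (pi * (real i - real j) / 2^L)\<bar> \<le> 11 / 2^L"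

lemma near_refl: "near L i i" unfolding near_def by simp

lemma near_sym: "near L i j \<Longrightarrow> near L j i"
proof -
  have "pi * (real j - real i) / 2^L = - (pi * (real i - real j) / 2^L)" by (simp add: field_simps)
  then show "near L i j \<Longrightarrow> near L j i" unfolding near_def by (metis abs_minus_cancel sin_minus)
qed

text \<open>Inverting the sine bounds the cyclic distance by 22 / pi, which is below 8. So there are
  at most 15 indices around \<open>i\<close> and 7 at either end for wrap-around, 29 in all. For
  \<open>L \<le> 3\<close> all indices together are few enough.\<close>

lemma near_card:
  assumes i: "i < 2^L"
  shows "card {j. j < 2^L \<and> near L i j} \<le> 30"
proof (cases "L \<le> 3")
  case True
  have "card {j::nat. j < 2^L \<and> near L i j} \<le> card {..<2^L::nat}" by (intro card_mono) auto
  also have "\<dots> \<le> 2^3" using power_increasing[OF True, of "2::nat"] by simp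
  finally show ?thesis by simp
next
  case False
  define n :: nat where "n = 2^L"
  have "(2::nat)^4 \<le> 2^L" using False by (intro power_increasing) auto
  then have n: "16 \<le> n" unfolding n_def by simp
  have "{j. j < n \<and> near L i j} \<subseteq> {i - 7..i + 7} \<union> {n - 7..<n} \<union> {..<7}"
  proof
    fix j assume "j \<in> {j. j < n \<and> near L i j}"
    then have j: "j < n" and nr: "\<bar>sin (pi * (real i - real j) / n)\<bar> \<le> 11 / n"
      unfolding near_def n_def by auto
    define d where "d = \<bar>real i - real j\<bar>"
    have d: "0 \<le> d" "d < n" using i j unfolding d_def n_def[symmetric] by linarith+
    have "pi * (real i - real j) / n = pi * d / n \<or> pi * (real i - real j) / n = - (pi * d / n)"
      unfolding d_def by (cases "i \<le> j") (auto simp: field_simps)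
    then have "\<bar>sin (pi * (real i - real j) / n)\<bar> = \<bar>sin (pi * d / n)\<bar>" by (elim disjE) (simp_all only: sin_minus abs_minus_cancel)
    then have s: "\<bar>sin (pi * d / n)\<bar> \<le> 11 / n" using nr by simp
    have small: "11 / real n \<le> 3/4" using n by (simp add: field_simps)
    have pi3: "pi > 3" using pi_gt3 .
    have "d < 8 \<or> n - d < 8"
    proof (cases "pi * d / n \<le> pi/2")
      case True
      have "\<bar>pi * d / n - 0\<bar> \<le> 2 * \<bar>sin (pi * d / n) - sin 0\<bar>"
        by (rule sin_separation) (use True d s small in \<open>auto intro: order_trans[of _ 0]\<close>)
      then have "pi * d / n \<le> 22 / n" using s d by simp
      then have "pi * d \<le> 22" using n by (simp add: divide_le_cancel)
      moreover have "3 * d \<le> pi * d" using pi3 d by (intro mult_right_mono) auto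
      ultimately show ?thesis by (intro disjI1) linarith
    next
      case False
      define y where "y = pi * (n - d) / n"
      have y: "y = pi - pi * d / n" unfolding y_def using n by (simp add: field_simps)
      have y0: "0 \<le> y" unfolding y_def using d by simp
      have sy: "sin y = sin (pi * d / n)" unfolding y by simp
      have "\<bar>y - 0\<bar> \<le> 2 * \<bar>sin y - sin 0\<bar>"
        by (rule sin_separation) (use y0 False y s small sy in \<open>auto intro: order_trans[of _ 0]\<close>)
      then have "y \<le> 2 * (11 / n)" using s y0 sy by simp
      then have "pi * (n - d) / n \<le> 22 / n" unfolding y_def by simp
      then have "pi * (n - d) \<le> 22" using n by (simp add: divide_le_cancel)
      moreover have "3 * (n - d) \<le> pi * (n - d)" using pi3 d by (intro mult_right_mono) auto
      ultimately show ?thesis by argo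
    qed
    then show "j \<in> {i - 7..i + 7} \<union> {n - 7..<n} \<union> {..<7}"
      using i j unfolding d_def n_def[symmetric] by (auto simp: abs_if split: if_splits)
  qed
  then have "card {j. j < n \<and> near L i j} \<le> card ({i - 7..i + 7} \<union> {n - 7..<n} \<union> {..<7})"
    by (intro card_mono) auto
  also have "\<dots> \<le> card {i - 7..i + 7} + card {n - 7..<n} + card {..<7::nat}"
    by (meson add_le_mono1 card_Un_le le_trans)
  also have "\<dots> \<le> 30" by simp
  finally show ?thesis unfolding n_def .
qed

lemma sin_lipschitz: "\<bar>sin x - sin y\<bar> \<le> \<bar>x - y\<bar>" for x y :: real
proof -
  have *: "\<bar>sin y - sin x\<bar> \<le> y - x" if h: "x < y" for x y :: real
  proof -
    obtain z where z: "sin y - sin x = (y - x) * cos z"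
      using MVT2[OF h, of sin cos] by (auto intro: DERIV_sin)
    show ?thesis unfolding z abs_mult using h mult_left_mono[OF abs_cos_le_one[of z], of "y - x"] by simp
  qed
  show ?thesis using *[of x y] *[of y x] by (cases x y rule: linorder_cases) (auto simp: abs_minus_commute)
qed

text \<open>\<open>\<phi>\<close> has minimum \<open>\<sigma>\<close> at \<open>t0\<close> and is
  small somewhere on arc \<open>i\<close>. With \<open>l = 1 / 2^L\<close>, the squared sine at the
  end of that arc is at most 18.3 \<open>l^2\<close>, whereas beyond \<open>near\<close> it is at
  least 44 \<open>l^2\<close>; the threshold \<open>38 * \<Delta>\<close> lies between the resulting
  values even after the loss of 2 in \<open>P\<close> and of \<open>\<sigma>\<close>.\<close>

lemma profile_small:
  fixes t0 \<theta> r P \<sigma> :: real and L i :: nat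
  defines "\<Delta> \<equiv> r / 4^L" and "c \<equiv> \<lambda>i::nat. 2 * pi * real i / 2^L"
  defines "\<phi> \<equiv> \<lambda>\<theta>. \<sigma> + 2 * P * (sin ((\<theta> - t0) / 2))\<^sup>2"
  assumes P: "r / 2 < P" "P \<le> r" "\<bar>\<sigma>\<bar> \<le> \<Delta>" "D \<le> \<Delta> / 4"
    and \<theta>: "c i \<le> \<theta>" "\<theta> \<le> c (Suc i)" "\<bar>\<phi> \<theta>\<bar> \<le> D"
  shows "\<phi> (c i) \<le> 38 * \<Delta>" and "\<not> near L i j \<Longrightarrow> \<phi> (c j) > 38 * \<Delta>"
proof -
  have r: "r > 0" using P(1,2) by linarith
  define l where "l = 1 / (2::real)^L"
  have l: "l > 0" unfolding l_def by simp
  have l2: "l\<^sup>2 = 1 / 4^L" unfolding l_def by (simp add: power2_eq_square power_mult_distrib[symmetric])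
  have D: "\<Delta> = r * l\<^sup>2" unfolding \<Delta>_def l2 by simp
  define u where "u \<theta> = sin ((\<theta> - t0) / 2)" for \<theta>
  have "2 * P * (u \<theta>)\<^sup>2 \<le> 5/4 * (r * l\<^sup>2)" using \<theta>(3) P(3,4) unfolding \<phi>_def u_def[symmetric] D by linarith
  moreover have "r * (u \<theta>)\<^sup>2 \<le> 2 * P * (u \<theta>)\<^sup>2" using P(1) by (intro mult_right_mono) auto
  ultimately have "r * (u \<theta>)\<^sup>2 \<le> r * (5/4 * l\<^sup>2)" by simp
  then have "(u \<theta>)\<^sup>2 \<le> 5/4 * l\<^sup>2" using r by simp
  \<comment> \<open>112/100 is slightly above the square root of 5/4. Moving to the left end of the
    arc changes the half angle by at most \<open>pi * l\<close>, below 315/100 \<open>l\<close>,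
    which explains 427/100.\<close>
  moreover have "(112/100 * l)\<^sup>2 = 12544/10000 * l\<^sup>2" by (simp add: power2_eq_square)
  ultimately have "(u \<theta>)\<^sup>2 \<le> (112/100 * l)\<^sup>2" using zero_le_power2[of l] by linarith
  then have u: "\<bar>u \<theta>\<bar> \<le> 112/100 * l" using l by (simp add: abs_le_square_iff[symmetric])
  have "\<bar>u (c i) - u \<theta>\<bar> \<le> \<bar>(c i - t0) / 2 - (\<theta> - t0) / 2\<bar>" unfolding u_def by (rule sin_lipschitz)
  also have "(c i - t0) / 2 - (\<theta> - t0) / 2 = (c i - \<theta>) / 2" by (simp add: diff_divide_distrib)
  also have "\<bar>(c i - \<theta>) / 2\<bar> \<le> (c (Suc i) - c i) / 2" using \<theta>(1,2) by simp
  also have "\<dots> = pi * l" unfolding c_def l_def by (simp add: field_simps)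
  also have "\<dots> \<le> 315/100 * l" using l pi_approx by (intro mult_right_mono) auto
  finally have ui: "\<bar>u (c i)\<bar> \<le> 427/100 * l" using u l by linarith
  then have "(u (c i))\<^sup>2 \<le> (427/100 * l)\<^sup>2" using l by (simp add: abs_le_square_iff[symmetric])
  moreover have "(427/100 * l)\<^sup>2 = 182329/10000 * l\<^sup>2" by (simp add: power2_eq_square)
  ultimately have u2: "(u (c i))\<^sup>2 \<le> 183/10 * l\<^sup>2" using zero_le_power2[of l] by linarith
  have "2 * P * (u (c i))\<^sup>2 \<le> 2 * r * (183/10 * l\<^sup>2)" using P r u2 by (intro mult_mono) auto
  then show "\<phi> (c i) \<le> 38 * \<Delta>" using P(3) mult_nonneg_nonneg[OF less_imp_le[OF r] zero_le_power2[of l]] unfolding \<phi>_def u_def[symmetric] D by linarith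
  assume "\<not> near L i j"
  then have n: "\<bar>sin (pi * (real i - real j) / 2^L)\<bar> > 11 * l" unfolding near_def l_def by simp
  have "sin (pi * (real i - real j) / 2^L) = sin ((c i - t0) / 2 - (c j - t0) / 2)"
    unfolding c_def by (intro arg_cong[where f=sin]) (simp add: field_simps)
  also have "\<dots> = u (c i) * cos ((c j - t0) / 2) - cos ((c i - t0) / 2) * u (c j)"
    unfolding u_def sin_diff ..
  finally have "\<bar>sin (pi * (real i - real j) / 2^L)\<bar> \<le> \<bar>u (c i) * cos ((c j - t0) / 2)\<bar> + \<bar>cos ((c i - t0) / 2) * u (c j)\<bar>"
    by linarith
  also have "\<dots> \<le> \<bar>u (c i)\<bar> * 1 + 1 * \<bar>u (c j)\<bar>"
    unfolding abs_mult by (intro add_mono mult_mono) auto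
  \<comment> \<open>From 11 at least 4.27 is subtracted at worst, leaving 6.7, whose square exceeds
    44; subtracting \<open>\<Delta>\<close> for \<open>\<sigma>\<close> still leaves
    \<open>43 * \<Delta>\<close>.\<close>
  finally have uj: "\<bar>u (c j)\<bar> \<ge> 67/10 * l" using n ui l by simp
  then have "(67/10 * l)\<^sup>2 \<le> (u (c j))\<^sup>2" using l by (simp add: abs_le_square_iff[symmetric])
  moreover have "(67/10 * l)\<^sup>2 = 4489/100 * l\<^sup>2" by (simp add: power2_eq_square)
  ultimately have "44 * l\<^sup>2 \<le> (u (c j))\<^sup>2" using zero_le_power2[of l] by linarith
  then have "r * (44 * l\<^sup>2) \<le> 2 * P * (u (c j))\<^sup>2" using P(1) r by (intro mult_mono) auto
  moreover have "r * l\<^sup>2 > 0" using r l by simp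
  ultimately show "\<phi> (c j) > 38 * \<Delta>" using P(3) unfolding \<phi>_def u_def[symmetric] D by linarith
qed

text \<open>The Frostman condition for finite weights, imposed only at scales from
  \<open>\<delta>\<close> upwards. Subsets with bounded pairwise distances replace balls, so no
  centres have to be chosen.\<close>

definition frostman :: "'a::metric_space set \<Rightarrow> ('a \<Rightarrow> real) \<Rightarrow> real \<Rightarrow> real \<Rightarrow> real \<Rightarrow> bool" where
  "frostman X \<mu> \<delta> s C \<longleftrightarrow> finite X \<and> (\<forall>x. 0 \<le> \<mu> x) \<and>
     (\<forall>Y\<subseteq>X. \<forall>l\<ge>\<delta>. (\<forall>x\<in>Y. \<forall>y\<in>Y. dist x y \<le> l) \<longrightarrow> sum \<mu> Y \<le> C * l powr s)"

lemma frostmanD: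
  assumes "frostman X \<mu> \<delta> s C"
  shows "finite X" "0 \<le> \<mu> x"
    "\<lbrakk>Y \<subseteq> X; \<delta> \<le> l; \<And>x y. \<lbrakk>x \<in> Y; y \<in> Y\<rbrakk> \<Longrightarrow> dist x y \<le> l\<rbrakk> \<Longrightarrow> sum \<mu> Y \<le> C * l powr s"
  using assms unfolding frostman_def by blast+

text \<open>The half angle runs through \<open>[-pi, pi]\<close>, where the sine has three monotone
  branches. On each, the window pulls back to angles within \<open>4 * l\<close> of one another: a
  factor 2 from inverting the sine and a factor 2 from the half angle. Staying inside
  \<open>[-3/4, 3/4]\<close> avoids the turning points.\<close>

lemma sine_window_mass:
  assumes fr: "frostman \<Theta> \<nu> \<delta> e C" and \<Theta>: "\<Theta> \<subseteq> {0..<2 * pi}" and t0: "0 \<le> t0" "t0 < 2 * pi"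
    and c: "- (3/4) \<le> c" "c + l \<le> 3/4" "4 * l \<le> m" "\<delta> \<le> m"
  shows "(\<Sum>\<theta> | \<theta> \<in> \<Theta> \<and> c \<le> sin ((\<theta> - t0) / 2) \<and> sin ((\<theta> - t0) / 2) \<le> c + l. \<nu> \<theta>) \<le> 3 * (C * m powr e)"
proof -
  define S where "S = {\<theta> \<in> \<Theta>. c \<le> sin ((\<theta> - t0) / 2) \<and> sin ((\<theta> - t0) / 2) \<le> c + l}"
  define S1 where "S1 = {\<theta> \<in> S. (\<theta> - t0) / 2 < - (pi/2)}"
  define S2 where "S2 = {\<theta> \<in> S. - (pi/2) \<le> (\<theta> - t0) / 2 \<and> (\<theta> - t0) / 2 \<le> pi/2}"
  define S3 where "S3 = {\<theta> \<in> S. pi/2 < (\<theta> - t0) / 2}"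
  have fin: "finite S" unfolding S_def using frostmanD(1)[OF fr] by auto
  have range: "- pi \<le> (\<theta> - t0) / 2" "(\<theta> - t0) / 2 \<le> pi" if "\<theta> \<in> S" for \<theta>
    using that \<Theta> t0 unfolding S_def by auto
  have close: "\<bar>u - v\<bar> \<le> 2 * l"
    if "- (pi/2) \<le> u" "u \<le> pi/2" "- (pi/2) \<le> v" "v \<le> pi/2" "c' \<le> sin u" "sin u \<le> c' + l" "c' \<le> sin v" "sin v \<le> c' + l"
      "- (3/4) \<le> c'" "c' + l \<le> 3/4" for u v c'
  proof -
    have "\<bar>u - v\<bar> \<le> 2 * \<bar>sin u - sin v\<bar>" by (rule sin_separation) (use that in auto)
    also have "\<dots> \<le> 2 * l" using that by auto
    finally show ?thesis .
  qed
  have SD: "c \<le> sin ((\<theta> - t0) / 2)" "sin ((\<theta> - t0) / 2) \<le> c + l" if "\<theta> \<in> S" for \<theta>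
    using that unfolding S_def by auto
  have half: "\<bar>(x - t0) / 2 - (y - t0) / 2\<bar> = \<bar>x - y\<bar> / 2" for x y :: real
    by (simp add: diff_divide_distrib[symmetric])
  have 2: "sum \<nu> S2 \<le> C * m powr e"
  proof (rule frostmanD(3)[OF fr])
    fix x y assume "x \<in> S2" "y \<in> S2"
    then have "\<bar>(x - t0) / 2 - (y - t0) / 2\<bar> \<le> 2 * l"
      using SD c unfolding S2_def by (intro close[of _ _ c]) auto
    then show "dist x y \<le> m" unfolding half dist_real_def using c by simp
  qed (use c in \<open>auto simp: S2_def S_def\<close>)
  have 3: "sum \<nu> S3 \<le> C * m powr e"
  proof (rule frostmanD(3)[OF fr])
    fix x y assume xy: "x \<in> S3" "y \<in> S3"
    have lo: "- (pi/2) \<le> pi - (z - t0) / 2" if "z \<in> S3" for z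
    proof -
      have "(z - t0) / 2 \<le> pi" using range(2)[of z] that unfolding S3_def by blast
      then show ?thesis using pi_gt_zero by linarith
    qed
    from xy have "\<bar>(pi - (x - t0) / 2) - (pi - (y - t0) / 2)\<bar> \<le> 2 * l"
      using SD[of x] SD[of y] lo[OF xy(1)] lo[OF xy(2)] c unfolding S3_def by (intro close[of _ _ c]) auto
    then have "\<bar>(y - t0) / 2 - (x - t0) / 2\<bar> \<le> 2 * l" by simp
    then show "dist x y \<le> m" unfolding half dist_real_def using c by (simp add: abs_minus_commute)
  qed (use c in \<open>auto simp: S3_def S_def\<close>)
  have 1: "sum \<nu> S1 \<le> C * m powr e"
  proof (rule frostmanD(3)[OF fr])
    fix x y assume xy: "x \<in> S1" "y \<in> S1"
    \<comment> \<open>The left branch is moved to the central one by adding pi, which negates the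
      sine and turns the window into \<open>[-(c + l), -c]\<close>.\<close>
    have s: "sin (pi + z) = - sin z" for z :: real by simp
    have lo: "- (pi/2) \<le> pi + (z - t0) / 2" "pi + (z - t0) / 2 \<le> pi / 2" if "z \<in> S1" for z
    proof -
      have "- pi \<le> (z - t0) / 2" "(z - t0) / 2 < - (pi/2)" using range(1)[of z] that unfolding S1_def by blast+
      then show "- (pi/2) \<le> pi + (z - t0) / 2" "pi + (z - t0) / 2 \<le> pi / 2" using pi_gt_zero by linarith+
    qed
    have "\<bar>(pi + (x - t0) / 2) - (pi + (y - t0) / 2)\<bar> \<le> 2 * l"
      using xy SD[of x] SD[of y] c
      by (intro close[of _ _ "- (c + l)"] lo) (auto simp: s S1_def)
    then have "\<bar>(x - t0) / 2 - (y - t0) / 2\<bar> \<le> 2 * l" by simp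
    then show "dist x y \<le> m" unfolding half dist_real_def using c by simp
  qed (use c in \<open>auto simp: S1_def S_def\<close>)
  have "S = S1 \<union> (S2 \<union> S3)" unfolding S1_def S2_def S3_def by auto
  then have "sum \<nu> S = sum \<nu> (S1 \<union> (S2 \<union> S3))" by simp
  also have "\<dots> = sum \<nu> S1 + (sum \<nu> S2 + sum \<nu> S3)"
  proof (subst sum.union_disjoint)
    show "S1 \<inter> (S2 \<union> S3) = {}" unfolding S1_def S2_def S3_def by (auto, smt (verit) pi_gt_zero)
    show "sum \<nu> S1 + sum \<nu> (S2 \<union> S3) = sum \<nu> S1 + (sum \<nu> S2 + sum \<nu> S3)"
      by (subst sum.union_disjoint) (use fin in \<open>auto simp: S1_def S2_def S3_def\<close>)
  qed (use fin in \<open>auto simp: S1_def S2_def S3_def\<close>)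
  finally show ?thesis using 1 2 3 unfolding S_def by linarith
qed

text \<open>In the unresolved class the angles fill one window around the minimum, of width
  comparable to \<open>l = 1 / 2^L\<close>. In the resolved class a positive defect leaves no
  angles, and a negative one leaves two transversal crossings, each with a window of width at most
  \<open>4 * D / (r * l)\<close>. Hence two windows, and 6 = 2 * 3.\<close>

lemma profile_mass:
  fixes r D :: real and L :: nat
  defines "\<Delta> \<equiv> r / 4^L"
  assumes fr: "frostman \<Theta> \<nu> \<delta> e C" and \<Theta>: "\<Theta> \<subseteq> {0..<2 * pi}" and t0: "0 \<le> t0" "t0 < 2 * pi"
    and P: "r / 2 < P" "P \<le> r" "\<bar>\<sigma>\<bar> \<le> \<Delta>" "- P \<le> \<sigma>" and D: "0 < D" "D \<le> \<Delta> / 4"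
    and cls: "\<Delta> \<le> 16 * D \<and> 1 \<le> L \<or> \<Delta> / 4 < \<bar>\<sigma>\<bar> \<and> 16 * D < \<Delta>"
    and \<delta>: "\<delta> \<le> 144 * D * 2^L / r" and C: "0 \<le> C"
  shows "(\<Sum>\<theta> | \<theta> \<in> \<Theta> \<and> \<bar>\<sigma> + 2 * P * (sin ((\<theta> - t0) / 2))\<^sup>2\<bar> \<le> D. \<nu> \<theta>) \<le> 6 * (C * (144 * D * 2^L / r) powr e)"
proof -
  define m where "m = 144 * D * 2^L / r"
  have r: "r > 0" using P(1,2) by linarith
  define l where "l = 1 / (2::real)^L"
  have l: "l > 0" unfolding l_def by simp
  have l2: "l\<^sup>2 = 1 / 4^L" unfolding l_def by (simp add: power2_eq_square power_mult_distrib[symmetric])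
  have De: "\<Delta> = r * l\<^sup>2" unfolding \<Delta>_def l2 by simp
  have me: "m * (r * l) = 144 * D" unfolding m_def l_def using r by simp
  define u where "u \<theta> = sin ((\<theta> - t0) / 2)" for \<theta>
  let ?S = "{\<theta> \<in> \<Theta>. \<bar>\<sigma> + 2 * P * (u \<theta>)\<^sup>2\<bar> \<le> D}"
  have fin: "finite \<Theta>" using frostmanD(1)[OF fr] .
  have nn: "0 \<le> C * m powr e" using C by simp
  have win: "(\<Sum>\<theta> | \<theta> \<in> \<Theta> \<and> c \<le> u \<theta> \<and> u \<theta> \<le> c + k. \<nu> \<theta>) \<le> 3 * (C * m powr e)"
    if "- (3/4) \<le> c" "c + k \<le> 3/4" "4 * k \<le> m" for c k
    using sine_window_mass[OF fr \<Theta> t0 that \<delta>[folded m_def]] unfolding u_def .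
  have "sum \<nu> ?S \<le> 6 * (C * m powr e)"
    using cls
  proof (elim disjE conjE)
    assume A: "\<Delta> \<le> 16 * D" "1 \<le> L"
    have "l \<le> 1/2" unfolding l_def using power_increasing[OF A(2), of "2::real"] by (simp add: field_simps)
    define a where "a = 112/100 * l"
    have "?S \<subseteq> {\<theta> \<in> \<Theta>. - a \<le> u \<theta> \<and> u \<theta> \<le> - a + 2 * a}"
    proof (intro subsetI CollectI conjI)
      fix \<theta> assume \<theta>: "\<theta> \<in> ?S"
      then show "\<theta> \<in> \<Theta>" by simp
      have "2 * P * (u \<theta>)\<^sup>2 \<le> 5/4 * (r * l\<^sup>2)" using \<theta> P(3) D(2) unfolding De[symmetric] by simp linarith
      moreover have "r * (u \<theta>)\<^sup>2 \<le> 2 * P * (u \<theta>)\<^sup>2" using P(1) by (intro mult_right_mono) auto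
      ultimately have "r * (u \<theta>)\<^sup>2 \<le> r * (5/4 * l\<^sup>2)" by simp
      then have "(u \<theta>)\<^sup>2 \<le> 5/4 * l\<^sup>2" using r by simp
      moreover have "a\<^sup>2 = 12544/10000 * l\<^sup>2" unfolding a_def by (simp add: power2_eq_square)
      ultimately have "(u \<theta>)\<^sup>2 \<le> a\<^sup>2" using zero_le_power2[of l] by linarith
      then have "\<bar>u \<theta>\<bar> \<le> a" using l unfolding a_def by (simp add: abs_le_square_iff[symmetric])
      then show "- a \<le> u \<theta>" "u \<theta> \<le> - a + 2 * a" by auto
    qed
    then have "sum \<nu> ?S \<le> (\<Sum>\<theta> | \<theta> \<in> \<Theta> \<and> - a \<le> u \<theta> \<and> u \<theta> \<le> - a + 2 * a. \<nu> \<theta>)"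
      by (intro sum_mono2) (use fin frostmanD(2)[OF fr] in auto)
    also have "\<dots> \<le> 3 * (C * m powr e)"
    proof (rule win)
      \<comment> \<open>The constant 144 = 9 * 16 is fixed here: \<open>4 * (2 * a)\<close> is below
        \<open>9 * l\<close>, and the class condition gives the factor 16.\<close>
      have "r * l * l \<le> 16 * D" using A(1) unfolding De by (simp add: power2_eq_square mult.assoc)
      then have "9 * l * (r * l) \<le> m * (r * l)" unfolding me by (simp add: mult_ac)
      then have "9 * l \<le> m" using r l by (simp add: mult_le_cancel_right)
      then show "4 * (2 * a) \<le> m" unfolding a_def using l by simp
    qed (use \<open>l \<le> 1/2\<close> l in \<open>auto simp: a_def\<close>)
    finally show ?thesis using nn by linarith
  next
    assume A: "\<Delta> / 4 < \<bar>\<sigma>\<bar>" "16 * D < \<Delta>"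
    show ?thesis
    proof (cases "\<sigma> > 0")
      case True
      have "?S = {}"
      proof (intro equals0I)
        fix \<theta> assume "\<theta> \<in> ?S"
        moreover have "0 \<le> 2 * P * (u \<theta>)\<^sup>2" using P(1) r by auto
        ultimately show False using True A D by auto
      qed
      then have "sum \<nu> ?S = 0" by (simp only: sum.empty)
      then show ?thesis using nn by simp
    next
      case False
      have osign: "\<sigma> < - (\<Delta> / 4)" using A False by auto
      define a where "a = sqrt ((- \<sigma> - D) / (2 * P))"
      define b where "b = sqrt ((- \<sigma> + D) / (2 * P))"
      have P0: "P > 0" using P r by auto
      have \<Delta>0: "\<Delta> > 0" using r l unfolding De by simp
      have a2: "a\<^sup>2 = (- \<sigma> - D) / (2 * P)" "b\<^sup>2 = (- \<sigma> + D) / (2 * P)" and ab0: "0 \<le> a" "0 \<le> b" "a \<le> b"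
        unfolding a_def b_def using osign A D P0 \<Delta>0 by (auto intro!: divide_nonneg_pos divide_right_mono)
      \<comment> \<open>Together with \<open>- \<sigma> \<le> P\<close> and \<open>r < 2 * P\<close>
        this gives \<open>b^2 \<le> 1/2 + 1/16 = 9/16\<close>, exactly what the sine window
        admits.\<close>
      have "D \<le> r / 16"
      proof -
        have "r * 1 \<le> r * 4^L" using r by (intro mult_left_mono) auto
        then have "\<Delta> \<le> r" unfolding \<Delta>_def by (simp add: divide_le_eq)
        then show ?thesis using A(2) by linarith
      qed
      then have "b\<^sup>2 \<le> (3/4)\<^sup>2"
        unfolding a2 using P0 P(1,4) by (simp add: field_simps power2_eq_square)
      then have b34: "b \<le> 3/4" using ab0 by (simp add: power2_le_iff_abs_le)
      have "(1/4 * l)\<^sup>2 \<le> a\<^sup>2"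
      proof -
        have "r * l\<^sup>2 / 16 * (2 * P) \<le> r * (r * l\<^sup>2) / 8" using P(2) r l by (simp add: mult_left_mono)
        also have "\<dots> \<le> r * (- \<sigma> - D)" 
        proof -
          have "\<Delta> / 8 \<le> - \<sigma> - D" using osign A(2) \<Delta>0 by linarith
          from mult_left_mono[OF this, of r] show ?thesis using r unfolding De by simp
        qed
        finally have "r * (l\<^sup>2 / 16 * (2 * P)) \<le> r * (- \<sigma> - D)" by (simp add: mult_ac)
        then have "l\<^sup>2 / 16 * (2 * P) \<le> - \<sigma> - D" using r by (simp only: mult_le_cancel_left_pos)
        then show ?thesis unfolding a2 using P0 by (simp add: field_simps power2_eq_square)
      qed
      then have al: "l / 4 \<le> a" using ab0 l by (simp add: abs_le_square_iff[symmetric])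
      have "(b - a) * (b + a) = D / P"
      proof -
        have "(b - a) * (b + a) = b\<^sup>2 - a\<^sup>2" by (simp add: power2_eq_square algebra_simps)
        also have "\<dots> = D / P" unfolding a2 using P0 by (simp add: field_simps)
        finally show ?thesis .
      qed
      moreover have "(b - a) * (l / 2) \<le> (b - a) * (b + a)" using al ab0 by (intro mult_left_mono) auto
      moreover have "D / P \<le> 2 * D / r" using P(1) P0 D r by (simp add: field_simps)
      ultimately have "(b - a) * (l / 2) \<le> 2 * D / r" by linarith
      then have "4 * (b - a) * (r * l) \<le> 16 * D" using r by (simp add: field_simps)
      also have "\<dots> \<le> m * (r * l)" unfolding me using D by simp
      finally have bam: "4 * (b - a) \<le> m" using r l by (simp add: mult_le_cancel_right)
      have "?S \<subseteq> {\<theta> \<in> \<Theta>. a \<le> u \<theta> \<and> u \<theta> \<le> a + (b - a)} \<union> {\<theta> \<in> \<Theta>. - b \<le> u \<theta> \<and> u \<theta> \<le> - b + (b - a)}"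
      proof
        fix \<theta> assume \<theta>: "\<theta> \<in> ?S"
        then have "- \<sigma> - D \<le> 2 * P * (u \<theta>)\<^sup>2" "2 * P * (u \<theta>)\<^sup>2 \<le> - \<sigma> + D" by auto
        then have "a\<^sup>2 \<le> (u \<theta>)\<^sup>2" "(u \<theta>)\<^sup>2 \<le> b\<^sup>2" unfolding a2 using P0 by (auto simp: field_simps)
        then have "a \<le> \<bar>u \<theta>\<bar>" "\<bar>u \<theta>\<bar> \<le> b" using ab0 by (auto simp: abs_le_square_iff[symmetric])
        then show "\<theta> \<in> {\<theta> \<in> \<Theta>. a \<le> u \<theta> \<and> u \<theta> \<le> a + (b - a)} \<union> {\<theta> \<in> \<Theta>. - b \<le> u \<theta> \<and> u \<theta> \<le> - b + (b - a)}"
          using \<theta> by (auto simp: abs_if split: if_splits)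
      qed
      then have "sum \<nu> ?S \<le> sum \<nu> ({\<theta> \<in> \<Theta>. a \<le> u \<theta> \<and> u \<theta> \<le> a + (b - a)} \<union> {\<theta> \<in> \<Theta>. - b \<le> u \<theta> \<and> u \<theta> \<le> - b + (b - a)})"
        by (intro sum_mono2) (use fin frostmanD(2)[OF fr] in auto)
      also have "\<dots> \<le> sum \<nu> {\<theta> \<in> \<Theta>. a \<le> u \<theta> \<and> u \<theta> \<le> a + (b - a)} + sum \<nu> {\<theta> \<in> \<Theta>. - b \<le> u \<theta> \<and> u \<theta> \<le> - b + (b - a)}"
        using fin frostmanD(2)[OF fr] by (subst sum_Un) (auto intro: sum_nonneg)
      also have "\<dots> \<le> 3 * (C * m powr e) + 3 * (C * m powr e)"
        by (intro add_mono win) (use ab0 b34 bam in auto)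
      finally show ?thesis by simp
    qed
  qed
  then show ?thesis unfolding u_def m_def .
qed

section \<open>Discretised projections\<close>

definition wave :: "real ^ 3 \<Rightarrow> real \<Rightarrow> real" where
  "wave z \<theta> = z $ 1 * cos \<theta> + z $ 2 * sin \<theta> + z $ 3"

definition pdist :: "real ^ 3 \<Rightarrow> real ^ 3 \<Rightarrow> real" where
  "pdist a b = sqrt ((b $ 1 - a $ 1)\<^sup>2 + (b $ 2 - a $ 2)\<^sup>2)"

text \<open>The minimum over all angles of the difference of the two curves. It vanishes exactly
  when \<open>b - a\<close> lies on the upper light cone, that is, when the curve of
  \<open>b\<close> touches that of \<open>a\<close> from above.\<close>

definition defect :: "real ^ 3 \<Rightarrow> real ^ 3 \<Rightarrow> real" where
  "defect a b = b $ 3 - a $ 3 - pdist a b"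

lemma pdist_nonneg: "0 \<le> pdist a b" unfolding pdist_def by simp

lemma wave_profile:
  assumes "0 < pdist a b"
  obtains t0 where "0 \<le> t0" "t0 < 2 * pi"
    "\<And>\<theta>. wave b \<theta> - wave a \<theta> = defect a b + 2 * pdist a b * (sin ((\<theta> - t0) / 2))\<^sup>2"
proof -
  have "b $ 1 - a $ 1 \<noteq> 0 \<or> b $ 2 - a $ 2 \<noteq> 0" using assms unfolding pdist_def by auto
  then obtain t0 where "0 \<le> t0" "t0 < 2 * pi" "\<And>\<theta>. (b $ 1 - a $ 1) * cos \<theta> + (b $ 2 - a $ 2) * sin \<theta> =
      2 * pdist a b * (sin ((\<theta> - t0) / 2))\<^sup>2 - pdist a b"
    using trig_normal_form[of "b $ 1 - a $ 1" "b $ 2 - a $ 2"] unfolding pdist_def by metis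
  then show thesis
    by (intro that[of t0]) (auto simp: wave_def defect_def algebra_simps)
qed

lemma abs_le_pdist: "\<bar>b $ 1 - a $ 1\<bar> \<le> pdist a b" "\<bar>b $ 2 - a $ 2\<bar> \<le> pdist a b"
  unfolding pdist_def by (auto intro: real_sqrt_sum_squares_ge1 real_sqrt_sum_squares_ge2 simp flip: real_sqrt_abs intro!: real_sqrt_le_mono)

lemma dist_le_coords: "dist a b \<le> 2 * pdist a b + \<bar>b $ 3 - a $ 3\<bar>" for a b :: "real ^ 3"
proof -
  have "dist a b = norm (b - a)" by (simp add: dist_norm norm_minus_commute)
  also have "\<dots> \<le> (\<Sum>i\<in>UNIV. \<bar>(b - a) $ i\<bar>)" by (rule norm_le_l1_cart)
  also have "\<dots> = \<bar>b $ 1 - a $ 1\<bar> + \<bar>b $ 2 - a $ 2\<bar> + \<bar>b $ 3 - a $ 3\<bar>" by (simp add: sum_3)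
  finally show ?thesis using abs_le_pdist[of b a] by linarith
qed

lemma pdist_le_dist: "pdist a b \<le> dist a b"
proof -
  have "(pdist a b)\<^sup>2 = (b $ 1 - a $ 1)\<^sup>2 + (b $ 2 - a $ 2)\<^sup>2" unfolding pdist_def by simp
  moreover have "(dist a b)\<^sup>2 = (b $ 1 - a $ 1)\<^sup>2 + (b $ 2 - a $ 2)\<^sup>2 + (b $ 3 - a $ 3)\<^sup>2"
    unfolding dist_norm power2_norm_eq_inner by (simp add: inner_vec_def sum_3 power2_eq_square algebra_simps)
  ultimately have "(pdist a b)\<^sup>2 \<le> (dist a b)\<^sup>2" by simp
  then show ?thesis by (rule power2_le_imp_le) simp
qed

lemma wave_no_alternation:
  assumes i: "i1 < i2" "i2 < i3" "i3 < i4" "i4 < (2::nat)^L"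
    and w: "wave a (2 * pi * real i1 / 2^L) < wave a' (2 * pi * real i1 / 2^L)"
      "wave a' (2 * pi * real i2 / 2^L) < wave a (2 * pi * real i2 / 2^L)"
      "wave a (2 * pi * real i3 / 2^L) < wave a' (2 * pi * real i3 / 2^L)"
      "wave a' (2 * pi * real i4 / 2^L) < wave a (2 * pi * real i4 / 2^L)"
  shows False
proof -
  define c where "c = (\<lambda>i::nat. 2 * pi * real i / 2^L)"
  have mono: "c i < c j" if "i < j" for i j using that unfolding c_def by (simp add: divide_strict_right_mono)
  have "real i4 < 2^L" using i(4) by (metis of_nat_less_iff of_nat_numeral of_nat_power)
  then have "c i4 < 2 * pi" unfolding c_def by (simp add: divide_less_eq)
  have wd: "wave x \<theta> - wave y \<theta> = (x $ 1 - y $ 1) * cos \<theta> + (x $ 2 - y $ 2) * sin \<theta> + (x $ 3 - y $ 3)" for x y \<theta>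
    unfolding wave_def by (simp add: algebra_simps)
  show False
    by (rule trig_no_alternation[of "c i1" "c i2" "c i3" "c i4" "a $ 1 - a' $ 1" "a $ 2 - a' $ 2" "a $ 3 - a' $ 3"])
      (use i mono \<open>c i4 < 2 * pi\<close> w in \<open>auto simp: wd[symmetric] c_def\<close>)
qed

text \<open>\<open>\<omega> \<theta>\<close> is an averaging kernel for the direction
  \<open>\<theta>\<close>: it couples points of one slab, with mass at most 1 per row and density at
  most \<open>1 / M0\<close>. In the application it is the inverse mass of the slab, and
  \<open>M0\<close> is a lower bound for the mass of the slabs that are kept.\<close>

locale projection_kernel =
  fixes Z :: "(real ^ 3) set" and w :: "real ^ 3 \<Rightarrow> real" and \<Theta> :: "real set" and \<nu> :: "real \<Rightarrow> real"
    and \<omega> :: "real \<Rightarrow> real ^ 3 \<Rightarrow> real ^ 3 \<Rightarrow> real" and k :: nat and e C M0 :: real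
  assumes frZ: "frostman Z w (1 / 2^k) e C" and fr\<Theta>: "frostman \<Theta> \<nu> (1 / 2^k) e C"
    and \<Theta>: "\<Theta> \<subseteq> {0..<2 * pi}"
    and \<omega>0: "\<And>\<theta> a b. 0 \<le> \<omega> \<theta> a b" and \<omega>sym: "\<And>\<theta> a b. \<omega> \<theta> a b = \<omega> \<theta> b a"
    and \<omega>row: "\<And>\<theta> a. \<theta> \<in> \<Theta> \<Longrightarrow> a \<in> Z \<Longrightarrow> (\<Sum>b\<in>Z. w b * \<omega> \<theta> a b) \<le> 1"
    and \<omega>le: "\<And>\<theta> a b. \<omega> \<theta> a b \<le> 1 / M0"
    and \<omega>supp: "\<And>\<theta> a b. \<lbrakk>\<theta> \<in> \<Theta>; a \<in> Z; b \<in> Z; \<omega> \<theta> a b > 0\<rbrakk> \<Longrightarrow> \<bar>wave a \<theta> - wave b \<theta>\<bar> \<le> 2 / 2^k"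
    and diam: "\<And>a b. a \<in> Z \<Longrightarrow> b \<in> Z \<Longrightarrow> dist a b \<le> 2"
    and e: "0 < e" "e \<le> 1" and C: "0 < C" and M0: "0 < M0"
begin

definition D :: real where "D = 2 / 2^k"
definition W :: real where "W = sum w Z"
definition NN :: real where "NN = sum \<nu> \<Theta>"

text \<open>Pairs at distance about \<open>r\<close> whose defect from tangency is about \<open>r / 4^L\<close>; all defects that are
  too small to be resolved at scale \<open>D\<close> form a single class.\<close>

definition cls :: "real \<Rightarrow> nat \<Rightarrow> real ^ 3 \<Rightarrow> real ^ 3 \<Rightarrow> bool" where
  "cls r L a b \<longleftrightarrow> r / 2 < pdist a b \<and> pdist a b \<le> r \<and> a $ 3 \<le> b $ 3 \<and> \<bar>defect a b\<bar> \<le> r / 4^L \<and> D \<le> r / 4^L / 4 \<and>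
     (r / 4^L \<le> 16 * D \<and> 1 \<le> L \<or> r / 4^L / 4 < \<bar>defect a b\<bar> \<and> 16 * D < r / 4^L)"

definition idx :: "nat \<Rightarrow> real \<Rightarrow> nat" where "idx L \<theta> = nat \<lfloor>\<theta> * 2^L / (2 * pi)\<rfloor>"

definition Om :: "real \<Rightarrow> nat \<Rightarrow> real ^ 3 \<Rightarrow> real ^ 3 \<Rightarrow> nat \<Rightarrow> real" where
  "Om r L a b i = (\<Sum>\<theta> | \<theta> \<in> \<Theta> \<and> idx L \<theta> = i. \<nu> \<theta> * \<omega> \<theta> a b * of_bool (cls r L a b))"

lemma D_pos: "D > 0" unfolding D_def by simp
lemma D_ge: "1 / 2^k \<le> D" unfolding D_def by (simp add: divide_right_mono)
lemma fin: "finite Z" "finite \<Theta>" using frostmanD(1) frZ fr\<Theta> by blast+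
lemma w0: "0 \<le> w x" and \<nu>0: "0 \<le> \<nu> \<theta>" using frostmanD(2) frZ fr\<Theta> by blast+

lemma idx:
  assumes "\<theta> \<in> \<Theta>"
  shows "2 * pi * real (idx L \<theta>) / 2^L \<le> \<theta>" "\<theta> \<le> 2 * pi * real (Suc (idx L \<theta>)) / 2^L" "idx L \<theta> < 2^L"
proof -
  have t: "0 \<le> \<theta>" "\<theta> < 2 * pi" using \<Theta> assms by auto
  define x where "x = \<theta> * 2^L / (2 * pi)"
  have x0: "0 \<le> x" unfolding x_def using t by simp
  have th: "\<theta> = 2 * pi * x / 2^L" unfolding x_def by simp
  have r: "real (idx L \<theta>) = of_int \<lfloor>x\<rfloor>" unfolding idx_def x_def[symmetric] using x0 by simp
  have lo: "real (idx L \<theta>) \<le> x" and hi: "x < real (Suc (idx L \<theta>))" using r by linarith+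
  have "2 * pi * real (idx L \<theta>) / 2^L \<le> 2 * pi * x / 2^L" using lo by (intro divide_right_mono mult_left_mono) auto
  then show "2 * pi * real (idx L \<theta>) / 2^L \<le> \<theta>" using th by simp
  have "2 * pi * x / 2^L \<le> 2 * pi * real (Suc (idx L \<theta>)) / 2^L" using hi by (intro divide_right_mono mult_left_mono) auto
  then show "\<theta> \<le> 2 * pi * real (Suc (idx L \<theta>)) / 2^L" using th by simp
  have "x < 2^L" unfolding x_def using t by (simp add: divide_less_eq mult.commute)
  then have "real (idx L \<theta>) < 2^L" using lo by linarith
  then show "idx L \<theta> < 2^L" by (metis of_nat_less_iff of_nat_numeral of_nat_power)
qed

lemma Om_posD:
  assumes "0 < Om r L a b i"
  obtains \<theta> where "\<theta> \<in> \<Theta>" "idx L \<theta> = i" "0 < \<omega> \<theta> a b" "cls r L a b"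
proof -
  have "\<exists>\<theta>. \<theta> \<in> \<Theta> \<and> idx L \<theta> = i \<and> \<nu> \<theta> * \<omega> \<theta> a b * of_bool (cls r L a b) \<noteq> 0"
  proof (rule ccontr)
    assume "\<not> ?thesis"
    then have "Om r L a b i = 0" unfolding Om_def by (intro sum.neutral) auto
    then show False using assms by simp
  qed
  then obtain \<theta> where t: "\<theta> \<in> \<Theta>" "idx L \<theta> = i" "\<omega> \<theta> a b \<noteq> 0" "cls r L a b" by auto
  then show thesis using that[of \<theta>] \<omega>0[of \<theta> a b] by auto
qed

lemma sum_Om: "(\<Sum>i<2^L. Om r L a b i) = (\<Sum>\<theta>\<in>\<Theta>. \<nu> \<theta> * \<omega> \<theta> a b * of_bool (cls r L a b))"
  unfolding Om_def by (rule sum.group) (use fin idx in auto)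

lemma cls_dist:
  assumes "cls r L a b" shows "dist a b \<le> 4 * r"
proof -
  have *: "pdist a b \<le> r" "\<bar>defect a b\<bar> \<le> r / 4^L" and r: "0 \<le> r" using assms pdist_nonneg[of a b] unfolding cls_def by auto
  have "r * 1 \<le> r * 4^L" using r by (intro mult_left_mono) auto
  then have "r / 4^L \<le> r" by (simp add: divide_le_eq)
  then have "\<bar>b $ 3 - a $ 3\<bar> \<le> 2 * r" using * pdist_nonneg[of a b] unfolding defect_def by linarith
  then show ?thesis using dist_le_coords[of a b] * by linarith
qed

definition Tcls :: "real \<Rightarrow> nat \<Rightarrow> real" where
  "Tcls r L = (\<Sum>a\<in>Z. \<Sum>b\<in>Z. w a * w b * (\<Sum>\<theta>\<in>\<Theta>. \<nu> \<theta> * \<omega> \<theta> a b * of_bool (cls r L a b)))"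

text \<open>This is the parameter \<open>U\<close> of the tangency bound. Only angles at which the
  two curves are \<open>D\<close>-close contribute, and the density there is at most
  \<open>1 / M0\<close>.\<close>

lemma pair_mass:
  assumes r: "0 < r" "r \<le> 2" and D4: "D \<le> r / 4^L / 4" and ab: "a \<in> Z" "b \<in> Z"
  shows "(\<Sum>\<theta>\<in>\<Theta>. \<nu> \<theta> * \<omega> \<theta> a b * of_bool (cls r L a b)) \<le> 6 * (C * (144 * D * 2^L / r) powr e) / M0"
proof (cases "cls r L a b")
  case False
  then show ?thesis using C M0 by simp
next
  case True
  then have c: "r / 2 < pdist a b" "pdist a b \<le> r" "\<bar>defect a b\<bar> \<le> r / 4^L" "- pdist a b \<le> defect a b"
     "r / 4^L \<le> 16 * D \<and> 1 \<le> L \<or> r / 4^L / 4 < \<bar>defect a b\<bar> \<and> 16 * D < r / 4^L"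
    unfolding cls_def defect_def by auto
  then have "0 < pdist a b" using r by linarith
  then obtain t0 where t0: "0 \<le> t0" "t0 < 2 * pi"
    "\<And>\<theta>. wave b \<theta> - wave a \<theta> = defect a b + 2 * pdist a b * (sin ((\<theta> - t0) / 2))\<^sup>2"
    using wave_profile by metis
  let ?S = "{\<theta>. \<theta> \<in> \<Theta> \<and> \<bar>defect a b + 2 * pdist a b * (sin ((\<theta> - t0) / 2))\<^sup>2\<bar> \<le> D}"
  have "(\<Sum>\<theta>\<in>\<Theta>. \<nu> \<theta> * \<omega> \<theta> a b * of_bool (cls r L a b)) = (\<Sum>\<theta>\<in>?S. \<nu> \<theta> * \<omega> \<theta> a b)"
  proof (rule sum.mono_neutral_cong_right)
    show "\<forall>\<theta>\<in>\<Theta> - ?S. \<nu> \<theta> * \<omega> \<theta> a b * of_bool (cls r L a b) = 0"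
    proof
      fix \<theta> assume th: "\<theta> \<in> \<Theta> - ?S"
      have "\<not> 0 < \<omega> \<theta> a b"
        using \<omega>supp[of \<theta> a b] ab th unfolding t0(3)[symmetric] by (auto simp: D_def abs_minus_commute)
      then show "\<nu> \<theta> * \<omega> \<theta> a b * of_bool (cls r L a b) = 0" using \<omega>0[of \<theta> a b] by auto
    qed
  qed (use fin True in auto)
  also have "\<dots> \<le> (\<Sum>\<theta>\<in>?S. \<nu> \<theta> * (1 / M0))"
    by (intro sum_mono mult_left_mono \<omega>le \<nu>0)
  also have "\<dots> = sum \<nu> ?S / M0" by (simp add: sum_divide_distrib)
  also have "\<dots> \<le> 6 * (C * (144 * D * 2^L / r) powr e) / M0"
  proof (rule divide_right_mono)
    have "r \<le> r * 2^L" using r mult_left_mono[of 1 "2^L" r] by simp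
    also have "\<dots> \<le> 144 * 2^L * 2" using r by (simp add: mult.commute mult_left_mono)
    finally have "r \<le> 288 * 2^L" by simp
    then have "1 / 2^k \<le> 144 * D * 2^L / r" unfolding D_def using r by (simp add: field_simps)
    then show "sum \<nu> ?S \<le> 6 * (C * (144 * D * 2^L / r) powr e)"
      by (intro profile_mass[OF fr\<Theta> \<Theta> t0(1,2)]) (use c D4 D_pos C in auto)
  qed (use M0 in simp)
  finally show ?thesis .
qed

text \<open>The lower bound on \<open>r / 4^L\<close> forces \<open>2^L \<le> 2^k\<close>, so an arc
  is not shorter than the finest scale at which the Frostman condition for \<open>\<nu>\<close> is
  available.\<close>

lemma arc_mass:
  assumes r: "0 < r" "r \<le> 2" and D4: "D \<le> r / 4^L / 4"
  shows "(\<Sum>\<theta> | \<theta> \<in> \<Theta> \<and> idx L \<theta> = i. \<nu> \<theta>) \<le> C * (2 * pi / 2^L) powr e"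
proof (rule frostmanD(3)[OF fr\<Theta>])
  have "(2::real)^L \<le> 4^L" by (intro power_mono) auto
  moreover have "4 * D * 4^L \<le> r" using D4 by (simp add: field_simps)
  moreover have "4 * D * 2^L \<le> 4 * D * 4^L" using \<open>2^L \<le> 4^L\<close> D_pos by (intro mult_left_mono) auto
  ultimately have "8 * 2^L / 2^k \<le> (2::real)" using r(2) unfolding D_def by simp
  then have "4 * (2::real)^L \<le> 2^k" by (simp add: field_simps)
  then have "(2::real)^L \<le> 2^k" using zero_le_power[of "2::real" L] by linarith
  then have "1 / (2::real)^k \<le> 1 / 2^L" by (simp add: frac_le)
  also have "\<dots> \<le> 2 * pi / 2^L" using pi_gt3 by (intro divide_right_mono) auto
  finally show "1 / 2^k \<le> 2 * pi / 2^L" .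
  fix x y assume "x \<in> {\<theta> \<in> \<Theta>. idx L \<theta> = i}" "y \<in> {\<theta> \<in> \<Theta>. idx L \<theta> = i}"
  then have "2 * pi * real i / 2^L \<le> x" "x \<le> 2 * pi * real (Suc i) / 2^L" "2 * pi * real i / 2^L \<le> y" "y \<le> 2 * pi * real (Suc i) / 2^L"
    using idx(1,2)[of x L] idx(1,2)[of y L] by auto
  moreover have "2 * pi * real (Suc i) / 2^L = 2 * pi * real i / 2^L + 2 * pi / 2^L" by (simp add: field_simps)
  ultimately show "dist x y \<le> 2 * pi / 2^L" unfolding dist_real_def by linarith
qed auto

lemma local_mass:
  assumes r: "0 < r" and D4: "D \<le> r / 4^L / 4" and Y: "Y \<subseteq> Z" "\<And>x. x \<in> Y \<Longrightarrow> dist a x \<le> 8 * r"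
  shows "sum w Y \<le> C * (16 * r) powr e"
proof (rule frostmanD(3)[OF frZ Y(1)])
  have "r * 1 \<le> r * 4^L" using r by (intro mult_left_mono) auto
  then have "r / 4^L \<le> r" by (simp add: divide_le_eq)
  then have "4 * D \<le> r" using D4 by simp
  then show "1 / 2^k \<le> 16 * r" using D_ge D_pos r by linarith
  show "dist x y \<le> 16 * r" if "x \<in> Y" "y \<in> Y" for x y
    using Y(2)[OF that(1)] Y(2)[OF that(2)] dist_triangle[of x y a] by (simp add: dist_commute)
qed

text \<open>Both families are \<open>Z\<close>, sampled at the left ends of the arcs, and the order
  built into \<open>cls\<close> decides which point is the lower one. \<open>V\<close> is the mass
  of an arc because the rows of \<open>\<omega>\<close> have mass at most 1; \<open>R\<close> comes
  from \<open>cls_dist\<close>, used twice along a common neighbour.\<close>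

lemma tangency_instance:
  assumes r: "0 < r" "r \<le> 2" and D4: "D \<le> r / 4^L / 4"
  shows "tangency Z Z w L (Om r L) (\<lambda>a i. wave a (2 * pi * real i / 2^L)) (\<lambda>a i. wave a (2 * pi * real i / 2^L))
    (near L) (38 * (r / 4^L)) 30 (6 * (C * (144 * D * 2^L / r) powr e) / M0) (C * (2 * pi / 2^L) powr e) (C * (16 * r) powr e) W"
proof
  have Om0: "0 \<le> Om r L a b i" for a b i unfolding Om_def by (intro sum_nonneg mult_nonneg_nonneg \<nu>0 \<omega>0) auto
  have prof: "wave b (2 * pi * real i / 2^L) - wave a (2 * pi * real i / 2^L) \<le> 38 * (r / 4^L) \<and>
      (\<not> near L i j \<longrightarrow> wave b (2 * pi * real j / 2^L) - wave a (2 * pi * real j / 2^L) > 38 * (r / 4^L))"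
    if ab: "a \<in> Z" "b \<in> Z" and O: "0 < Om r L a b i" for a b i j
  proof -
    obtain \<theta> where th: "\<theta> \<in> \<Theta>" "idx L \<theta> = i" "0 < \<omega> \<theta> a b" "cls r L a b" using Om_posD[OF O] by blast
    then have c: "r / 2 < pdist a b" "pdist a b \<le> r" "\<bar>defect a b\<bar> \<le> r / 4^L" unfolding cls_def by auto
    then have "0 < pdist a b" using r by linarith
    then obtain t0 where t0: "0 \<le> t0" "t0 < 2 * pi"
      "\<And>\<theta>. wave b \<theta> - wave a \<theta> = defect a b + 2 * pdist a b * (sin ((\<theta> - t0) / 2))\<^sup>2"
      using wave_profile by metis
    have "\<bar>defect a b + 2 * pdist a b * (sin ((\<theta> - t0) / 2))\<^sup>2\<bar> \<le> D"
      using \<omega>supp[OF th(1) ab th(3)] unfolding t0(3)[symmetric] D_def by (simp add: abs_minus_commute)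
    note D_small = this
    note i = idx(1,2)[OF th(1), of L, unfolded th(2)]
    show ?thesis
      unfolding t0(3) using profile_small(1)[OF c D4 i D_small] profile_small(2)[OF c D4 i D_small] by blast
  qed
  show "wave b (2 * pi * real i / 2^L) - wave a (2 * pi * real i / 2^L) \<le> 38 * (r / 4^L)"
    if "a \<in> Z" "b \<in> Z" "0 < Om r L a b i" for a b i using prof[OF that] by blast
  show "38 * (r / 4^L) < wave b (2 * pi * real j / 2^L) - wave a (2 * pi * real j / 2^L)"
    if "a \<in> Z" "b \<in> Z" "0 < Om r L a b i" "\<not> near L i j" for a b i j using prof[OF that(1-3)] that(4) by blast
  show "finite Z" by (fact fin)
  show "0 \<le> w x" for x by (rule w0)
  show "0 \<le> Om r L a b i" for a b i by (rule Om0)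
  show False if "i1 < i2" "i2 < i3" "i3 < i4" "i4 < 2^L" 
    "wave a (2 * pi * real i1 / 2^L) < wave a' (2 * pi * real i1 / 2^L)"
      "wave a' (2 * pi * real i2 / 2^L) < wave a (2 * pi * real i2 / 2^L)"
      "wave a (2 * pi * real i3 / 2^L) < wave a' (2 * pi * real i3 / 2^L)"
      "wave a' (2 * pi * real i4 / 2^L) < wave a (2 * pi * real i4 / 2^L)" for a a' i1 i2 i3 i4
    using wave_no_alternation that by blast
  show "near L i i" for i by (rule near_refl)
  show "near L j i" if "near L i j" for i j using that by (rule near_sym)
  show "real (card {j. j < 2^L \<and> near L i j}) \<le> 30" if "i < 2^L" for i using near_card[OF that] by simp
  show "(\<Sum>i<2^L. Om r L a b i) \<le> 6 * (C * (144 * D * 2^L / r) powr e) / M0" if "a \<in> Z" "b \<in> Z" for a b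
    unfolding sum_Om by (rule pair_mass[OF r D4 that])
  have sym: "\<nu> \<theta> * \<omega> \<theta> a b * of_bool P \<le> \<nu> \<theta> * \<omega> \<theta> a b" for \<theta> a b P using \<nu>0[of \<theta>] \<omega>0[of \<theta> a b] by auto
  have row: "(\<Sum>b\<in>Z. w b * g b) \<le> C * (2 * pi / 2^L) powr e"
    if g: "\<And>b. g b \<le> (\<Sum>\<theta> | \<theta> \<in> \<Theta> \<and> idx L \<theta> = i. \<nu> \<theta> * \<omega> \<theta> a b)" and a: "a \<in> Z" for g a i
  proof -
    have "(\<Sum>b\<in>Z. w b * g b) \<le> (\<Sum>b\<in>Z. w b * (\<Sum>\<theta> | \<theta> \<in> \<Theta> \<and> idx L \<theta> = i. \<nu> \<theta> * \<omega> \<theta> a b))"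
      by (intro sum_mono mult_left_mono g w0)
    also have "\<dots> = (\<Sum>\<theta> | \<theta> \<in> \<Theta> \<and> idx L \<theta> = i. \<nu> \<theta> * (\<Sum>b\<in>Z. w b * \<omega> \<theta> a b))"
      unfolding sum_distrib_left by (subst sum.swap) (simp add: mult_ac)
    also have "\<dots> \<le> (\<Sum>\<theta> | \<theta> \<in> \<Theta> \<and> idx L \<theta> = i. \<nu> \<theta> * 1)"
      by (intro sum_mono mult_left_mono \<omega>row \<nu>0 a) auto
    also have "\<dots> \<le> C * (2 * pi / 2^L) powr e" using arc_mass[OF r D4, of i] by simp
    finally show ?thesis .
  qed
  show "(\<Sum>b\<in>Z. w b * Om r L a b i) \<le> C * (2 * pi / 2^L) powr e" if "a \<in> Z" "i < 2^L" for a i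
    unfolding Om_def by (rule row[where i = i, OF _ that(1)]) (intro sum_mono sym)
  show "(\<Sum>a\<in>Z. w a * Om r L a b i) \<le> C * (2 * pi / 2^L) powr e" if "b \<in> Z" "i < 2^L" for b i
    unfolding Om_def \<omega>sym[of _ _ b] by (rule row[where i = i, OF _ that(1)]) (intro sum_mono sym)
  have d: "dist a b \<le> 4 * r" if "0 < Om r L a b i" for a b i using Om_posD[OF that] cls_dist by metis
  show "(\<Sum>a' | a' \<in> Z \<and> (\<exists>b\<in>Z. \<exists>i<2^L. \<exists>j<2^L. 0 < Om r L a b i \<and> 0 < Om r L a' b j). w a') \<le> C * (16 * r) powr e" if "a \<in> Z" for a
  proof (rule local_mass[OF r(1) D4])
    fix x assume "x \<in> {a' \<in> Z. \<exists>b\<in>Z. \<exists>i<2^L. \<exists>j<2^L. 0 < Om r L a b i \<and> 0 < Om r L a' b j}"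
    then obtain b i j where "0 < Om r L a b i" "0 < Om r L x b j" by auto
    then show "dist a x \<le> 8 * r" using d[of a b i] d[of x b j] dist_triangle2[of a x b] by linarith
  qed auto
  show "(\<Sum>b' | b' \<in> Z \<and> (\<exists>a\<in>Z. \<exists>i<2^L. \<exists>j<2^L. 0 < Om r L a b i \<and> 0 < Om r L a b' j). w b') \<le> C * (16 * r) powr e" if "b \<in> Z" for b
  proof (rule local_mass[OF r(1) D4])
    fix x assume "x \<in> {b' \<in> Z. \<exists>a\<in>Z. \<exists>i<2^L. \<exists>j<2^L. 0 < Om r L a b i \<and> 0 < Om r L a b' j}"
    then obtain a i j where "0 < Om r L a b i" "0 < Om r L a x j" by auto
    then show "dist b x \<le> 8 * r" using d[of a b i] d[of a x j] dist_triangle3[of b x a] by linarith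
  qed auto
  show "(\<Sum>b | b \<in> Z \<and> (\<exists>i<2^L. 0 < Om r L a b i). w b) \<le> C * (16 * r) powr e" if "a \<in> Z" for a
  proof (rule local_mass[OF r(1) D4])
    fix x assume "x \<in> {b \<in> Z. \<exists>i<2^L. 0 < Om r L a b i}"
    then obtain i where "0 < Om r L a x i" by auto
    then show "dist a x \<le> 8 * r" using d[of a x i] r by linarith
  qed auto
  show "(\<Sum>a | a \<in> Z \<and> (\<exists>i<2^L. 0 < Om r L a b i). w a) \<le> C * (16 * r) powr e" if "b \<in> Z" for b
  proof (rule local_mass[OF r(1) D4])
    fix x assume "x \<in> {a \<in> Z. \<exists>i<2^L. 0 < Om r L a b i}"
    then obtain i where "0 < Om r L x b i" by auto
    then show "dist b x \<le> 8 * r" using d[of x b i] r by (simp add: dist_commute)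
  qed auto
  show "sum w Z \<le> W" unfolding W_def by auto
  show "0 \<le> W" unfolding W_def by (intro sum_nonneg w0)
  show "0 < 6 * (C * (144 * D * 2^L / r) powr e) / M0" "0 < C * (2 * pi / 2^L) powr e" "0 \<le> C * (16 * r) powr e" "0 < (30::real)"
    using C M0 r D_pos by auto
qed

lemma W_nonneg: "0 \<le> W" unfolding W_def by (intro sum_nonneg w0)

lemma Tcls_bound:
  assumes r: "0 < r" "r \<le> 2"
  shows "Tcls r L \<le> sqrt (4 * 10^8 * C^3 * D powr e / M0) * (real L + 1) * W"
proof (cases "D \<le> r / 4^L / 4")
  case False
  then have "Tcls r L = 0" unfolding Tcls_def cls_def by simp
  then show ?thesis using C M0 W_nonneg by simp
next
  case True
  let ?U = "6 * (C * (144 * D * 2^L / r) powr e) / M0" and ?V = "C * (2 * pi / 2^L) powr e" and ?R = "C * (16 * r) powr e"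
  interpret t: tangency Z Z w L "Om r L" "\<lambda>a i. wave a (2 * pi * real i / 2^L)" "\<lambda>a i. wave a (2 * pi * real i / 2^L)"
    "near L" "38 * (r / 4^L)" 30 ?U ?V ?R W
    by (rule tangency_instance[OF r True])
  have T: "t.T = Tcls r L" unfolding t.T_def t.tot_def Tcls_def sum_Om ..
  \<comment> \<open>Replacing 2 pi by 7 gives 144 * 7 * 16 = 16128, and 130 * 30 * 6 * 16128 =
    377395200 is rounded up to \<open>4 * 10^8\<close> below.\<close>
  let ?X = "144 * (2 * pi) * 16 :: real"
  have X: "1 \<le> ?X" "?X \<le> 16128" using pi_gt3 pi_less_4 pi_approx by auto
  have prod: "(144 * D * 2^L / r) * (2 * pi / 2^L) * (16 * r) = ?X * D" using r by (simp add: field_simps)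
  have "?U * ?V * ?R = 6 * C^3 / M0 * ((144 * D * 2^L / r) powr e * (2 * pi / 2^L) powr e * (16 * r) powr e)"
    by (simp add: power3_eq_cube)
  also have "(144 * D * 2^L / r) powr e * (2 * pi / 2^L) powr e * (16 * r) powr e = (?X * D) powr e"
  proof -
    have "x powr e * y powr e * z powr e = (x * y * z) powr e" if "0 \<le> x" "0 \<le> y" "0 \<le> z" for x y z :: real
      using that by (simp add: powr_mult)
    then show ?thesis unfolding prod[symmetric] using r D_pos by simp
  qed
  also have "\<dots> = ?X powr e * D powr e" using D_pos by (simp add: powr_mult)
  also have "6 * C^3 / M0 * (?X powr e * D powr e) \<le> 6 * C^3 / M0 * (16128 * D powr e)"
  proof (intro mult_left_mono mult_right_mono)
    have "?X powr e \<le> ?X powr 1" using X e by (intro powr_mono) auto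
    then show "?X powr e \<le> 16128" using X by simp
  qed (use C M0 in auto)
  finally have UVR: "?U * ?V * ?R \<le> 6 * C^3 / M0 * (16128 * D powr e)" .
  have "(Tcls r L)\<^sup>2 \<le> 130 * 30 * (real L + 1)\<^sup>2 * ?U * ?V * ?R * W\<^sup>2"
    using t.T_bound unfolding T by (simp add: add.commute)
  also have "\<dots> = (130 * 30 * (real L + 1)\<^sup>2 * W\<^sup>2) * (?U * ?V * ?R)" by (simp only: mult_ac)
  also have "\<dots> \<le> (130 * 30 * (real L + 1)\<^sup>2 * W\<^sup>2) * (6 * C^3 / M0 * (16128 * D powr e))"
    by (intro mult_left_mono UVR) auto
  also have "\<dots> = 377395200 * (C^3 * D powr e / M0 * ((real L + 1)\<^sup>2 * W\<^sup>2))" by simp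
  also have "\<dots> \<le> 4 * 10^8 * (C^3 * D powr e / M0 * ((real L + 1)\<^sup>2 * W\<^sup>2))"
    using C M0 by (intro mult_right_mono) auto
  also have "\<dots> = (sqrt (4 * 10^8 * C^3 * D powr e / M0) * (real L + 1) * W)\<^sup>2"
    using C M0 by (simp add: power_mult_distrib)
  finally show ?thesis
    by (rule power2_le_imp_le) (use C M0 W_nonneg in auto)
qed

section \<open>Summation over all classes of pairs\<close>

definition Ttot :: real where
  "Ttot = (\<Sum>a\<in>Z. \<Sum>b\<in>Z. w a * w b * (\<Sum>\<theta>\<in>\<Theta>. \<nu> \<theta> * \<omega> \<theta> a b))"

text \<open>Closeness in the first two coordinates and in projection forces closeness in the third,
  at most D + 32 D, so the distance is at most 65 D. The Frostman bound for such a neighbourhood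
  then takes the place of the tangency bound.\<close>

lemma near_pairs:
  "(\<Sum>a\<in>Z. \<Sum>b\<in>Z. w a * w b * (\<Sum>\<theta>\<in>\<Theta>. \<nu> \<theta> * \<omega> \<theta> a b * of_bool (pdist a b \<le> 16 * D)))
     \<le> NN * W * (130 * C * D powr e / M0)"
proof -
  have row: "(\<Sum>b\<in>Z. w b * (\<omega> \<theta> a b * of_bool (pdist a b \<le> 16 * D))) \<le> 130 * C * D powr e / M0"
    if a: "a \<in> Z" and \<theta>: "\<theta> \<in> \<Theta>" for a \<theta>
  proof -
    let ?Y = "{b \<in> Z. dist a b \<le> 65 * D}"
    have "(\<Sum>b\<in>Z. w b * (\<omega> \<theta> a b * of_bool (pdist a b \<le> 16 * D))) \<le> (\<Sum>b\<in>?Y. w b * (1 / M0))"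
    proof (subst sum.mono_neutral_right[of Z ?Y])
      show "\<forall>b\<in>Z - ?Y. w b * (\<omega> \<theta> a b * of_bool (pdist a b \<le> 16 * D)) = 0"
      proof
        fix b assume b: "b \<in> Z - ?Y"
        have "\<omega> \<theta> a b = 0" if p: "pdist a b \<le> 16 * D"
        proof (rule ccontr)
          assume "\<omega> \<theta> a b \<noteq> 0"
          then have "\<omega> \<theta> a b > 0" using \<omega>0[of \<theta> a b] by simp
          then have "\<bar>wave a \<theta> - wave b \<theta>\<bar> \<le> D" using \<omega>supp[OF \<theta> a] b unfolding D_def by auto
          moreover have "wave b \<theta> - wave a \<theta> = (b $ 1 - a $ 1) * cos \<theta> + (b $ 2 - a $ 2) * sin \<theta> + (b $ 3 - a $ 3)"
            unfolding wave_def by (simp add: algebra_simps)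
          moreover have "\<bar>(b $ 1 - a $ 1) * cos \<theta>\<bar> \<le> pdist a b * 1" "\<bar>(b $ 2 - a $ 2) * sin \<theta>\<bar> \<le> pdist a b * 1"
            unfolding abs_mult by (intro mult_mono abs_le_pdist pdist_nonneg; simp)+
          ultimately have "\<bar>b $ 3 - a $ 3\<bar> \<le> 33 * D" using p by linarith
          moreover have "dist a b \<le> 2 * pdist a b + \<bar>b $ 3 - a $ 3\<bar>" by (rule dist_le_coords)
          ultimately have "dist a b \<le> 65 * D" using p by linarith
          then show False using b by auto
        qed
        then show "w b * (\<omega> \<theta> a b * of_bool (pdist a b \<le> 16 * D)) = 0" by auto
      qed
      show "(\<Sum>b\<in>?Y. w b * (\<omega> \<theta> a b * of_bool (pdist a b \<le> 16 * D))) \<le> (\<Sum>b\<in>?Y. w b * (1 / M0))"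
        by (intro sum_mono mult_left_mono w0 order_trans[OF _ \<omega>le]) (use \<omega>0 in auto)
    qed (use fin in auto)
    also have "\<dots> = sum w ?Y / M0" by (simp add: sum_divide_distrib)
    also have "\<dots> \<le> C * (130 * D) powr e / M0"
    proof (rule divide_right_mono[OF frostmanD(3)[OF frZ]])
      show "1 / 2^k \<le> 130 * D" using D_ge D_pos by linarith
      show "dist x y \<le> 130 * D" if "x \<in> ?Y" "y \<in> ?Y" for x y
        using that dist_triangle[of x y a] by (simp add: dist_commute)
    qed (use M0 in auto)
    also have "\<dots> = C * (130 powr e * D powr e) / M0" using D_pos by (simp add: powr_mult)
    also have "\<dots> \<le> C * (130 * D powr e) / M0"
      using C M0 e powr_mono[of e 1 "130::real"] by (intro divide_right_mono mult_left_mono mult_right_mono) auto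
    finally show ?thesis by (simp add: mult_ac)
  qed
  have "(\<Sum>a\<in>Z. \<Sum>b\<in>Z. w a * w b * (\<Sum>\<theta>\<in>\<Theta>. \<nu> \<theta> * \<omega> \<theta> a b * of_bool (pdist a b \<le> 16 * D)))
     = (\<Sum>a\<in>Z. \<Sum>b\<in>Z. \<Sum>\<theta>\<in>\<Theta>. w a * \<nu> \<theta> * (w b * (\<omega> \<theta> a b * of_bool (pdist a b \<le> 16 * D))))"
    unfolding sum_distrib_left by (intro sum.cong refl) (simp only: mult_ac)
  also have "\<dots> = (\<Sum>a\<in>Z. \<Sum>\<theta>\<in>\<Theta>. \<Sum>b\<in>Z. w a * \<nu> \<theta> * (w b * (\<omega> \<theta> a b * of_bool (pdist a b \<le> 16 * D))))"
    by (intro sum.cong refl sum.swap)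
  also have "\<dots> = (\<Sum>a\<in>Z. \<Sum>\<theta>\<in>\<Theta>. w a * \<nu> \<theta> * (\<Sum>b\<in>Z. w b * (\<omega> \<theta> a b * of_bool (pdist a b \<le> 16 * D))))"
    unfolding sum_distrib_left ..
  also have "\<dots> \<le> (\<Sum>a\<in>Z. \<Sum>\<theta>\<in>\<Theta>. w a * \<nu> \<theta> * (130 * C * D powr e / M0))"
    by (intro sum_mono mult_left_mono row mult_nonneg_nonneg w0 \<nu>0)
  also have "\<dots> = (\<Sum>a\<in>Z. w a * (NN * (130 * C * D powr e / M0)))"
    unfolding NN_def by (intro sum.cong refl) (simp only: sum_distrib_left sum_distrib_right mult.assoc)
  also have "\<dots> = W * (NN * (130 * C * D powr e / M0))" unfolding W_def sum_distrib_right ..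
  also have "\<dots> = NN * W * (130 * C * D powr e / M0)" by simp
  finally show ?thesis .
qed

text \<open>\<open>m\<close> is the first level at which half the dyadic radius is below the
  distance; \<open>L\<close> is the first at which \<open>r / 4^L\<close> has come down to
  \<open>16 * D\<close> or below four times the defect. Failure one level earlier yields the upper
  bound on the defect and \<open>D \<le> r / 4^L / 4\<close>. Since \<open>16 * D < r\<close>, the
  first reason cannot occur at level 0.\<close>

lemma cls_exhaust:
  assumes a: "a \<in> Z" "b \<in> Z" and \<theta>: "\<theta> \<in> \<Theta>" "0 < \<omega> \<theta> a b" and p: "16 * D < pdist a b" and le: "a $ 3 \<le> b $ 3"
  shows "\<exists>m<k. \<exists>L<k. cls (2 / 2^m) L a b"
proof -
  let ?P = "pdist a b" and ?s = "defect a b"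
  have P2: "?P \<le> 2" using pdist_le_dist[of a b] diam[OF a] by linarith
  have P0: "0 < ?P" using p D_pos by linarith
  have "\<exists>m::nat. (1/2)^m < ?P" using real_arch_pow_inv[OF P0, of "1/2"] by auto
  then have ex: "\<exists>m::nat. 1 / 2^m < ?P" by (simp add: power_one_over)
  define m where "m = (LEAST m::nat. 1 / 2^m < ?P)"
  have m: "1 / 2^m < ?P" unfolding m_def using ex by (rule LeastI_ex)
  define r where "r = 2 / (2::real)^m"
  have r: "0 < r" "r / 2 < ?P" using m unfolding r_def by auto
  have rP: "?P \<le> r"
  proof (cases m)
    case 0 then show ?thesis using P2 unfolding r_def by simp
  next
    case (Suc n)
    have "\<not> 1 / 2^n < ?P" using not_less_Least[of n "\<lambda>m. 1 / 2^m < ?P"] Suc unfolding m_def by auto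
    then show ?thesis unfolding r_def Suc by simp
  qed
  have rD: "16 * D < r" using p rP by linarith
  have mk: "m < k"
  proof (rule ccontr)
    assume "\<not> m < k"
    then have "(2::real)^k \<le> 2^m" by (intro power_increasing) auto
    then have "r \<le> D" unfolding r_def D_def by (intro divide_left_mono) auto
    then show False using rD D_pos by linarith
  qed
  have "0 < ?P" using P0 .
  then obtain t0 where t0: "\<And>\<theta>. wave b \<theta> - wave a \<theta> = ?s + 2 * ?P * (sin ((\<theta> - t0) / 2))\<^sup>2"
    using wave_profile by metis
  \<comment> \<open>Closeness at a single angle bounds the minimum of the difference from above by
    \<open>D\<close>; the order of the third coordinates bounds it from below by
    \<open>- pdist a b\<close>.\<close>
  have "\<bar>wave a \<theta> - wave b \<theta>\<bar> \<le> D" using \<omega>supp[OF \<theta>(1) a \<theta>(2)] unfolding D_def .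
  then have "?s + 2 * ?P * (sin ((\<theta> - t0) / 2))\<^sup>2 \<le> D" unfolding t0[symmetric] by linarith
  moreover have "0 \<le> 2 * ?P * (sin ((\<theta> - t0) / 2))\<^sup>2" using P0 by auto
  ultimately have "?s \<le> D" by linarith
  moreover have "- ?P \<le> ?s" using le unfolding defect_def by simp
  ultimately have sr: "\<bar>?s\<bar> \<le> r" using rP rD D_pos by linarith
  obtain L0 :: nat where "(1/4)^L0 < 16 * D / r" using real_arch_pow_inv[of "16 * D / r" "1/4"] D_pos r by auto
  then have "r / 4^L0 \<le> 16 * D" using r by (simp add: power_one_over field_simps)
  then have exL: "\<exists>L::nat. r / 4^L \<le> 16 * D \<or> r / 4^L / 4 < \<bar>?s\<bar>" by blast
  define L where "L = (LEAST L::nat. r / 4^L \<le> 16 * D \<or> r / 4^L / 4 < \<bar>?s\<bar>)"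
  have L: "r / 4^L \<le> 16 * D \<or> r / 4^L / 4 < \<bar>?s\<bar>" unfolding L_def using exL by (rule LeastI_ex)
  have LS: "\<bar>?s\<bar> \<le> r / 4^L \<and> D \<le> r / 4^L / 4"
  proof (cases L)
    case 0 then show ?thesis using sr rD D_pos by simp
  next
    case (Suc n)
    have "\<not> (r / 4^n \<le> 16 * D \<or> r / 4^n / 4 < \<bar>?s\<bar>)"
      using not_less_Least[of n "\<lambda>L. r / 4^L \<le> 16 * D \<or> r / 4^L / 4 < \<bar>?s\<bar>"] Suc unfolding L_def by auto
    then show ?thesis unfolding Suc by (auto simp: field_simps)
  qed
  have L1: "1 \<le> L" if "r / 4^L \<le> 16 * D" using that rD by (cases L) auto
  have "cls r L a b" unfolding cls_def using r rP le LS L L1 by (auto simp: not_le) 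
  moreover have "L < k"
  proof (rule ccontr)
    assume "\<not> L < k"
    then have "(2::real)^k \<le> 2^L" by (intro power_increasing) auto
    also have "\<dots> \<le> 4^L" by (intro power_mono) auto
    finally have "r / 4^L \<le> 2 / 2^k" unfolding r_def by (intro frac_le) (auto simp: divide_le_eq)
    then show False using LS D_pos unfolding D_def[symmetric] by simp
  qed
  ultimately show ?thesis using mk unfolding r_def by blast
qed

text \<open>A pair that is not near is classified in the order that puts the smaller third
  coordinate first. By symmetry of \<open>\<omega>\<close> the other order only doubles the sum over
  \<open>m\<close> and \<open>L\<close>.\<close>

lemma Ttot_bound:
  "Ttot \<le> NN * W * (130 * C * D powr e / M0) +
     2 * real k ^ 2 * (sqrt (4 * 10^8 * C^3 * D powr e / M0) * (real k + 1) * W)"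
proof -
  let ?r = "\<lambda>m. 2 / (2::real)^m"
  have split: "\<omega> \<theta> a b \<le> \<omega> \<theta> a b * of_bool (pdist a b \<le> 16 * D) +
      ((\<Sum>m<k. \<Sum>L<k. \<omega> \<theta> a b * of_bool (cls (?r m) L a b)) + (\<Sum>m<k. \<Sum>L<k. \<omega> \<theta> a b * of_bool (cls (?r m) L b a)))"
    if ab: "a \<in> Z" "b \<in> Z" and \<theta>: "\<theta> \<in> \<Theta>" for \<theta> a b
  proof -
    have nn: "0 \<le> (\<Sum>m<k. \<Sum>L<k. \<omega> \<theta> a b * of_bool (cls (?r m) L x y))" for x y
      by (intro sum_nonneg mult_nonneg_nonneg \<omega>0) auto
    have one: "\<omega> \<theta> a b \<le> (\<Sum>m<k. \<Sum>L<k. \<omega> \<theta> a b * of_bool (cls (?r m) L x y))" if h: "\<exists>m<k. \<exists>L<k. cls (?r m) L x y" for x y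
    proof -
      obtain m L where mL: "m < k" "L < k" "cls (?r m) L x y" using h by blast
      have "\<omega> \<theta> a b \<le> (\<Sum>L\<in>{L}. \<omega> \<theta> a b * of_bool (cls (?r m) L x y))" using mL by simp
      also have "\<dots> \<le> (\<Sum>L<k. \<omega> \<theta> a b * of_bool (cls (?r m) L x y))"
        by (rule sum_mono2) (use mL \<omega>0 in auto)
      also have "\<dots> = (\<Sum>m\<in>{m}. \<Sum>L<k. \<omega> \<theta> a b * of_bool (cls (?r m) L x y))" by simp
      also have "\<dots> \<le> (\<Sum>m<k. \<Sum>L<k. \<omega> \<theta> a b * of_bool (cls (?r m) L x y))"
        by (rule sum_mono2) (use mL \<omega>0 in \<open>auto intro!: sum_nonneg\<close>)
      finally show ?thesis .
    qed
    show ?thesis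
    proof (cases "pdist a b \<le> 16 * D \<or> \<omega> \<theta> a b = 0")
      case True
      then show ?thesis using nn[of a b] nn[of b a] \<omega>0[of \<theta> a b] by auto
    next
      case False
      then have f: "16 * D < pdist a b" "0 < \<omega> \<theta> a b" using \<omega>0[of \<theta> a b] by auto
      have f': "16 * D < pdist b a" "0 < \<omega> \<theta> b a"
        using f \<omega>sym[of \<theta> a b] by (auto simp: pdist_def power2_commute)
      show ?thesis
      proof (cases "a $ 3 \<le> b $ 3")
        case True
        show ?thesis using one[OF cls_exhaust[OF ab \<theta> f(2,1) True]] nn[of b a] f by auto
      next
        case False
        then have "b $ 3 \<le> a $ 3" by simp
        then show ?thesis using one[OF cls_exhaust[OF ab(2,1) \<theta> f'(2,1)]] nn[of a b] f by auto
      qed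
    qed
  qed
  let ?N = "\<lambda>a b. \<Sum>\<theta>\<in>\<Theta>. \<nu> \<theta> * \<omega> \<theta> a b * of_bool (pdist a b \<le> 16 * D)"
  let ?C = "\<lambda>m L a b. \<Sum>\<theta>\<in>\<Theta>. \<nu> \<theta> * \<omega> \<theta> a b * of_bool (cls (?r m) L a b)"
  have pair: "(\<Sum>\<theta>\<in>\<Theta>. \<nu> \<theta> * \<omega> \<theta> a b) \<le> ?N a b + ((\<Sum>m<k. \<Sum>L<k. ?C m L a b) + (\<Sum>m<k. \<Sum>L<k. ?C m L b a))"
    if ab: "a \<in> Z" "b \<in> Z" for a b
  proof -
    have sw: "(\<Sum>\<theta>\<in>\<Theta>. \<nu> \<theta> * (\<Sum>m<k. \<Sum>L<k. \<omega> \<theta> a b * of_bool (cls (?r m) L x y)))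
       = (\<Sum>m<k. \<Sum>L<k. \<Sum>\<theta>\<in>\<Theta>. \<nu> \<theta> * \<omega> \<theta> a b * of_bool (cls (?r m) L x y))" for x y
    proof -
      have "(\<Sum>\<theta>\<in>\<Theta>. \<nu> \<theta> * (\<Sum>m<k. \<Sum>L<k. \<omega> \<theta> a b * of_bool (cls (?r m) L x y)))
        = (\<Sum>\<theta>\<in>\<Theta>. \<Sum>m<k. \<Sum>L<k. \<nu> \<theta> * \<omega> \<theta> a b * of_bool (cls (?r m) L x y))"
        by (simp only: sum_distrib_left mult.assoc)
      also have "\<dots> = (\<Sum>m<k. \<Sum>\<theta>\<in>\<Theta>. \<Sum>L<k. \<nu> \<theta> * \<omega> \<theta> a b * of_bool (cls (?r m) L x y))" by (rule sum.swap)
      also have "\<dots> = (\<Sum>m<k. \<Sum>L<k. \<Sum>\<theta>\<in>\<Theta>. \<nu> \<theta> * \<omega> \<theta> a b * of_bool (cls (?r m) L x y))"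
        by (intro sum.cong refl sum.swap)
      finally show ?thesis .
    qed
    have "(\<Sum>\<theta>\<in>\<Theta>. \<nu> \<theta> * \<omega> \<theta> a b) \<le> (\<Sum>\<theta>\<in>\<Theta>. \<nu> \<theta> * (\<omega> \<theta> a b * of_bool (pdist a b \<le> 16 * D) +
      ((\<Sum>m<k. \<Sum>L<k. \<omega> \<theta> a b * of_bool (cls (?r m) L a b)) + (\<Sum>m<k. \<Sum>L<k. \<omega> \<theta> a b * of_bool (cls (?r m) L b a)))))"
      by (intro sum_mono mult_left_mono split ab \<nu>0)
    also have "\<dots> = ?N a b + ((\<Sum>m<k. \<Sum>L<k. ?C m L a b) + (\<Sum>m<k. \<Sum>L<k. \<Sum>\<theta>\<in>\<Theta>. \<nu> \<theta> * \<omega> \<theta> a b * of_bool (cls (?r m) L b a)))"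
      unfolding distrib_left sum.distrib sw by (simp only: mult.assoc)
    finally show ?thesis unfolding \<omega>sym[of _ b a] .
  qed
  have "Ttot \<le> (\<Sum>a\<in>Z. \<Sum>b\<in>Z. w a * w b * (?N a b + ((\<Sum>m<k. \<Sum>L<k. ?C m L a b) + (\<Sum>m<k. \<Sum>L<k. ?C m L b a))))"
    unfolding Ttot_def
    by (rule sum_mono, rule sum_mono, rule mult_left_mono) (rule pair, auto intro!: w0 mult_nonneg_nonneg)
  also have "\<dots> = (\<Sum>a\<in>Z. \<Sum>b\<in>Z. w a * w b * ?N a b) + ((\<Sum>a\<in>Z. \<Sum>b\<in>Z. w a * w b * (\<Sum>m<k. \<Sum>L<k. ?C m L a b))
      + (\<Sum>a\<in>Z. \<Sum>b\<in>Z. w a * w b * (\<Sum>m<k. \<Sum>L<k. ?C m L b a)))"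
    by (simp only: distrib_left sum.distrib)
  also have "(\<Sum>a\<in>Z. \<Sum>b\<in>Z. w a * w b * (\<Sum>m<k. \<Sum>L<k. ?C m L b a)) = (\<Sum>a\<in>Z. \<Sum>b\<in>Z. w a * w b * (\<Sum>m<k. \<Sum>L<k. ?C m L a b))"
    by (subst sum.swap) (simp only: mult.commute[of "w _" "w _"])
  also have "(\<Sum>a\<in>Z. \<Sum>b\<in>Z. w a * w b * (\<Sum>m<k. \<Sum>L<k. ?C m L a b)) = (\<Sum>m<k. \<Sum>L<k. Tcls (?r m) L)"
  proof -
    let ?h = "\<lambda>a b m L. w a * w b * ?C m L a b"
    have "(\<Sum>a\<in>Z. \<Sum>b\<in>Z. w a * w b * (\<Sum>m<k. \<Sum>L<k. ?C m L a b)) = (\<Sum>a\<in>Z. \<Sum>b\<in>Z. \<Sum>m<k. \<Sum>L<k. ?h a b m L)"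
      by (intro sum.cong refl, subst sum_distrib_left, intro sum.cong refl, rule sum_distrib_left)
    also have "\<dots> = (\<Sum>a\<in>Z. \<Sum>m<k. \<Sum>b\<in>Z. \<Sum>L<k. ?h a b m L)" by (intro sum.cong refl sum.swap)
    also have "\<dots> = (\<Sum>m<k. \<Sum>a\<in>Z. \<Sum>b\<in>Z. \<Sum>L<k. ?h a b m L)" by (rule sum.swap)
    also have "\<dots> = (\<Sum>m<k. \<Sum>a\<in>Z. \<Sum>L<k. \<Sum>b\<in>Z. ?h a b m L)" by (intro sum.cong refl sum.swap)
    also have "\<dots> = (\<Sum>m<k. \<Sum>L<k. \<Sum>a\<in>Z. \<Sum>b\<in>Z. ?h a b m L)" by (intro sum.cong refl sum.swap)
    finally show ?thesis unfolding Tcls_def .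
  qed
  also have "(\<Sum>a\<in>Z. \<Sum>b\<in>Z. w a * w b * ?N a b) + ((\<Sum>m<k. \<Sum>L<k. Tcls (?r m) L) + (\<Sum>m<k. \<Sum>L<k. Tcls (?r m) L))
     \<le> NN * W * (130 * C * D powr e / M0) + (2 * (\<Sum>m<k. \<Sum>L<k. Tcls (?r m) L))"
    using near_pairs by simp
  also have "(\<Sum>m<k. \<Sum>L<k. Tcls (?r m) L) \<le> (\<Sum>m<k. \<Sum>L<k. sqrt (4 * 10^8 * C^3 * D powr e / M0) * (real k + 1) * W)"
  proof (intro sum_mono)
    fix m L assume "L \<in> {..<k}"
    have "(1::real) \<le> 2^m" by simp
    then have "2 / (2::real)^m \<le> 2" by (simp add: divide_le_eq)
    then have "Tcls (?r m) L \<le> sqrt (4 * 10^8 * C^3 * D powr e / M0) * (real L + 1) * W"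
      by (intro Tcls_bound) auto
    also have "\<dots> \<le> sqrt (4 * 10^8 * C^3 * D powr e / M0) * (real k + 1) * W"
      using \<open>L \<in> {..<k}\<close> W_nonneg C M0 by (intro mult_right_mono mult_left_mono) auto
    finally show "Tcls (?r m) L \<le> \<dots>" .
  qed
  also have "\<dots> = real k ^ 2 * (sqrt (4 * 10^8 * C^3 * D powr e / M0) * (real k + 1) * W)"
    by (simp add: power2_eq_square)
  finally show ?thesis by simp
qed

end

section \<open>Dyadic net content\<close>

text \<open>Half-open dyadic cubes are named by their integer corners; the value 0 off
  \<open>Basis\<close> makes the names unique.\<close>

definition cell :: "nat \<Rightarrow> 'a::euclidean_space \<Rightarrow> 'a \<Rightarrow> int" where
  "cell j x = (\<lambda>b. if b \<in> Basis then \<lfloor>2^j * (x \<bullet> b)\<rfloor> else 0)"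

lemma cell_refine:
  assumes "cell (Suc j) x = cell (Suc j) y" shows "cell j x = cell j y"
proof (rule ext)
  fix b :: 'a
  have *: "\<lfloor>2^j * t\<rfloor> = \<lfloor>2^Suc j * t\<rfloor> div 2" for t :: real
    using floor_divide_real_eq_div[of 2 "2^Suc j * t"] by simp
  have "cell (Suc j) x b = cell (Suc j) y b" using assms by simp
  then show "cell j x b = cell j y b" unfolding cell_def using *[of "x \<bullet> b"] *[of "y \<bullet> b"] by auto
qed

lemma cell_coarser:
  assumes "cell j x = cell j y" "i \<le> j" shows "cell i x = cell i y"
  using assms(2,1) by (induction rule: dec_induct) (auto dest: cell_refine)

definition covers :: "(nat \<times> ('a::euclidean_space \<Rightarrow> int)) set \<Rightarrow> 'a set" where
  "covers \<C> = {x. \<exists>j. (j, cell j x) \<in> \<C>}"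

text \<open>A sum over an arbitrary family, written as an integral for counting measure so that
  monotone convergence applies directly.\<close>

definition cost :: "real \<Rightarrow> (nat \<times> 'b) set \<Rightarrow> ennreal" where
  "cost s \<C> = (\<integral>\<^sup>+\<kappa>. ennreal ((1 / 2^fst \<kappa>) powr s) * indicator \<C> \<kappa> \<partial>count_space UNIV)"

definition net_content :: "real \<Rightarrow> 'a::euclidean_space set \<Rightarrow> ennreal" where
  "net_content s A = (INF \<C>\<in>{\<C>. A \<subseteq> covers \<C>}. cost s \<C>)"

lemma net_content_le: "A \<subseteq> covers \<C> \<Longrightarrow> net_content s A \<le> cost s \<C>"
  unfolding net_content_def by (rule INF_lower) simp

lemma net_content_mono: "A \<subseteq> B \<Longrightarrow> net_content s A \<le> net_content s B"
  unfolding net_content_def by (rule INF_superset_mono) auto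

lemma covers_mono: "\<C> \<subseteq> \<D> \<Longrightarrow> covers \<C> \<subseteq> covers \<D>"
  unfolding covers_def by auto

lemma cost_mono: "\<C> \<subseteq> \<D> \<Longrightarrow> cost s \<C> \<le> cost s \<D>"
  unfolding cost_def by (intro nn_integral_mono mult_left_mono) (auto simp: indicator_def)

lemma cost_Un_Int: "cost s \<C> + cost s \<D> = cost s (\<C> \<union> \<D>) + cost s (\<C> \<inter> \<D>)"
  unfolding cost_def by (simp flip: nn_integral_add) (intro nn_integral_cong, auto simp: indicator_def)

lemma cost_finite:
  assumes "finite \<C>" shows "cost s \<C> = ennreal (\<Sum>\<kappa>\<in>\<C>. (1 / 2^fst \<kappa>) powr s)"
proof -
  have "cost s \<C> = (\<integral>\<^sup>+\<kappa>. ennreal ((1 / 2^fst \<kappa>) powr s) \<partial>count_space \<C>)"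
    unfolding cost_def by (simp add: nn_integral_count_space_indicator)
  also have "\<dots> = (\<Sum>\<kappa>\<in>\<C>. ennreal ((1 / 2^fst \<kappa>) powr s))"
    using assms by (rule nn_integral_count_space_finite)
  finally show ?thesis by (simp add: sum_ennreal)
qed

lemma cost_Union_incseq:
  assumes "incseq \<C>" shows "cost s (\<Union>n. \<C> n) = (SUP n. cost s (\<C> n))"
proof -
  have inc: "incseq (\<lambda>n \<kappa>. ennreal ((1 / 2^fst \<kappa>) powr s) * indicator (\<C> n) \<kappa>)"
    using assms unfolding incseq_def le_fun_def by (auto intro!: mult_left_mono simp: indicator_def)
  have "cost s (\<Union>n. \<C> n) = (\<integral>\<^sup>+\<kappa>. (SUP n. ennreal ((1 / 2^fst \<kappa>) powr s) * indicator (\<C> n) \<kappa>) \<partial>count_space UNIV)"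
    unfolding cost_def
  proof (intro nn_integral_cong)
    fix \<kappa> :: "nat \<times> 'a"
    let ?w = "ennreal ((1 / 2^fst \<kappa>) powr s)"
    show "?w * indicator (\<Union>n. \<C> n) \<kappa> = (SUP n. ?w * indicator (\<C> n) \<kappa>)"
    proof (cases "\<kappa> \<in> (\<Union>n. \<C> n)")
      case True
      then obtain n where "\<kappa> \<in> \<C> n" by blast
      then have "?w \<le> (SUP n. ?w * indicator (\<C> n) \<kappa>)" by (intro SUP_upper2[of n]) auto
      moreover have "(SUP n. ?w * indicator (\<C> n) \<kappa>) \<le> ?w" by (intro SUP_least) (simp add: indicator_def)
      ultimately show ?thesis using True by (simp add: antisym)
    qed auto
  qed
  also have "\<dots> = (SUP n. cost s (\<C> n))"
    unfolding cost_def by (rule nn_integral_monotone_convergence_SUP[OF inc]) simp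
  finally show ?thesis .
qed

definition lev :: "(nat \<times> ('a::euclidean_space \<Rightarrow> int)) set \<Rightarrow> 'a \<Rightarrow> nat" where
  "lev \<C> x = (LEAST j. (j, cell j x) \<in> \<C>)"

text \<open>The maximal cells of a family. At each point covered by both families,
  \<open>low_cells\<close> takes the smaller of the two maximal cells.\<close>

definition top_cells :: "(nat \<times> ('a::euclidean_space \<Rightarrow> int)) set \<Rightarrow> (nat \<times> ('a \<Rightarrow> int)) set" where
  "top_cells \<C> = (\<lambda>x. (lev \<C> x, cell (lev \<C> x) x)) ` covers \<C>"

definition low_cells :: "(nat \<times> ('a::euclidean_space \<Rightarrow> int)) set \<Rightarrow> (nat \<times> ('a \<Rightarrow> int)) set \<Rightarrow> (nat \<times> ('a \<Rightarrow> int)) set" where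
  "low_cells \<C> \<D> = (\<lambda>x. (max (lev \<C> x) (lev \<D> x), cell (max (lev \<C> x) (lev \<D> x)) x)) ` (covers \<C> \<inter> covers \<D>)"

lemma lev_in: "x \<in> covers \<C> \<Longrightarrow> (lev \<C> x, cell (lev \<C> x) x) \<in> \<C>"
  unfolding covers_def lev_def by (auto intro: LeastI)

lemma lev_le: "(j, cell j x) \<in> \<C> \<Longrightarrow> lev \<C> x \<le> j"
  unfolding lev_def by (rule Least_le)

lemma top_cells_sub: "top_cells \<C> \<subseteq> \<C>"
  unfolding top_cells_def using lev_in by auto

lemma covers_top: "covers \<C> \<subseteq> covers (top_cells \<C>)"
proof
  fix x assume "x \<in> covers \<C>"
  then have "(lev \<C> x, cell (lev \<C> x) x) \<in> top_cells \<C>" unfolding top_cells_def by blast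
  then show "x \<in> covers (top_cells \<C>)" unfolding covers_def by blast
qed

lemma covers_low: "covers \<C> \<inter> covers \<D> \<subseteq> covers (low_cells \<C> \<D>)"
proof
  fix x assume "x \<in> covers \<C> \<inter> covers \<D>"
  then have "(max (lev \<C> x) (lev \<D> x), cell (max (lev \<C> x) (lev \<D> x)) x) \<in> low_cells \<C> \<D>" unfolding low_cells_def by blast
  then show "x \<in> covers (low_cells \<C> \<D>)" unfolding covers_def by blast
qed

lemma low_cells_sub: "low_cells \<C> \<D> \<subseteq> \<C> \<union> \<D>"
  unfolding low_cells_def using lev_in[of _ \<C>] lev_in[of _ \<D>] by (auto simp: max_def)

text \<open>If the smaller of the two cells is also maximal in the union, neither family has a
  coarser cell there. The two levels then coincide and the cell belongs to both families.\<close>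

lemma top_Int_low: "top_cells (\<C> \<union> \<D>) \<inter> low_cells \<C> \<D> \<subseteq> \<C> \<inter> \<D>"
proof
  fix \<kappa> assume k: "\<kappa> \<in> top_cells (\<C> \<union> \<D>) \<inter> low_cells \<C> \<D>"
  then obtain x where x: "\<kappa> = (lev (\<C> \<union> \<D>) x, cell (lev (\<C> \<union> \<D>) x) x)" unfolding top_cells_def by blast
  obtain y where y: "y \<in> covers \<C>" "y \<in> covers \<D>" "\<kappa> = (max (lev \<C> y) (lev \<D> y), cell (max (lev \<C> y) (lev \<D> y)) y)"
    using k unfolding low_cells_def by blast
  define j where "j = max (lev \<C> y) (lev \<D> y)"
  have j: "j = lev (\<C> \<union> \<D>) x" "cell j x = cell j y" using x y(3) unfolding j_def by auto
  have c: "cell (lev \<C> y) x = cell (lev \<C> y) y" "cell (lev \<D> y) x = cell (lev \<D> y) y"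
    using cell_coarser[OF j(2)] unfolding j_def by auto
  have "j \<le> lev \<C> y" "j \<le> lev \<D> y"
    unfolding j(1) using lev_in[OF y(1)] lev_in[OF y(2)] c by (auto intro!: lev_le)
  then have "lev \<C> y = j" "lev \<D> y = j" unfolding j_def by auto
  then show "\<kappa> \<in> \<C> \<inter> \<D>" using lev_in[OF y(1)] lev_in[OF y(2)] y(3) unfolding j_def[symmetric] by auto
qed

text \<open>Strong subadditivity on the level of covers: because cells are nested, the maximal cells
  cover the union of the two covered sets and the low cells cover the intersection, at no additional
  total cost.\<close>

lemma cost_top_low: "cost s (top_cells (\<C> \<union> \<D>)) + cost s (low_cells \<C> \<D>) \<le> cost s \<C> + cost s \<D>"
proof -
  have "cost s (top_cells (\<C> \<union> \<D>)) + cost s (low_cells \<C> \<D>) =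
      cost s (top_cells (\<C> \<union> \<D>) \<union> low_cells \<C> \<D>) + cost s (top_cells (\<C> \<union> \<D>) \<inter> low_cells \<C> \<D>)"
    by (rule cost_Un_Int)
  also have "\<dots> \<le> cost s (\<C> \<union> \<D>) + cost s (\<C> \<inter> \<D>)"
    using top_cells_sub[of "\<C> \<union> \<D>"] low_cells_sub[of \<C> \<D>] by (intro add_mono cost_mono top_Int_low) auto
  finally show ?thesis unfolding cost_Un_Int[of s \<C> \<D>, symmetric] .
qed

text \<open>Passing to maximal cells first loses no maximal cell of a later union, so an induction
  may replace the union of all earlier covers by its maximal cells.\<close>

lemma top_cells_Un: "top_cells (\<C> \<union> \<D>) \<subseteq> top_cells (top_cells \<C> \<union> \<D>)"
proof
  fix \<kappa> assume "\<kappa> \<in> top_cells (\<C> \<union> \<D>)"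
  then obtain x where x: "x \<in> covers (\<C> \<union> \<D>)" "\<kappa> = (lev (\<C> \<union> \<D>) x, cell (lev (\<C> \<union> \<D>) x) x)" unfolding top_cells_def by blast
  let ?l = "lev (\<C> \<union> \<D>) x"
  have least: "?l \<le> j" if "(j, cell j x) \<in> top_cells \<C> \<union> \<D>" for j
    using that top_cells_sub[of \<C>] by (intro lev_le) auto
  have "\<kappa> \<in> \<C> \<union> \<D>" using lev_in[OF x(1)] unfolding x(2) .
  then have kin: "\<kappa> \<in> top_cells \<C> \<union> \<D>"
  proof
    assume k: "\<kappa> \<in> \<C>"
    then have xc: "x \<in> covers \<C>" using x unfolding covers_def by auto
    have "lev \<C> x \<le> ?l" using k unfolding x(2) by (rule lev_le)
    moreover have "?l \<le> lev \<C> x" using lev_in[OF xc] by (intro lev_le) simp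
    ultimately have e: "lev \<C> x = ?l" by simp
    have "\<kappa> \<in> top_cells \<C>" unfolding x(2) e[symmetric] top_cells_def by (rule image_eqI[OF refl xc])
    then show ?thesis by simp
  qed simp
  then have xc: "x \<in> covers (top_cells \<C> \<union> \<D>)" using x unfolding covers_def by auto
  have e: "lev (top_cells \<C> \<union> \<D>) x = ?l"
    using lev_le[OF kin[unfolded x(2)]] least[OF lev_in[OF xc]] by (rule antisym)
  show "\<kappa> \<in> top_cells (top_cells \<C> \<union> \<D>)"
    unfolding x(2) e[symmetric] top_cells_def[of "top_cells \<C> \<union> \<D>"] by (rule image_eqI[OF refl xc])
qed

lemma top_cells_restrict: 
  assumes "\<C> \<subseteq> \<D>" shows "top_cells \<D> \<inter> \<C> \<subseteq> top_cells \<C>"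
proof
  fix \<kappa> assume k: "\<kappa> \<in> top_cells \<D> \<inter> \<C>"
  then obtain x where x: "x \<in> covers \<D>" "\<kappa> = (lev \<D> x, cell (lev \<D> x) x)" unfolding top_cells_def by blast
  then have xc: "x \<in> covers \<C>" using k unfolding covers_def by auto
  have "lev \<C> x \<le> lev \<D> x" using k x by (auto intro: lev_le)
  moreover have "lev \<D> x \<le> lev \<C> x" using lev_in[OF xc] assms by (auto intro: lev_le)
  ultimately have e: "lev \<C> x = lev \<D> x" by simp
  show "\<kappa> \<in> top_cells \<C>" unfolding x(2) e[symmetric] top_cells_def by (rule image_eqI[OF refl xc])
qed

text \<open>Unlike Hausdorff measures, the content is continuous from below along arbitrary increasing
  sequences; this is what makes capacitability arguments possible for non-measurable sets.\<close>

lemma net_content_incseq: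
  assumes inc: "incseq A" and M: "\<And>n. net_content s (A n) \<le> M"
  shows "net_content s (\<Union>n. A n) \<le> M"
proof (cases "M = \<infinity>")
  case True then show ?thesis by simp
next
  case False
  have fin: "net_content s (A n) < \<infinity>" for n using le_less_trans[OF M[of n]] False by (simp add: less_top)
  show ?thesis
  proof (rule ennreal_le_epsilon)
    fix \<epsilon> :: real assume \<epsilon>: "0 < \<epsilon>"
    have "\<exists>\<C>. A n \<subseteq> covers \<C> \<and> cost s \<C> \<le> net_content s (A n) + ennreal (\<epsilon> / 2^(n+1))" for n
    proof -
      have "net_content s (A n) < net_content s (A n) + ennreal (\<epsilon> / 2^(n+1))"
        using fin[of n] \<epsilon> by (simp add: ennreal_add_left_cancel_less less_top)
      then obtain \<C> where "\<C> \<in> {\<C>. A n \<subseteq> covers \<C>}" "cost s \<C> < net_content s (A n) + ennreal (\<epsilon> / 2^(n+1))"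
        unfolding net_content_def[of s "A n"] INF_less_iff by blast
      then show ?thesis by (auto intro: less_imp_le)
    qed
    then have "\<forall>n. \<exists>\<C>. A n \<subseteq> covers \<C> \<and> cost s \<C> \<le> net_content s (A n) + ennreal (\<epsilon> / 2^(n+1))" by blast
    from choice[OF this] obtain \<C> where "\<forall>n. A n \<subseteq> covers (\<C> n) \<and> cost s (\<C> n) \<le> net_content s (A n) + ennreal (\<epsilon> / 2^(n+1))" ..
    then have \<C>: "\<And>n. A n \<subseteq> covers (\<C> n)" "\<And>n. cost s (\<C> n) \<le> net_content s (A n) + ennreal (\<epsilon> / 2^(n+1))" by blast+
    define U where "U n = (\<Union>i\<le>n. \<C> i)" for n
    have cU: "A n \<subseteq> covers (U n)" for n
      using \<C>(1)[of n] covers_mono[of "\<C> n" "U n"] unfolding U_def by blast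
    \<comment> \<open>Errors must add up instead of costs. In the step the low cells still cover
      \<open>A n\<close>, so their cost is at least its content and strong subadditivity gives that
      content back; it can be cancelled because it is finite.\<close>
    have bd: "cost s (top_cells (U n)) \<le> net_content s (A n) + ennreal (\<epsilon> * (1 - 1 / 2^(n+1)))" for n
    proof (induction n)
      case 0
      have "cost s (top_cells (U 0)) \<le> cost s (\<C> 0)" using top_cells_sub[of "U 0"] unfolding U_def by (intro cost_mono) auto
      then show ?case using \<C>(2)[of 0] by simp
    next
      case (Suc n)
      let ?W = "top_cells (U n)"
      have U: "U (Suc n) = U n \<union> \<C> (Suc n)" unfolding U_def by (auto simp: le_Suc_eq)
      have "A n \<subseteq> covers ?W \<inter> covers (\<C> (Suc n))"
        using cU[of n] covers_top[of "U n"] \<C>(1)[of "Suc n"] incseq_SucD[OF inc, of n] by blast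
      then have "net_content s (A n) \<le> cost s (low_cells ?W (\<C> (Suc n)))" using covers_low by (intro net_content_le) blast
      then have "cost s (top_cells (U (Suc n))) + net_content s (A n) \<le> cost s (top_cells (?W \<union> \<C> (Suc n))) + cost s (low_cells ?W (\<C> (Suc n)))"
        unfolding U by (intro add_mono cost_mono top_cells_Un)
      also have "\<dots> \<le> cost s ?W + cost s (\<C> (Suc n))" by (rule cost_top_low)
      also have "\<dots> \<le> (net_content s (A n) + ennreal (\<epsilon> * (1 - 1 / 2^(n+1)))) + (net_content s (A (Suc n)) + ennreal (\<epsilon> / 2^(Suc n+1)))"
        by (intro add_mono Suc \<C>(2))
      also have "\<dots> = (net_content s (A (Suc n)) + (ennreal (\<epsilon> * (1 - 1 / 2^(n+1))) + ennreal (\<epsilon> / 2^(Suc n+1)))) + net_content s (A n)"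
        by (simp only: add_ac)
      also have "ennreal (\<epsilon> * (1 - 1 / 2^(n+1))) + ennreal (\<epsilon> / 2^(Suc n+1)) = ennreal (\<epsilon> * (1 - 1 / 2^(Suc n+1)))"
        using \<epsilon> one_le_power[of "2::real" "Suc n"] by (subst ennreal_plus[symmetric]) (auto simp: field_simps)
      finally show ?case using fin[of n] unfolding add.commute[of _ "net_content s (A n)"] ennreal_add_left_cancel_le by auto
    qed
    define D where "D = top_cells (\<Union>n. U n)"
    have incD: "incseq (\<lambda>n. D \<inter> U n)" unfolding incseq_def U_def by fastforce
    have DU: "(\<Union>n. D \<inter> U n) = D" using top_cells_sub[of "\<Union>n. U n"] unfolding D_def by blast
    have "(\<Union>n. A n) \<subseteq> covers (\<Union>n. U n)"
      using cU covers_mono[of "U _" "\<Union>n. U n"] by blast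
    then have "(\<Union>n. A n) \<subseteq> covers D" using covers_top unfolding D_def by blast
    then have "net_content s (\<Union>n. A n) \<le> cost s D" by (rule net_content_le)
    also have "\<dots> = (SUP n. cost s (D \<inter> U n))" using cost_Union_incseq[OF incD, of s] unfolding DU .
    also have "\<dots> \<le> M + ennreal \<epsilon>"
    proof (rule SUP_least)
      fix n
      \<comment> \<open>A cell of \<open>U n\<close> that is maximal in the whole family is maximal
        in \<open>U n\<close>, so every partial cost obeys the bound for a single
        \<open>A n\<close>.\<close>
      have "cost s (D \<inter> U n) \<le> cost s (top_cells (U n))"
        unfolding D_def by (intro cost_mono top_cells_restrict) auto
      also have "\<dots> \<le> net_content s (A n) + ennreal (\<epsilon> * (1 - 1 / 2^(n+1)))" by (rule bd)
      also have "\<dots> \<le> M + ennreal \<epsilon>" using mult_left_mono[of "1 - 1 / 2^(n+1)" 1 \<epsilon>] \<epsilon> by (intro add_mono M ennreal_leI) simp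
      finally show "cost s (D \<inter> U n) \<le> M + ennreal \<epsilon>" .
    qed
    finally show "net_content s (\<Union>n. A n) \<le> M + ennreal \<epsilon>" .
  qed
qed

section \<open>Comparison of the content with Hausdorff measure\<close>

lemma dist_same_cell:
  fixes x y :: "'a::euclidean_space"
  assumes "cell j x = cell j y"
  shows "dist x y \<le> DIM('a) / 2^j"
proof -
  have "\<bar>(x - y) \<bullet> b\<bar> \<le> 1 / 2^j" if b: "b \<in> Basis" for b
  proof -
    have "\<lfloor>2^j * (x \<bullet> b)\<rfloor> = \<lfloor>2^j * (y \<bullet> b)\<rfloor>" using fun_cong[OF assms, of b] b unfolding cell_def by simp
    then have "\<bar>2^j * (x \<bullet> b) - 2^j * (y \<bullet> b)\<bar> \<le> 1" by linarith
    also have "2^j * (x \<bullet> b) - 2^j * (y \<bullet> b) = 2^j * ((x - y) \<bullet> b)" by (simp add: algebra_simps)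
    finally show ?thesis by (simp add: abs_mult field_simps)
  qed
  then have "(\<Sum>b\<in>Basis. \<bar>(x - y) \<bullet> b\<bar>) \<le> (\<Sum>b\<in>(Basis::'a set). 1 / 2^j)" by (intro sum_mono)
  then show ?thesis using norm_le_l1[of "x - y"] by (simp add: dist_norm)
qed

lemma countable_cells: "countable {\<kappa> :: nat \<times> ('a::euclidean_space \<Rightarrow> int). \<forall>b. b \<notin> Basis \<longrightarrow> snd \<kappa> b = 0}"
proof -
  have "countable (PiE (Basis :: 'a set) (\<lambda>_. UNIV :: int set))" by (intro countable_PiE) auto
  then have "countable ((\<lambda>f b. if b \<in> Basis then f b else 0) ` PiE (Basis :: 'a set) (\<lambda>_. UNIV :: int set))" (is "countable ?F") by simp
  moreover have "{\<kappa> :: nat \<times> ('a \<Rightarrow> int). \<forall>b. b \<notin> Basis \<longrightarrow> snd \<kappa> b = 0} \<subseteq> UNIV \<times> ?F"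
  proof
    fix \<kappa> :: "nat \<times> ('a \<Rightarrow> int)" assume k: "\<kappa> \<in> {\<kappa>. \<forall>b. b \<notin> Basis \<longrightarrow> snd \<kappa> b = 0}"
    have "snd \<kappa> = (\<lambda>f b. if b \<in> Basis then f b else 0) (restrict (snd \<kappa>) Basis)" using k by (auto simp: fun_eq_iff)
    then have "snd \<kappa> \<in> ?F" by (intro image_eqI) auto
    then show "\<kappa> \<in> UNIV \<times> ?F" by (simp add: mem_Times_iff)
  qed
  ultimately show ?thesis by (meson countable_SIGMA countable_subset countableI_type)
qed

lemma diameter_le_dist:
  assumes "\<And>x y. \<lbrakk>x \<in> S; y \<in> S\<rbrakk> \<Longrightarrow> dist x y \<le> d" "0 \<le> d"
  shows "diameter S \<le> d"
  unfolding diameter_def using assms by (auto intro!: cSUP_least)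

lemma hausdorff_premeasure_le_cost:
  fixes A :: "'a::euclidean_space set"
  assumes s: "0 < s" and A: "A \<subseteq> covers \<C>" and lv: "\<And>\<kappa>. \<kappa> \<in> \<C> \<Longrightarrow> DIM('a) / 2^fst \<kappa> \<le> \<delta>" and "0 \<le> \<delta>"
  shows "hausdorff_premeasure s \<delta> A \<le> ennreal (DIM('a) powr s) * cost s \<C>"
proof -
  \<comment> \<open>Discarding names not supported on \<open>Basis\<close> loses only empty cells
    and leaves a countable family, which can be listed as a cover indexed by naturals.\<close>
  define \<D> where "\<D> = \<C> \<inter> {\<kappa>. \<forall>b. b \<notin> Basis \<longrightarrow> snd \<kappa> b = 0}"
  have cD: "countable \<D>" unfolding \<D>_def using countable_cells by (rule countable_subset[rotated]) auto
  have AD: "A \<subseteq> covers \<D>" using A unfolding covers_def \<D>_def by (auto simp: cell_def)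
  define Q where "Q \<kappa> = {x::'a. cell (fst \<kappa>) x = snd \<kappa>}" for \<kappa>
  have Qd: "dist x y \<le> DIM('a) / 2^fst \<kappa>" if "x \<in> Q \<kappa>" "y \<in> Q \<kappa>" for x y \<kappa>
    using that dist_same_cell[of "fst \<kappa>" x y] unfolding Q_def by simp
  have diamQ: "diameter (Q \<kappa>) \<le> DIM('a) / 2^fst \<kappa>" for \<kappa> by (rule diameter_le_dist[OF Qd]) auto
  have bQ: "bounded (Q \<kappa>)" for \<kappa>
  proof (cases "Q \<kappa> = {}")
    case False
    then obtain x where "x \<in> Q \<kappa>" by blast
    then show ?thesis unfolding bounded_def using Qd by (intro exI[of _ x]) blast
  qed simp
  have wQ: "diam_weight s (Q \<kappa>) \<le> ennreal (DIM('a) powr s) * ennreal ((1 / 2^fst \<kappa>) powr s)" for \<kappa>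
  proof -
    have "diameter (Q \<kappa>) powr s \<le> (DIM('a) * (1 / 2^fst \<kappa>)) powr s"
      using diamQ[of \<kappa>] s diameter_ge_0[OF bQ] by (intro powr_mono2) auto
    also have "\<dots> = DIM('a) powr s * (1 / 2^fst \<kappa>) powr s" by (subst powr_mult) auto
    finally show ?thesis using s by (simp add: diam_weight_def ennreal_mult[symmetric] ennreal_leI)
  qed
  define g where "g = to_nat_on \<D>"
  have inj: "inj_on g \<D>" unfolding g_def using cD by (rule inj_on_to_nat_on)
  define U where "U i = (if i \<in> g ` \<D> then Q (the_inv_into \<D> g i) else {})" for i
  have Ug: "U (g \<kappa>) = Q \<kappa>" if "\<kappa> \<in> \<D>" for \<kappa> using that inj unfolding U_def by (simp add: the_inv_into_f_f)
  have "U \<in> delta_covers \<delta> A"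
    unfolding delta_covers_def
  proof (intro CollectI conjI allI)
    show "A \<subseteq> (\<Union>i. U i)"
    proof
      fix x assume "x \<in> A"
      then obtain j where j: "(j, cell j x) \<in> \<D>" using AD unfolding covers_def by auto
      have "x \<in> U (g (j, cell j x))" unfolding Ug[OF j] Q_def by simp
      then show "x \<in> (\<Union>i. U i)" by blast
    qed
    fix i
    show "bounded (U i)" unfolding U_def using bQ by simp
    show "diameter (U i) \<le> \<delta>"
    proof (cases "i \<in> g ` \<D>")
      case True
      then obtain \<kappa> where k: "\<kappa> \<in> \<D>" "i = g \<kappa>" by blast
      then have "DIM('a) / 2^fst \<kappa> \<le> \<delta>" using lv unfolding \<D>_def by blast
      then show ?thesis unfolding k(2) Ug[OF k(1)] using diamQ[of \<kappa>] by linarith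
    qed (use \<open>0 \<le> \<delta>\<close> in \<open>simp add: U_def\<close>)
  qed
  then have "hausdorff_premeasure s \<delta> A \<le> (\<Sum>i. diam_weight s (U i))"
    unfolding hausdorff_premeasure_def by (rule INF_lower)
  also have "\<dots> = (\<integral>\<^sup>+i. diam_weight s (U i) \<partial>count_space UNIV)" by (simp add: nn_integral_count_space_nat)
  also have "\<dots> = (\<integral>\<^sup>+i. diam_weight s (U i) * indicator (g ` \<D>) i \<partial>count_space UNIV)"
    by (intro nn_integral_cong) (auto simp: U_def diam_weight_def indicator_def)
  also have "\<dots> = (\<integral>\<^sup>+i. diam_weight s (U i) \<partial>count_space (g ` \<D>))"
    by (simp add: nn_integral_count_space_indicator)
  also have "\<dots> = (\<integral>\<^sup>+\<kappa>. diam_weight s (U (g \<kappa>)) \<partial>count_space \<D>)"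
    by (rule nn_integral_bij_count_space[symmetric, OF inj_on_imp_bij_betw[OF inj]])
  also have "\<dots> \<le> (\<integral>\<^sup>+\<kappa>. ennreal (DIM('a) powr s) * ennreal ((1 / 2^fst \<kappa>) powr s) \<partial>count_space \<D>)"
    by (intro nn_integral_mono) (simp add: Ug wQ)
  also have "\<dots> = ennreal (DIM('a) powr s) * (\<integral>\<^sup>+\<kappa>. ennreal ((1 / 2^fst \<kappa>) powr s) \<partial>count_space \<D>)"
    by (rule nn_integral_cmult) simp
  also have "(\<integral>\<^sup>+\<kappa>. ennreal ((1 / 2^fst \<kappa>) powr s) \<partial>count_space \<D>) = cost s \<D>"
    unfolding cost_def by (simp add: nn_integral_count_space_indicator)
  also have "cost s \<D> \<le> cost s \<C>" unfolding \<D>_def by (intro cost_mono) auto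
  finally show ?thesis by (simp add: mult_left_mono)
qed

lemma cost_ge_term: "\<kappa> \<in> \<C> \<Longrightarrow> ennreal ((1 / 2^fst \<kappa>) powr s) \<le> cost s \<C>"
  using cost_mono[of "{\<kappa>}" \<C> s] cost_finite[of "{\<kappa>}" s] by simp

text \<open>A cover of small total cost contains no large cell, since for positive \<open>s\<close>
  a single cell already costs a positive power of its side. Covers witnessing vanishing content are
  thus automatically fine.\<close>

lemma hausdorff_measure_eq_0:
  fixes A :: "'a::euclidean_space set"
  assumes s: "0 < s" and A: "net_content s A = 0"
  shows "hausdorff_measure s A = 0"
proof -
  have "hausdorff_premeasure s \<delta> A = 0" if \<delta>: "\<delta> > 0" for \<delta>
  proof -
    have "hausdorff_premeasure s \<delta> A \<le> 0 + ennreal \<epsilon>" if \<epsilon>: "\<epsilon> > 0" for \<epsilon>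
    proof -
      define c where "c = DIM('a) powr s"
      have c: "c > 0" unfolding c_def by simp
      define \<eta> where "\<eta> = min (\<epsilon> / c) ((\<delta> / DIM('a)) powr s)"
      have \<eta>: "\<eta> > 0" unfolding \<eta>_def using \<epsilon> c \<delta> by simp
      then have "net_content s A < ennreal \<eta>" using A by simp
      then obtain \<C> where \<C>: "A \<subseteq> covers \<C>" "cost s \<C> < ennreal \<eta>"
        unfolding net_content_def INF_less_iff by blast
      have lv: "DIM('a) / 2^fst \<kappa> \<le> \<delta>" if "\<kappa> \<in> \<C>" for \<kappa>
      proof -
        have "ennreal ((1 / 2^fst \<kappa>) powr s) < ennreal \<eta>" using cost_ge_term[OF that] \<C>(2) by (rule le_less_trans)
        then have "(1 / 2^fst \<kappa>) powr s < (\<delta> / DIM('a)) powr s" using \<eta> unfolding \<eta>_def by (simp add: ennreal_less_iff)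
        then have "1 / 2^fst \<kappa> < \<delta> / DIM('a)" using s \<delta> by (metis powr_less_cancel2 divide_pos_pos zero_less_power zero_less_numeral of_nat_0_less_iff DIM_positive zero_less_one)
        then show ?thesis by (simp add: field_simps)
      qed
      have "hausdorff_premeasure s \<delta> A \<le> ennreal c * cost s \<C>"
        unfolding c_def using hausdorff_premeasure_le_cost[OF s \<C>(1) lv] \<delta> by simp
      also have "\<dots> \<le> ennreal c * ennreal \<eta>" using \<C>(2) by (intro mult_left_mono) auto
      also have "\<dots> = ennreal (c * \<eta>)" using c \<eta> by (simp add: ennreal_mult)
      also have "\<dots> \<le> ennreal (c * (\<epsilon> / c))" using c unfolding \<eta>_def by (intro ennreal_leI mult_left_mono) auto
      finally show ?thesis using c by simp
    qed
    then have "hausdorff_premeasure s \<delta> A \<le> 0" by (rule ennreal_le_epsilon)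
    then show ?thesis by simp
  qed
  then show ?thesis unfolding hausdorff_measure_def by simp
qed

section \<open>Frostman weights on finite sets\<close>

definition nbrs :: "('a::euclidean_space \<Rightarrow> int) \<Rightarrow> ('a \<Rightarrow> int) set" where
  "nbrs k = {k'. (\<forall>b\<in>Basis. \<bar>k' b - k b\<bar> \<le> 1) \<and> (\<forall>b. b \<notin> Basis \<longrightarrow> k' b = 0)}"

lemma nbrs_card:
  fixes k :: "'a::euclidean_space \<Rightarrow> int"
  shows "finite (nbrs k)" "card (nbrs k) \<le> 3 ^ DIM('a)"
proof -
  let ?P = "PiE (Basis :: 'a set) (\<lambda>b. {k b - 1..k b + 1})"
  let ?e = "\<lambda>f b. if b \<in> (Basis :: 'a set) then f b else (0::int)"
  have fin: "finite ?P" by (intro finite_PiE) auto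
  have sub: "nbrs k \<subseteq> ?e ` ?P"
  proof
    fix k' assume k': "k' \<in> nbrs k"
    have "k' = ?e (restrict k' Basis)" using k' unfolding nbrs_def by (auto simp: fun_eq_iff)
    moreover have "restrict k' Basis \<in> ?P" using k' unfolding nbrs_def by (auto simp: abs_le_iff)
    ultimately show "k' \<in> ?e ` ?P" by (rule image_eqI)
  qed
  then show "finite (nbrs k)" using fin by (rule finite_subset[OF _ finite_imageI])
  have "card (nbrs k) \<le> card (?e ` ?P)" using sub fin by (intro card_mono) auto
  also have "\<dots> \<le> card ?P" by (rule card_image_le[OF fin])
  also have "\<dots> = 3 ^ DIM('a)" by (subst card_PiE) auto
  finally show "card (nbrs k) \<le> 3 ^ DIM('a)" .
qed

lemma cell_nbrs:
  fixes x y :: "'a::euclidean_space"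
  assumes "dist x y \<le> 1 / 2^j" shows "cell j y \<in> nbrs (cell j x)"
proof -
  have "\<bar>\<lfloor>2^j * (y \<bullet> b)\<rfloor> - \<lfloor>2^j * (x \<bullet> b)\<rfloor>\<bar> \<le> 1" if b: "b \<in> Basis" for b
  proof -
    have "\<bar>(y - x) \<bullet> b\<bar> \<le> norm (y - x)" using Basis_le_norm[OF b] .
    also have "\<dots> \<le> 1 / 2^j" using assms by (simp add: dist_norm norm_minus_commute)
    finally have "2^j * \<bar>(y - x) \<bullet> b\<bar> \<le> 1" by (simp add: field_simps)
    then have "\<bar>2^j * ((y - x) \<bullet> b)\<bar> \<le> 1" by (simp add: abs_mult)
    moreover have "2^j * ((y - x) \<bullet> b) = 2^j * (y \<bullet> b) - 2^j * (x \<bullet> b)" by (simp add: algebra_simps)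
    ultimately show ?thesis by linarith
  qed
  then show ?thesis unfolding nbrs_def cell_def by auto
qed

lemma dist_same_unit_cell:
  fixes x y :: "'a::euclidean_space"
  assumes "cell 0 x = cell 0 y" shows "dist x y \<le> sqrt (DIM('a))"
proof -
  have "((x - y) \<bullet> b) * ((x - y) \<bullet> b) \<le> 1" if b: "b \<in> Basis" for b
  proof -
    have "\<lfloor>x \<bullet> b\<rfloor> = \<lfloor>y \<bullet> b\<rfloor>" using fun_cong[OF assms, of b] b unfolding cell_def by simp
    then have "\<bar>(x - y) \<bullet> b\<bar> \<le> 1" unfolding inner_diff_left by linarith
    then show ?thesis using abs_le_square_iff[of "(x - y) \<bullet> b" 1] by (simp add: power2_eq_square)
  qed
  then have "(\<Sum>b\<in>Basis. ((x - y) \<bullet> b) * ((x - y) \<bullet> b)) \<le> (\<Sum>b\<in>(Basis::'a set). 1)" by (rule sum_mono)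
  then have "(x - y) \<bullet> (x - y) \<le> DIM('a)" unfolding euclidean_inner[of "x - y" "x - y"] by simp
  then show ?thesis unfolding dist_norm norm_eq_sqrt_inner by simp
qed

lemma finite_cells_bounded:
  fixes A :: "'a::euclidean_space set"
  assumes "bounded A" shows "finite (cell n ` A)"
proof -
  obtain B where B: "\<And>x. x \<in> A \<Longrightarrow> norm x \<le> B" using assms unfolding bounded_iff by blast
  let ?P = "PiE (Basis :: 'a set) (\<lambda>b. {\<lfloor>- (2^n * B)\<rfloor>..\<lfloor>2^n * B\<rfloor>})"
  let ?e = "\<lambda>f b. if b \<in> (Basis :: 'a set) then f b else (0::int)"
  have "cell n ` A \<subseteq> ?e ` ?P"
  proof
    fix k assume "k \<in> cell n ` A"
    then obtain x where x: "x \<in> A" "k = cell n x" by blast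
    have "\<lfloor>- (2^n * B)\<rfloor> \<le> \<lfloor>2^n * (x \<bullet> b)\<rfloor> \<and> \<lfloor>2^n * (x \<bullet> b)\<rfloor> \<le> \<lfloor>2^n * B\<rfloor>" if b: "b \<in> Basis" for b
    proof -
      have *: "\<bar>x \<bullet> b\<bar> \<le> B" using Basis_le_norm[OF b, of x] B[OF x(1)] by linarith
      have "2^n * (x \<bullet> b) \<le> 2^n * B" "2^n * (- B) \<le> 2^n * (x \<bullet> b)"
        using mult_left_mono[of "x \<bullet> b" B "2^n"] mult_left_mono[of "- B" "x \<bullet> b" "2^n"] * by auto
      then show ?thesis by (auto intro!: floor_mono)
    qed
    then have "restrict k Basis \<in> ?P" unfolding x cell_def by auto
    moreover have "k = ?e (restrict k Basis)" unfolding x cell_def by auto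
    ultimately show "k \<in> ?e ` ?P" by blast
  qed
  moreover have "finite (?e ` ?P)" by (intro finite_imageI finite_PiE) auto
  ultimately show ?thesis by (rule finite_subset)
qed

text \<open>The equality clause is a maximality condition: every point sits in a full cell. It is
  what later bounds the total mass from below.\<close>

definition saturated :: "'a::euclidean_space set \<Rightarrow> nat \<Rightarrow> real \<Rightarrow> nat \<Rightarrow> ('a \<Rightarrow> real) \<Rightarrow> bool" where
  "saturated Z n s m w \<longleftrightarrow> (\<forall>x. 0 \<le> w x) \<and>
    (\<forall>j k. m \<le> j \<and> j \<le> n \<longrightarrow> (\<Sum>z | z \<in> Z \<and> cell j z = k. w z) \<le> (1/2^j) powr s) \<and>
    (\<forall>z\<in>Z. \<exists>j. m \<le> j \<and> j \<le> n \<and> (\<Sum>x | x \<in> Z \<and> cell j x = cell j z. w x) = (1/2^j) powr s)"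

text \<open>Frostman's construction, from the finest level upwards. A cell of level \<open>m\<close>
  with too much mass is scaled down to exactly the allowed amount and thereby becomes full; points
  in the other cells keep their weights and their old full cells.\<close>

lemma saturated_weights:
  fixes Z :: "'a::euclidean_space set" and s :: real
  assumes fin: "finite Z" and inj: "inj_on (cell n) Z" and "m \<le> n"
  shows "\<exists>w. saturated Z n s m w"
  using \<open>m \<le> n\<close>
proof (induction m rule: inc_induct)
  case base
  let ?w = "\<lambda>x. (1/2^n) powr s"
  have one: "{x \<in> Z. cell n x = cell n z} = {z}" if "z \<in> Z" for z using inj that by (auto dest: inj_onD)
  have "(\<Sum>z | z \<in> Z \<and> cell n z = k. ?w z) \<le> (1/2^n) powr s" for k
  proof (cases "\<exists>z\<in>Z. cell n z = k")
    case True
    then obtain z where "z \<in> Z" "cell n z = k" by blast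
    then show ?thesis using one[of z] by simp
  next
    case False
    then have "{z \<in> Z. cell n z = k} = {}" by auto
    then show ?thesis by (simp only: sum.empty) simp
  qed
  note le = this
  have eq: "(\<Sum>x | x \<in> Z \<and> cell n x = cell n z. ?w x) = (1/2^n) powr s" if "z \<in> Z" for z using one[OF that] by simp
  have "saturated Z n s n ?w" unfolding saturated_def
  proof (intro conjI allI impI ballI)
    show "0 \<le> (1 / (2::real)^n) powr s" by simp
    show "(\<Sum>z | z \<in> Z \<and> cell j z = k. ?w z) \<le> (1/2^j) powr s" if "n \<le> j \<and> j \<le> n" for j k
      using le[of k] that by (metis le_antisym)
    show "\<exists>j. n \<le> j \<and> j \<le> n \<and> (\<Sum>x | x \<in> Z \<and> cell j x = cell j z. ?w x) = (1/2^j) powr s" if "z \<in> Z" for z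
      using eq[OF that] by blast
  qed
  then show ?case by blast
next
  case (step m)
  then obtain w where "saturated Z n s (Suc m) w" by blast
  then have w0: "\<And>x. 0 \<le> w x"
    and wle: "\<And>j k. \<lbrakk>Suc m \<le> j; j \<le> n\<rbrakk> \<Longrightarrow> (\<Sum>z | z \<in> Z \<and> cell j z = k. w z) \<le> (1/2^j) powr s"
    and sat: "\<And>z. z \<in> Z \<Longrightarrow> \<exists>j. Suc m \<le> j \<and> j \<le> n \<and> (\<Sum>x | x \<in> Z \<and> cell j x = cell j z. w x) = (1/2^j) powr s"
    unfolding saturated_def by blast+
  define M where "M k = (\<Sum>z | z \<in> Z \<and> cell m z = k. w z)" for k
  define b where "b = (1 / (2::real)^m) powr s"
  have b0: "b > 0" unfolding b_def by simp
  define f where "f k = (if M k > b then b / M k else 1)" for k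
  have f: "0 \<le> f k" "f k \<le> 1" for k unfolding f_def using b0 by auto
  define w' where "w' x = w x * f (cell m x)" for x
  have w'0: "0 \<le> w' x" for x unfolding w'_def using w0 f by simp
  have M': "(\<Sum>z | z \<in> Z \<and> cell m z = k. w' z) = M k * f k" for k
    unfolding M_def sum_distrib_right by (rule sum.cong) (auto simp: w'_def)
  have le: "(\<Sum>z | z \<in> Z \<and> cell j z = k. w' z) \<le> (1/2^j) powr s" if j: "m \<le> j" "j \<le> n" for j k
  proof (cases "j = m")
    case True
    have "M k * f k \<le> b" unfolding f_def using b0 by auto
    then show ?thesis using M'[of k] unfolding True b_def by simp
  next
    case False
    have "(\<Sum>z | z \<in> Z \<and> cell j z = k. w' z) \<le> (\<Sum>z | z \<in> Z \<and> cell j z = k. w z)"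
    proof (rule sum_mono)
      fix z show "w' z \<le> w z" unfolding w'_def using mult_left_mono[OF f(2) w0] by simp
    qed
    also have "\<dots> \<le> (1/2^j) powr s" using wle[of j k] j False by simp
    finally show ?thesis .
  qed
  have "\<exists>j. m \<le> j \<and> j \<le> n \<and> (\<Sum>x | x \<in> Z \<and> cell j x = cell j z. w' x) = (1/2^j) powr s" if z: "z \<in> Z" for z
  proof (cases "M (cell m z) > b")
    case True
    then have "(\<Sum>x | x \<in> Z \<and> cell m x = cell m z. w' x) = b" unfolding M' f_def using b0 by auto
    then show ?thesis using step.hyps unfolding b_def by (intro exI[of _ m]) auto
  next
    case False
    obtain j where j: "Suc m \<le> j" "j \<le> n" "(\<Sum>x | x \<in> Z \<and> cell j x = cell j z. w x) = (1/2^j) powr s" using sat[OF z] by blast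
    have "(\<Sum>x | x \<in> Z \<and> cell j x = cell j z. w' x) = (\<Sum>x | x \<in> Z \<and> cell j x = cell j z. w x)"
    proof (rule sum.cong[OF refl])
      fix x assume "x \<in> {x \<in> Z. cell j x = cell j z}"
      then have "cell m x = cell m z" using cell_coarser[of j x z m] j by auto
      then show "w' x = w x" unfolding w'_def f_def using False by simp
    qed
    then show ?thesis using j by (intro exI[of _ j]) auto
  qed
  then have "saturated Z n s m w'" unfolding saturated_def using w'0 le by blast
  then show ?case by blast
qed

definition cover_bound :: "nat \<Rightarrow> real \<Rightarrow> real \<Rightarrow> 'a::euclidean_space set \<Rightarrow> bool" where
  "cover_bound n s c A \<longleftrightarrow> (\<forall>\<C>. finite \<C> \<and> (\<forall>\<kappa>\<in>\<C>. fst \<kappa> \<le> n) \<and> A \<subseteq> covers \<C> \<longrightarrow>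
     c \<le> (\<Sum>\<kappa>\<in>\<C>. (1/2^fst \<kappa>) powr s))"

text \<open>One representative is taken in each cell of level \<open>n\<close>. The coarsest full
  cells around the representatives partition them and cover \<open>A\<close>, so the total mass
  equals the cost of a cover and is at least \<open>c\<close>.\<close>

lemma cell_weights_exist:
  fixes A :: "'a::euclidean_space set" and s c :: real
  assumes bd: "bounded A"
    and cov: "cover_bound n s c A"
  shows "\<exists>Z w. finite Z \<and> Z \<subseteq> A \<and> (\<forall>x. 0 \<le> w x) \<and> c \<le> sum w Z \<and>
    (\<forall>j k. j \<le> n \<longrightarrow> (\<Sum>z | z \<in> Z \<and> cell j z = k. w z) \<le> (1/2^j) powr s)"
proof -
  define Z where "Z = inv_into A (cell n) ` cell n ` A"
  have fin: "finite Z" unfolding Z_def using finite_cells_bounded[OF bd] by simp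
  have ZA: "Z \<subseteq> A" unfolding Z_def by (auto intro: inv_into_into)
  have inj: "inj_on (cell n) Z" unfolding Z_def by (auto intro!: inj_onI simp: f_inv_into_f)
  have rep: "\<exists>z\<in>Z. cell n z = cell n x" if "x \<in> A" for x
    using that unfolding Z_def by (intro bexI[of _ "inv_into A (cell n) (cell n x)"]) (auto simp: f_inv_into_f)
  obtain w where "saturated Z n s 0 w" using saturated_weights[OF fin inj, of 0 s] by blast
  then have w0: "\<And>x. 0 \<le> w x"
    and wle: "\<And>j k. j \<le> n \<Longrightarrow> (\<Sum>z | z \<in> Z \<and> cell j z = k. w z) \<le> (1/2^j) powr s"
    and sat: "\<And>z. z \<in> Z \<Longrightarrow> \<exists>j. j \<le> n \<and> (\<Sum>x | x \<in> Z \<and> cell j x = cell j z. w x) = (1/2^j) powr s"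
    unfolding saturated_def by blast+
  define S where "S z j \<longleftrightarrow> j \<le> n \<and> (\<Sum>x | x \<in> Z \<and> cell j x = cell j z. w x) = (1/2^j) powr s" for z j
  define J where "J z = (LEAST j. S z j)" for z
  have SJ: "S z (J z)" if "z \<in> Z" for z unfolding J_def using sat[OF that] unfolding S_def[symmetric] by (rule LeastI_ex)
  have Jle: "J z \<le> j" if "S z j" for z j unfolding J_def using that by (rule Least_le)
  define g where "g z = (J z, cell (J z) z)" for z
  have sum_g: "sum w Z = (\<Sum>\<kappa>\<in>g ` Z. (1/2^fst \<kappa>) powr s)"
  proof -
    have "sum w Z = (\<Sum>\<kappa>\<in>g ` Z. \<Sum>z | z \<in> Z \<and> g z = \<kappa>. w z)" by (rule sum.image_gen[OF fin])
    also have "\<dots> = (\<Sum>\<kappa>\<in>g ` Z. (1/2^fst \<kappa>) powr s)"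
    proof (rule sum.cong[OF refl])
      fix \<kappa> assume "\<kappa> \<in> g ` Z"
      then obtain z where z: "z \<in> Z" "\<kappa> = g z" by blast
      \<comment> \<open>Fullness depends only on the cell, so points of one coarsest full cell have
        the same least level.\<close>
      have "{x \<in> Z. g x = g z} = {x \<in> Z. cell (J z) x = cell (J z) z}"
      proof (intro Collect_cong conj_cong refl iffI)
        fix x assume x: "x \<in> Z" "cell (J z) x = cell (J z) z"
        have "S x (J z)" using SJ[OF z(1)] x(2) unfolding S_def by simp
        then have le: "J x \<le> J z" by (rule Jle)
        then have "cell (J x) x = cell (J x) z" using cell_coarser[OF x(2)] by simp
        then have "S z (J x)" using SJ[OF x(1)] unfolding S_def by simp
        then have "J z \<le> J x" by (rule Jle)
        then show "g x = g z" using le x(2) unfolding g_def by simp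
      qed (auto simp: g_def)
      then show "(\<Sum>x | x \<in> Z \<and> g x = \<kappa>. w x) = (1/2^fst \<kappa>) powr s"
        using SJ[OF z(1)] unfolding z(2) S_def g_def by simp
    qed
    finally show ?thesis .
  qed
  have "c \<le> (\<Sum>\<kappa>\<in>g ` Z. (1/2^fst \<kappa>) powr s)"
  proof (rule cov[unfolded cover_bound_def, rule_format], intro conjI ballI)
    show "fst \<kappa> \<le> n" if "\<kappa> \<in> g ` Z" for \<kappa> using that SJ unfolding g_def S_def by auto
    show "A \<subseteq> covers (g ` Z)"
    proof
      fix x assume "x \<in> A"
      then obtain z where z: "z \<in> Z" "cell n z = cell n x" using rep by blast
      have "cell (J z) z = cell (J z) x" using cell_coarser[OF z(2)] SJ[OF z(1)] unfolding S_def by simp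
      then have "(J z, cell (J z) x) = g z" unfolding g_def by simp
      then show "x \<in> covers (g ` Z)" using z(1) unfolding covers_def by (auto intro!: exI[of _ "J z"])
    qed
  qed (use fin in simp)
  then have "c \<le> sum w Z" unfolding sum_g .
  then show ?thesis using fin ZA w0 wle by blast
qed

text \<open>A set of diameter at most \<open>l \<le> 1\<close> meets at most
  \<open>3 ^ DIM('a)\<close> cells of the level whose side lies between \<open>l\<close> and
  \<open>2 * l\<close>, whence the constant. Pigeonholing into a single unit cell bounds the
  diameter of the support and costs the number of unit cells met by \<open>A\<close>.\<close>

lemma frostman_exists:
  fixes A :: "'a::euclidean_space set" and s c :: real
  assumes bd: "bounded A" and c: "0 < c" and s: "0 < s" "s \<le> 1"
    and cov: "cover_bound n s c A"
  shows "\<exists>Z w. Z \<subseteq> A \<and> frostman Z w (1/2^n) s (2 * 3 ^ DIM('a)) \<and> c / card (cell 0 ` A) \<le> sum w Z \<and>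
    (\<forall>x\<in>Z. \<forall>y\<in>Z. dist x y \<le> sqrt (DIM('a)))"
proof -
  from cell_weights_exist[OF bd cov]
  obtain Z0 w where Zw: "finite Z0 \<and> Z0 \<subseteq> A \<and> (\<forall>x. 0 \<le> w x) \<and> c \<le> sum w Z0 \<and>
      (\<forall>j k. j \<le> n \<longrightarrow> (\<Sum>z | z \<in> Z0 \<and> cell j z = k. w z) \<le> (1/2^j) powr s)"
    by (elim exE)
  then have Z0: "finite Z0" "Z0 \<subseteq> A" and w0: "\<And>x. 0 \<le> w x" and cw: "c \<le> sum w Z0"
    and wle: "\<And>j k. j \<le> n \<Longrightarrow> (\<Sum>z | z \<in> Z0 \<and> cell j z = k. w z) \<le> (1/2^j) powr s"
    by simp_all
  let ?N = "card (cell 0 ` A)"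
  have finN: "finite (cell 0 ` A)" by (rule finite_cells_bounded[OF bd])
  have "Z0 \<noteq> {}" using cw c by auto
  then have N: "?N > 0" using Z0 finN by (auto simp: card_gt_0_iff)
  have "\<exists>k\<in>cell 0 ` A. c / ?N \<le> (\<Sum>z | z \<in> Z0 \<and> cell 0 z = k. w z)"
  proof (rule ccontr)
    assume "\<not> ?thesis"
    then have lt: "(\<Sum>z | z \<in> Z0 \<and> cell 0 z = k. w z) < c / ?N" if "k \<in> cell 0 ` A" for k using that by auto
    have "sum w Z0 = (\<Sum>k\<in>cell 0 ` A. \<Sum>z | z \<in> Z0 \<and> cell 0 z = k. w z)"
      using Z0 finN by (intro sum.group[symmetric]) auto
    also have "\<dots> < (\<Sum>k\<in>cell 0 ` A. c / ?N)" using lt finN N by (intro sum_strict_mono) auto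
    also have "\<dots> = c" using N by simp
    finally show False using cw by simp
  qed
  then obtain k0 where k0: "c / ?N \<le> (\<Sum>z | z \<in> Z0 \<and> cell 0 z = k0. w z)" by blast
  define Z where "Z = {z \<in> Z0. cell 0 z = k0}"
  have finZ: "finite Z" unfolding Z_def using Z0 by simp
  have fr: "sum w Y \<le> 2 * 3 ^ DIM('a) * l powr s" if Y: "Y \<subseteq> Z" and l: "1/2^n \<le> l" and d: "\<And>x y. x \<in> Y \<Longrightarrow> y \<in> Y \<Longrightarrow> dist x y \<le> l" for Y l
  proof (cases "Y = {} \<or> l > 1")
    case True
    have K: "(1::real) \<le> 2 * 3 ^ DIM('a)" using one_le_power[of "3::real" "DIM('a)"] by linarith
    have l0: "l > 0" using l by (rule less_le_trans[rotated]) simp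
    have "sum w Y \<le> l powr s"
    proof (cases "Y = {}")
      case False
      then have "l > 1" using True by simp
      have "sum w Y \<le> sum w Z" by (rule sum_mono2[OF finZ Y w0])
      also have "\<dots> \<le> 1" using wle[of 0 k0] unfolding Z_def by simp
      also have "\<dots> \<le> l powr s" using \<open>l > 1\<close> s by (simp add: ge_one_powr_ge_zero)
      finally show ?thesis .
    qed simp
    also have "\<dots> \<le> 2 * 3 ^ DIM('a) * l powr s" using K mult_right_mono[OF K, of "l powr s"] by simp
    finally show ?thesis .
  next
    case False
    then obtain y0 where y0: "y0 \<in> Y" and l1: "l \<le> 1" by auto
    have l0: "l > 0" using l by (rule less_le_trans[rotated]) simp
    define j where "j = (GREATEST j. l \<le> 1/2^j)"
    have bdd: "i \<le> n" if "l \<le> 1/2^i" for i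
    proof (rule ccontr)
      assume "\<not> i \<le> n"
      then have "(2::real)^n < 2^i" by (intro power_strict_increasing) auto
      then have "1/2^i < 1/(2::real)^n" by (intro divide_strict_left_mono) auto
      then show False using that l by linarith
    qed
    have "l \<le> 1/2^(0::nat)" using l1 by simp
    then have j: "l \<le> 1/2^j" unfolding j_def using bdd by (rule GreatestI_nat)
    have jn: "j \<le> n" using bdd[OF j] .
    have "\<not> l \<le> 1/2^(Suc j)"
    proof
      assume "l \<le> 1/2^(Suc j)"
      then have "Suc j \<le> j" unfolding j_def using bdd by (rule Greatest_le_nat)
      then show False by simp
    qed
    then have j2: "1/2^j < 2 * l" by (simp add: field_simps)
    have sub: "cell j ` Y \<subseteq> nbrs (cell j y0)" using d[OF y0] j cell_nbrs[of y0 _ j] by (auto intro: order_trans)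
    have "sum w Y = (\<Sum>k\<in>nbrs (cell j y0). \<Sum>z | z \<in> Y \<and> cell j z = k. w z)"
      using sub nbrs_card(1) Y finZ by (intro sum.group[symmetric]) (auto intro: finite_subset)
    also have "\<dots> \<le> (\<Sum>k\<in>nbrs (cell j y0). (1/2^j) powr s)"
    proof (rule sum_mono)
      fix k
      have "(\<Sum>z | z \<in> Y \<and> cell j z = k. w z) \<le> (\<Sum>z | z \<in> Z0 \<and> cell j z = k. w z)"
        by (rule sum_mono2[OF _ _ w0]) (use Y Z0 in \<open>auto simp: Z_def\<close>)
      also have "\<dots> \<le> (1/2^j) powr s" by (rule wle[OF jn])
      finally show "(\<Sum>z | z \<in> Y \<and> cell j z = k. w z) \<le> (1/2^j) powr s" .
    qed
    also have "\<dots> = card (nbrs (cell j y0)) * (1/2^j) powr s" by simp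
    also have "\<dots> \<le> 3 ^ DIM('a) * (2 * l powr s)"
    proof (rule mult_mono)
      show "real (card (nbrs (cell j y0))) \<le> 3 ^ DIM('a)"
        using nbrs_card(2)[of "cell j y0"] by (metis of_nat_le_iff of_nat_numeral of_nat_power)
      have "(1/2^j) powr s \<le> (2 * l) powr s" using j2 s by (intro powr_mono2) auto
      also have "\<dots> = 2 powr s * l powr s" using l0 by (simp add: powr_mult)
      also have "\<dots> \<le> 2 powr 1 * l powr s" using s by (intro mult_right_mono powr_mono) auto
      finally show "(1/2^j) powr s \<le> 2 * l powr s" by simp
    qed auto
    finally show ?thesis by (simp add: mult_ac)
  qed
  have "frostman Z w (1/2^n) s (2 * 3 ^ DIM('a))" unfolding frostman_def using finZ w0 fr by blast
  moreover have "dist x y \<le> sqrt (DIM('a))" if "x \<in> Z" "y \<in> Z" for x y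
    using that unfolding Z_def by (intro dist_same_unit_cell) auto
  moreover have "Z \<subseteq> A" "c / ?N \<le> sum w Z" using Z0 k0 unfolding Z_def by auto
  ultimately show ?thesis by blast
qed

section \<open>Capacitability of analytic sets\<close>

lemma cover_bound_net_content:
  assumes "ennreal c \<le> net_content s A" "0 \<le> c"
  shows "cover_bound n s c A"
  unfolding cover_bound_def
proof (intro allI impI, elim conjE)
  fix \<C> :: "(nat \<times> ('a \<Rightarrow> int)) set" assume f: "finite \<C>" and A: "A \<subseteq> covers \<C>"
  have "ennreal c \<le> cost s \<C>" using assms(1) net_content_le[OF A] by (rule order_trans)
  then show "c \<le> (\<Sum>\<kappa>\<in>\<C>. (1/2^fst \<kappa>) powr s)"
    unfolding cost_finite[OF f] by (simp add: ennreal_le_iff sum_nonneg)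
qed

lemma compact_box: "compact {\<sigma> :: nat \<Rightarrow> nat. \<forall>i. \<sigma> i \<le> h i}"
proof -
  have "compactin (product_topology (\<lambda>_. euclidean) UNIV) (PiE UNIV (\<lambda>i. {..h i}))"
    unfolding compactin_PiE by (auto intro: finite_imp_compact)
  moreover have "PiE UNIV (\<lambda>i. {..h i}) = {\<sigma> :: nat \<Rightarrow> nat. \<forall>i. \<sigma> i \<le> h i}" by (auto simp: PiE_def Pi_def)
  ultimately show ?thesis by (simp add: euclidean_product_topology)
qed

text \<open>Otherwise there are points with ever longer good prefixes and images outside
  \<open>O'\<close>. They lie in one compact box, a limit point has all coordinates bounded by
  \<open>h\<close>, and its image in the open set \<open>O'\<close> is a contradiction.\<close>

lemma box_neighbourhood:
  fixes f :: "(nat \<Rightarrow> nat) \<Rightarrow> 'a::metric_space"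
  assumes f: "continuous_on UNIV f" and O: "open O'" "f ` {\<sigma>. \<forall>i. \<sigma> i \<le> h i} \<subseteq> O'"
  shows "\<exists>m. f ` {\<sigma>. \<forall>i<m. \<sigma> i \<le> h i} \<subseteq> O'"
proof (rule ccontr)
  assume "\<not> ?thesis"
  then have "\<forall>m. \<exists>\<sigma>. (\<forall>i<m. \<sigma> i \<le> h i) \<and> f \<sigma> \<notin> O'" by blast
  from choice[OF this] obtain \<sigma> where "\<forall>m. (\<forall>i<m. \<sigma> m i \<le> h i) \<and> f (\<sigma> m) \<notin> O'" ..
  then have s: "\<And>m i. i < m \<Longrightarrow> \<sigma> m i \<le> h i" "\<And>m. f (\<sigma> m) \<notin> O'" by blast+
  \<comment> \<open>Coordinate \<open>i\<close> can exceed \<open>h i\<close> only for the finitely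
    many \<open>m \<le> i\<close>; adding those values bounds the whole sequence.\<close>
  define g where "g i = h i + (\<Sum>m\<le>i. \<sigma> m i)" for i
  have "\<sigma> m i \<le> g i" for m i
  proof (cases "i < m")
    case True then show ?thesis using s(1)[of i m] unfolding g_def by simp
  next
    case False
    then have "\<sigma> m i \<le> (\<Sum>m\<le>i. \<sigma> m i)" by (intro member_le_sum) auto
    then show ?thesis unfolding g_def by simp
  qed
  then have "\<forall>m. \<sigma> m \<in> {\<sigma>. \<forall>i. \<sigma> i \<le> g i}" by simp
  with compact_imp_seq_compact[OF compact_box[of g]]
  obtain l r where l: "l \<in> {\<sigma>. \<forall>i. \<sigma> i \<le> g i}" "strict_mono r" "(\<sigma> \<circ> r) \<longlonglongrightarrow> l"
    by (rule seq_compactE)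
  have "l i \<le> h i" for i
  proof -
    have cont: "continuous_on UNIV (\<lambda>\<sigma> :: nat \<Rightarrow> nat. \<sigma> i)" by simp
    have lim: "(\<lambda>k. (\<sigma> \<circ> r) k i) \<longlonglongrightarrow> l i"
      by (rule continuous_on_tendsto_compose[OF cont l(3)]) auto
    show ?thesis
    proof (rule LIMSEQ_le_const2[OF lim], intro exI allI impI)
      fix k assume "Suc i \<le> k"
      then have "i < r k" using seq_suble[OF l(2), of k] by simp
      then show "(\<sigma> \<circ> r) k i \<le> h i" using s(1) by simp
    qed
  qed
  then have "f l \<in> O'" using O(2) by blast
  have "(\<lambda>k. f ((\<sigma> \<circ> r) k)) \<longlonglongrightarrow> f l"
    by (rule continuous_on_tendsto_compose[OF f l(3)]) auto
  from topological_tendstoD[OF this O(1) \<open>f l \<in> O'\<close>]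
  have "eventually (\<lambda>k. f ((\<sigma> \<circ> r) k) \<in> O') sequentially" .
  then show False using s(2) by (auto simp: eventually_sequentially)
qed

lemma sum_UN_le:
  fixes g :: "'b \<Rightarrow> real"
  assumes "finite I" "\<And>i. i \<in> I \<Longrightarrow> finite (A i)" "\<And>x. 0 \<le> g x"
  shows "sum g (\<Union>i\<in>I. A i) \<le> (\<Sum>i\<in>I. sum g (A i))"
  using assms(1,2)
proof (induction I rule: finite_induct)
  case (insert x F)
  have "sum g (\<Union>i\<in>insert x F. A i) = sum g (A x \<union> (\<Union>i\<in>F. A i))" by simp
  also have "\<dots> \<le> sum g (A x) + sum g (\<Union>i\<in>F. A i)"
    using insert assms(3) by (subst sum_Un) (auto intro!: sum_nonneg)
  also have "\<dots> \<le> sum g (A x) + (\<Sum>i\<in>F. sum g (A i))" using insert by simp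
  finally show ?case using insert by simp
qed simp

text \<open>Choquet's argument: coordinates are bounded one after another while the content stays
  above \<open>c\<close>, by continuity from below. Cells are not open, so a cover of the compact
  image is enlarged by all neighbouring cells before it can contain the image of a box with finitely
  many constraints; this costs \<open>3 ^ DIM('a)\<close>.\<close>

lemma compact_capacity:
  fixes f :: "(nat \<Rightarrow> nat) \<Rightarrow> 'a::euclidean_space"
  assumes f: "continuous_on UNIV f" and c: "ennreal c < net_content s (range f)" "0 < c"
  shows "\<exists>C \<subseteq> range f. compact C \<and> (\<forall>n. cover_bound n s (c / 3 ^ DIM('a)) C)"
proof -
  define B where "B m h = {\<sigma> :: nat \<Rightarrow> nat. \<forall>i<m. \<sigma> i \<le> h i}" for m and h :: "nat \<Rightarrow> nat"
  have "\<exists>F. \<forall>m. ennreal c < net_content s (f ` B m (F m)) \<and> (\<forall>i<m. F (Suc m) i = F m i)"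
  proof (rule dependent_nat_choice)
    show "\<exists>h. ennreal c < net_content s (f ` B 0 h)" using c unfolding B_def by simp
    fix h m assume h: "ennreal c < net_content s (f ` B m h)"
    have "\<exists>k. ennreal c < net_content s (f ` B (Suc m) (h(m := k)))"
    proof (rule ccontr)
      assume "\<not> ?thesis"
      then have le: "net_content s (f ` B (Suc m) (h(m := k))) \<le> ennreal c" for k by (simp add: not_less)
      have "incseq (\<lambda>k. f ` B (Suc m) (h(m := k)))"
        unfolding incseq_def B_def by (auto simp: less_Suc_eq intro!: image_mono)
      then have "net_content s (\<Union>k. f ` B (Suc m) (h(m := k))) \<le> ennreal c" using le by (rule net_content_incseq)
      moreover have "f ` B m h \<subseteq> (\<Union>k. f ` B (Suc m) (h(m := k)))"
      proof
        fix x assume "x \<in> f ` B m h"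
        then obtain \<sigma> where \<sigma>: "\<sigma> \<in> B m h" "x = f \<sigma>" by blast
        then have "\<sigma> \<in> B (Suc m) (h(m := \<sigma> m))" unfolding B_def by (auto simp: less_Suc_eq)
        then show "x \<in> (\<Union>k. f ` B (Suc m) (h(m := k)))" using \<sigma> by blast
      qed
      ultimately have "net_content s (f ` B m h) \<le> ennreal c" using net_content_mono order_trans by metis
      then show False using h by simp
    qed
    then obtain k where "ennreal c < net_content s (f ` B (Suc m) (h(m := k)))" ..
    then show "\<exists>h'. ennreal c < net_content s (f ` B (Suc m) h') \<and> (\<forall>i<m. h' i = h i)"
      by (intro exI[of _ "h(m := k)"]) auto
  qed
  then obtain F where F: "\<And>m. ennreal c < net_content s (f ` B m (F m))" "\<And>m i. i < m \<Longrightarrow> F (Suc m) i = F m i" by blast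
  define h where "h i = F (Suc i) i" for i
  have Fh: "F m i = h i" if "i < m" for m i
  proof -
    have "Suc i \<le> m" using that by simp
    then show ?thesis unfolding h_def
      by (induction m rule: dec_induct) (auto simp: F(2))
  qed
  have cB: "ennreal c < net_content s (f ` B m h)" for m
  proof -
    have "B m (F m) = B m h" unfolding B_def using Fh by auto
    then show ?thesis using F(1)[of m] by simp
  qed
  define P where "P = {\<sigma>. \<forall>i. \<sigma> i \<le> h i}"
  define C where "C = f ` P"
  have "compact C" unfolding C_def P_def
    by (rule compact_continuous_image[OF continuous_on_subset[OF f] compact_box]) simp
  moreover have "cover_bound n s (c / 3 ^ DIM('a)) C" for n
    unfolding cover_bound_def
  proof (intro allI impI, elim conjE)
    fix \<C> :: "(nat \<times> ('a \<Rightarrow> int)) set" assume fin: "finite \<C>" and n: "\<forall>\<kappa>\<in>\<C>. fst \<kappa> \<le> n" and C: "C \<subseteq> covers \<C>"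
    define O' where "O' = (\<Union>x\<in>C. ball x (1/2^n))"
    define \<D> where "\<D> = (\<Union>\<kappa>\<in>\<C>. Pair (fst \<kappa>) ` nbrs (snd \<kappa>))"
    have finD: "finite \<D>" unfolding \<D>_def using fin nbrs_card(1) by auto
    have OD: "O' \<subseteq> covers \<D>"
    proof
      fix y assume "y \<in> O'"
      then obtain x where x: "x \<in> C" "dist x y < 1/2^n" unfolding O'_def by auto
      then obtain j where j: "(j, cell j x) \<in> \<C>" using C unfolding covers_def by auto
      have "j \<le> n" using n j by auto
      then have "1/2^n \<le> 1/(2::real)^j" by (intro divide_left_mono power_increasing) auto
      then have "cell j y \<in> nbrs (cell j x)" using x by (intro cell_nbrs) auto
      then have "(j, cell j y) \<in> \<D>" using j unfolding \<D>_def by force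
      then show "y \<in> covers \<D>" unfolding covers_def by blast
    qed
    have "open O'" unfolding O'_def by auto
    moreover have "f ` {\<sigma>. \<forall>i. \<sigma> i \<le> h i} \<subseteq> O'"
    proof
      fix y assume "y \<in> f ` {\<sigma>. \<forall>i. \<sigma> i \<le> h i}"
      moreover have "y \<in> ball y (1/2^n)" by simp
      ultimately show "y \<in> O'" unfolding O'_def C_def P_def by blast
    qed
    ultimately obtain m where "f ` B m h \<subseteq> O'" using box_neighbourhood[OF f] unfolding B_def by blast
    then have "net_content s (f ` B m h) \<le> cost s \<D>" using OD by (intro net_content_le) blast
    then have "ennreal c \<le> cost s \<D>" using cB[of m] by simp
    then have "c \<le> (\<Sum>\<kappa>\<in>\<D>. (1/2^fst \<kappa>) powr s)" unfolding cost_finite[OF finD] by (simp add: sum_nonneg)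
    also have "\<dots> \<le> (\<Sum>\<kappa>\<in>\<C>. \<Sum>\<kappa>'\<in>Pair (fst \<kappa>) ` nbrs (snd \<kappa>). (1/2^fst \<kappa>') powr s)"
      unfolding \<D>_def by (rule sum_UN_le) (use fin nbrs_card(1) in auto)
    also have "\<dots> \<le> (\<Sum>\<kappa>\<in>\<C>. 3 ^ DIM('a) * (1/2^fst \<kappa>) powr s)"
    proof (rule sum_mono)
      fix \<kappa> :: "nat \<times> ('a \<Rightarrow> int)"
      have "(\<Sum>\<kappa>'\<in>Pair (fst \<kappa>) ` nbrs (snd \<kappa>). (1/2^fst \<kappa>') powr s) = card (nbrs (snd \<kappa>)) * (1/2^fst \<kappa>) powr s"
        by (subst sum.reindex) (auto intro: inj_onI)
      also have "\<dots> \<le> 3 ^ DIM('a) * (1/2^fst \<kappa>) powr s"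
        using nbrs_card(2)[of "snd \<kappa>"] by (intro mult_right_mono) (metis of_nat_le_iff of_nat_numeral of_nat_power, simp)
      finally show "(\<Sum>\<kappa>'\<in>Pair (fst \<kappa>) ` nbrs (snd \<kappa>). (1/2^fst \<kappa>') powr s) \<le> 3 ^ DIM('a) * (1/2^fst \<kappa>) powr s" .
    qed
    also have "\<dots> = (\<Sum>\<kappa>\<in>\<C>. (1/2^fst \<kappa>) powr s) * 3 ^ DIM('a)" by (simp add: sum_distrib_left mult.commute)
    finally show "c / 3 ^ DIM('a) \<le> (\<Sum>\<kappa>\<in>\<C>. (1/2^fst \<kappa>) powr s)" by (simp add: divide_le_eq)
  qed
  moreover have "C \<subseteq> range f" unfolding C_def by auto
  ultimately show ?thesis by blast
qed

lemma frostman_mono: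
  assumes "frostman X \<mu> \<delta> s C" "X' \<subseteq> X" "\<delta> \<le> \<delta>'" "C \<le> C'"
  shows "frostman X' \<mu> \<delta>' s C'"
  unfolding frostman_def
proof (intro conjI allI impI)
  show "finite X'" using frostmanD(1)[OF assms(1)] assms(2) by (rule finite_subset[rotated])
  show "0 \<le> \<mu> x" for x by (rule frostmanD(2)[OF assms(1)])
  fix Y l assume Y: "Y \<subseteq> X'" "\<delta>' \<le> l" "\<forall>x\<in>Y. \<forall>y\<in>Y. dist x y \<le> l"
  have "sum \<mu> Y \<le> C * l powr s" by (rule frostmanD(3)[OF assms(1)]) (use Y assms in auto)
  also have "\<dots> \<le> C' * l powr s" using assms(4) by (intro mult_right_mono) auto
  finally show "sum \<mu> Y \<le> C' * l powr s" .
qed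

text \<open>There are at most \<open>2 powr (k * t)\<close> slabs, so those of mass below
  \<open>M0\<close> carry together at most half of \<open>W * p\<close>. On the others the
  normalised coupling has row sums 1, and its total weight is their mass. Integrated over
  \<open>\<nu>\<close>, this is a lower bound for \<open>Ttot\<close>.\<close>

lemma projection_inequality:
  fixes Z :: "(real ^ 3) set" and w :: "real ^ 3 \<Rightarrow> real" and \<Theta> :: "real set" and \<nu> :: "real \<Rightarrow> real" and Y :: "real \<Rightarrow> real set" and p e C t :: real
  defines "W \<equiv> sum w Z" and "NN \<equiv> sum \<nu> \<Theta>"
  assumes frZ: "frostman Z w (1 / 2^k) e C" and fr\<Theta>: "frostman \<Theta> \<nu> (1 / 2^k) e C" and \<Theta>: "\<Theta> \<subseteq> {0..<2 * pi}"
    and diam: "\<And>a b. a \<in> Z \<Longrightarrow> b \<in> Z \<Longrightarrow> dist a b \<le> 2"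
    and e: "0 < e" "e \<le> 1" and C: "0 < C" and p: "0 < p" and W: "0 < W"
    and Y: "\<And>\<theta>. \<theta> \<in> \<Theta> \<Longrightarrow> finite (Y \<theta>)" "\<And>\<theta>. \<theta> \<in> \<Theta> \<Longrightarrow> real (card (Y \<theta>)) \<le> 2 powr (k * t)"
    and heavy: "\<And>\<theta>. \<theta> \<in> \<Theta> \<Longrightarrow> W * p \<le> (\<Sum>z | z \<in> Z \<and> (\<exists>y\<in>Y \<theta>. \<bar>wave z \<theta> - y\<bar> < 1 / 2^k). w z)"
  defines "M0 \<equiv> W * p / (2 * 2 powr (k * t))"
  shows "NN * (W * p / 2) \<le> NN * W * (130 * C * (2 / 2^k) powr e / M0) +
     2 * real k ^ 2 * (sqrt (4 * 10^8 * C^3 * (2 / 2^k) powr e / M0) * (real k + 1) * W)"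
proof -
  have M0: "M0 > 0" unfolding M0_def using W p by simp
  have finZ: "finite Z" using frostmanD(1)[OF frZ] .
  have w0: "0 \<le> w x" for x using frostmanD(2)[OF frZ] .
  have \<nu>0: "0 \<le> \<nu> x" for x using frostmanD(2)[OF fr\<Theta>] .
  define Zt where "Zt \<theta> = {z \<in> Z. \<exists>y\<in>Y \<theta>. \<bar>wave z \<theta> - y\<bar> < 1 / 2^k}" for \<theta>
  have ZtZ: "Zt \<theta> \<subseteq> Z" and finZt: "finite (Zt \<theta>)" for \<theta> unfolding Zt_def using finZ by auto
  \<comment> \<open>Slabs may overlap; choosing one centre per point turns them into a
    partition.\<close>
  define pick where "pick \<theta> z = (SOME y. y \<in> Y \<theta> \<and> \<bar>wave z \<theta> - y\<bar> < 1 / 2^k)" for \<theta> z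
  have pick: "pick \<theta> z \<in> Y \<theta>" "\<bar>wave z \<theta> - pick \<theta> z\<bar> < 1 / 2^k" if "z \<in> Zt \<theta>" for \<theta> z
  proof -
    have "\<exists>y. y \<in> Y \<theta> \<and> \<bar>wave z \<theta> - y\<bar> < 1 / 2^k" using that unfolding Zt_def by blast
    from someI_ex[OF this] show "pick \<theta> z \<in> Y \<theta>" "\<bar>wave z \<theta> - pick \<theta> z\<bar> < 1 / 2^k" unfolding pick_def by blast+
  qed
  define mass where "mass \<theta> y = (\<Sum>z | z \<in> Zt \<theta> \<and> pick \<theta> z = y. w z)" for \<theta> y
  define good where "good \<theta> = {z \<in> Zt \<theta>. M0 \<le> mass \<theta> (pick \<theta> z)}" for \<theta>
  define \<omega> where "\<omega> \<theta> a b = (if a \<in> good \<theta> \<and> b \<in> good \<theta> \<and> pick \<theta> a = pick \<theta> b then 1 / mass \<theta> (pick \<theta> a) else 0)" for \<theta> a b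
  have gZ: "good \<theta> \<subseteq> Z" for \<theta> unfolding good_def using ZtZ by blast
  have mass_pos: "M0 \<le> mass \<theta> (pick \<theta> a)" if "a \<in> good \<theta>" for a \<theta> using that unfolding good_def by auto
  have row1: "(\<Sum>b\<in>Z. w b * \<omega> \<theta> a b) = 1" if a: "a \<in> good \<theta>" for \<theta> a
  proof -
    have "(\<Sum>b\<in>Z. w b * \<omega> \<theta> a b) = (\<Sum>b | b \<in> Zt \<theta> \<and> pick \<theta> b = pick \<theta> a. w b * (1 / mass \<theta> (pick \<theta> a)))"
    proof (rule sum.mono_neutral_cong_right[OF finZ])
      show "{b. b \<in> Zt \<theta> \<and> pick \<theta> b = pick \<theta> a} \<subseteq> Z" using ZtZ by blast
      show "\<forall>b\<in>Z - {b. b \<in> Zt \<theta> \<and> pick \<theta> b = pick \<theta> a}. w b * \<omega> \<theta> a b = 0"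
        unfolding \<omega>_def good_def by auto
      fix b assume "b \<in> {b. b \<in> Zt \<theta> \<and> pick \<theta> b = pick \<theta> a}"
      then have "b \<in> good \<theta>" "pick \<theta> a = pick \<theta> b" using a unfolding good_def by auto
      then show "w b * \<omega> \<theta> a b = w b * (1 / mass \<theta> (pick \<theta> a))" using a unfolding \<omega>_def by simp
    qed
    also have "\<dots> = mass \<theta> (pick \<theta> a) * (1 / mass \<theta> (pick \<theta> a))" unfolding mass_def sum_distrib_right ..
    also have "\<dots> = 1" using mass_pos[OF a] M0 by simp
    finally show ?thesis .
  qed
  have row0: "(\<Sum>b\<in>Z. w b * \<omega> \<theta> a b) = 0" if "a \<notin> good \<theta>" for \<theta> a
    using that unfolding \<omega>_def by simp
  interpret K: projection_kernel Z w \<Theta> \<nu> \<omega> k e C M0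
  proof
    show "frostman Z w (1 / 2^k) e C" "frostman \<Theta> \<nu> (1 / 2^k) e C" "\<Theta> \<subseteq> {0..<2 * pi}" by fact+
    show "0 \<le> \<omega> \<theta> a b" for \<theta> a b unfolding \<omega>_def using mass_pos[of a \<theta>] M0 by auto
    show "\<omega> \<theta> a b = \<omega> \<theta> b a" for \<theta> a b unfolding \<omega>_def by auto
    show "(\<Sum>b\<in>Z. w b * \<omega> \<theta> a b) \<le> 1" for \<theta> a using row1[of a \<theta>] row0[of a \<theta>] by (cases "a \<in> good \<theta>") auto
    show "\<omega> \<theta> a b \<le> 1 / M0" for \<theta> a b
      unfolding \<omega>_def using mass_pos[of a \<theta>] M0 by (auto intro!: divide_left_mono mult_pos_pos)
    show "\<bar>wave a \<theta> - wave b \<theta>\<bar> \<le> 2 / 2^k" if "0 < \<omega> \<theta> a b" for \<theta> a b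
    proof -
      have ab: "a \<in> Zt \<theta>" "b \<in> Zt \<theta>" "pick \<theta> a = pick \<theta> b"
        using that unfolding \<omega>_def good_def by (auto split: if_splits)
      have "2 / (2::real)^k = 1 / 2^k + 1 / 2^k" by simp
      then show ?thesis using pick(2)[OF ab(1)] pick(2)[OF ab(2)] unfolding ab(3) by linarith
    qed
    show "dist a b \<le> 2" if "a \<in> Z" "b \<in> Z" for a b using diam that by blast
    show "0 < e" "e \<le> 1" "0 < C" "0 < M0" by fact+
  qed
  have lower: "W * p / 2 \<le> (\<Sum>a\<in>Z. \<Sum>b\<in>Z. w a * w b * \<omega> \<theta> a b)" if \<theta>: "\<theta> \<in> \<Theta>" for \<theta>
  proof -
    have "(\<Sum>a\<in>Z. \<Sum>b\<in>Z. w a * w b * \<omega> \<theta> a b) = (\<Sum>a\<in>Z. w a * (\<Sum>b\<in>Z. w b * \<omega> \<theta> a b))"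
      by (simp add: sum_distrib_left mult_ac)
    also have "\<dots> = (\<Sum>a\<in>good \<theta>. w a)"
      by (rule sum.mono_neutral_cong_right[OF finZ gZ]) (auto simp: row0 row1)
    finally have eq: "(\<Sum>a\<in>Z. \<Sum>b\<in>Z. w a * w b * \<omega> \<theta> a b) = sum w (good \<theta>)" .
    let ?bad = "Zt \<theta> - good \<theta>"
    have "sum w ?bad = (\<Sum>y\<in>Y \<theta>. \<Sum>z | z \<in> ?bad \<and> pick \<theta> z = y. w z)"
      using pick finZt Y(1)[OF \<theta>] by (intro sum.group[symmetric]) auto
    also have "\<dots> \<le> (\<Sum>y\<in>Y \<theta>. M0)"
    proof (rule sum_mono)
      fix y
      show "(\<Sum>z | z \<in> ?bad \<and> pick \<theta> z = y. w z) \<le> M0"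
      proof (cases "{z. z \<in> ?bad \<and> pick \<theta> z = y} = {}")
        case True
        then show ?thesis using M0 by (simp only: sum.empty less_imp_le)
      next
        case False
        then obtain z0 where z0: "z0 \<in> ?bad" "pick \<theta> z0 = y" by blast
        have "(\<Sum>z | z \<in> ?bad \<and> pick \<theta> z = y. w z) \<le> mass \<theta> y"
          unfolding mass_def by (rule sum_mono2[OF _ _ w0]) (use finZt in auto)
        also have "\<dots> \<le> M0" using z0 unfolding good_def by auto
        finally show ?thesis .
      qed
    qed
    also have "\<dots> = card (Y \<theta>) * M0" by simp
    also have "\<dots> \<le> 2 powr (k * t) * M0" using Y(2)[OF \<theta>] M0 by (intro mult_right_mono) auto
    also have "\<dots> = W * p / 2" unfolding M0_def by (simp add: field_simps)
    finally have bad: "sum w ?bad \<le> W * p / 2" .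
    have "W * p \<le> sum w (Zt \<theta>)" using heavy[OF \<theta>] unfolding Zt_def .
    also have "\<dots> = sum w (good \<theta>) + sum w ?bad"
      by (rule sum.subset_diff[OF _ finZt, THEN trans]) (auto simp: good_def add.commute)
    finally show ?thesis using bad unfolding eq by linarith
  qed
  have "NN * (W * p / 2) = (\<Sum>\<theta>\<in>\<Theta>. \<nu> \<theta> * (W * p / 2))" unfolding NN_def sum_distrib_right ..
  also have "\<dots> \<le> (\<Sum>\<theta>\<in>\<Theta>. \<nu> \<theta> * (\<Sum>a\<in>Z. \<Sum>b\<in>Z. w a * w b * \<omega> \<theta> a b))"
    by (intro sum_mono mult_left_mono lower \<nu>0)
  also have "\<dots> = (\<Sum>\<theta>\<in>\<Theta>. \<Sum>a\<in>Z. \<Sum>b\<in>Z. w a * w b * (\<nu> \<theta> * \<omega> \<theta> a b))"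
    by (simp add: sum_distrib_left mult_ac)
  also have "\<dots> = (\<Sum>a\<in>Z. \<Sum>\<theta>\<in>\<Theta>. \<Sum>b\<in>Z. w a * w b * (\<nu> \<theta> * \<omega> \<theta> a b))" by (rule sum.swap)
  also have "\<dots> = (\<Sum>a\<in>Z. \<Sum>b\<in>Z. \<Sum>\<theta>\<in>\<Theta>. w a * w b * (\<nu> \<theta> * \<omega> \<theta> a b))" by (intro sum.cong refl sum.swap)
  also have "\<dots> = K.Ttot" unfolding K.Ttot_def sum_distrib_left ..
  also note K.Ttot_bound
  finally show ?thesis unfolding K.D_def K.W_def K.NN_def W_def NN_def .
qed

section \<open>Exceptional directions\<close>

lemma rho_wave: "rho \<theta> z = wave z \<theta> / sqrt 2"
  unfolding rho_def gamma_curve_def wave_def by (simp add: inner_vec_def sum_3 vector_3 field_simps)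

lemma sqrt2_le_2: "sqrt 2 \<le> 2"
  by (rule real_le_lsqrt) auto

lemma dyadic_level:
  fixes q :: real
  assumes "0 < q" "q < 1 / 2^k0"
  shows "\<exists>k\<ge>k0. q < 1 / 2^k \<and> 1 / 2^k \<le> 2 * q"
proof -
  obtain m :: nat where "(1/2)^m < q" using real_arch_pow_inv[of q "1/2"] assms by auto
  then have "1 / 2^(m+1) \<le> q" using power_decreasing[of m "m+1" "1/2::real"] by (simp add: power_one_over)
  then have ex: "\<exists>k. 1 / 2^(k+1) \<le> q" by blast
  define k where "k = (LEAST k. 1 / 2^(k+1) \<le> q)"
  have k: "1 / 2^(k+1) \<le> q" unfolding k_def using ex by (rule LeastI_ex)
  have lt: "q < 1 / 2^k"
  proof (cases k)
    case 0
    have "1 / (2::real)^k0 \<le> 1" by (simp add: divide_le_eq)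
    then have "q < 1" using assms(2) by linarith
    then show ?thesis unfolding 0 by simp
  next
    case (Suc n)
    have "\<not> 1 / 2^(n+1) \<le> q" using not_less_Least[of n "\<lambda>k. 1 / 2^(k+1) \<le> q"] Suc unfolding k_def by auto
    then show ?thesis unfolding Suc by simp
  qed
  have "k0 \<le> k"
  proof (rule ccontr)
    assume "\<not> k0 \<le> k"
    then have "(1::real) / 2^k0 \<le> 1 / 2^(k+1)" by (intro divide_left_mono power_increasing) auto
    then show False using k assms by linarith
  qed
  then show ?thesis using k lt by (intro exI[of _ k]) simp
qed

lemma diameter_powr_le_weight:
  assumes "U \<noteq> {}" "bounded U" "diameter U \<le> 1" "0 \<le> s" "s \<le> t"
  shows "ennreal (diameter U powr t) \<le> diam_weight s U"
proof -
  have "diameter U powr t \<le> (if s = 0 then 1 else diameter U powr s)"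
    using assms diameter_ge_0[OF assms(2)] by (auto intro: powr_le1 powr_mono')
  then show ?thesis using assms(1) by (auto simp: diam_weight_def intro!: ennreal_leI)
qed

text \<open>The bound \<open>n\<close> on the level writes the exceptional directions as a countable
  increasing union, while \<open>k0\<close> keeps all scales small. The count is imposed level by
  level because only one level will eventually be used.\<close>

definition thin :: "(real ^ 3) set \<Rightarrow> real \<Rightarrow> nat \<Rightarrow> nat \<Rightarrow> real \<Rightarrow> bool" where
  "thin C t k0 n \<theta> \<longleftrightarrow> (\<exists>Y :: nat \<Rightarrow> real set. (\<forall>k. finite (Y k) \<and> real (card (Y k)) \<le> 2 powr (real k * t)) \<and>
     (\<forall>z\<in>C. \<exists>k\<in>{k0..n}. \<exists>y\<in>Y k. \<bar>wave z \<theta> - y\<bar> < 1 / 2^k))"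

lemma thin_mono: "thin C t k0 n \<theta> \<Longrightarrow> n \<le> n' \<Longrightarrow> thin C t k0 n' \<theta>"
  unfolding thin_def by (meson atLeastAtMost_iff le_trans)

text \<open>A cover of small s-dimensional weight with s < t is rounded to dyadic lengths. Since the
  t-th powers sum to at most 1, at most \<open>2 powr (k * t)\<close> intervals have level
  \<open>k\<close>. Compactness leaves finitely many and thereby provides \<open>n\<close>.\<close>

lemma small_projection_thin:
  assumes C: "compact C" and t: "0 < t" "t \<le> 1" and dim: "hausdorff_dim (rho \<theta> ` C) < ennreal t"
  shows "\<exists>n. thin C t k0 n \<theta>"
proof -
  let ?H = "rho \<theta> ` C"
  obtain s where s: "0 \<le> s" "hausdorff_measure s ?H = 0" "ennreal s < ennreal t"
    using dim unfolding hausdorff_dim_def INF_less_iff by blast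
  then have st: "s \<le> t" using t by (simp add: ennreal_less_iff)
  define \<delta> where "\<delta> = 1 / (2::real)^(k0+2)"
  have "(1::real) \<le> 2^(k0+2)" by (rule one_le_power) simp
  then have \<delta>: "0 < \<delta>" "\<delta> \<le> 1" unfolding \<delta>_def by (auto simp: divide_le_eq)
  have "hausdorff_premeasure s \<delta> ?H \<le> hausdorff_measure s ?H"
    unfolding hausdorff_measure_def by (rule SUP_upper) (use \<delta> in simp)
  then have "hausdorff_premeasure s \<delta> ?H < ennreal (1/8)" using s(2) by simp
  then obtain U where U: "U \<in> delta_covers \<delta> ?H" "(\<Sum>i. diam_weight s (U i)) < ennreal (1/8)"
    unfolding hausdorff_premeasure_def INF_less_iff by blast
  then have cov: "?H \<subseteq> (\<Union>i. U i)" and bU: "\<And>i. bounded (U i)" and dU: "\<And>i. diameter (U i) \<le> \<delta>"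
    unfolding delta_covers_def by auto
  define d where "d i = diameter (U i)" for i
  have d0: "0 \<le> d i" for i unfolding d_def by (rule diameter_ge_0[OF bU])
  \<comment> \<open>Sets of diameter 0 need a positive length too; this floor has t-th power at most
    \<open>1 / 2^(i+4)\<close> and is therefore summable.\<close>
  define \<tau> where "\<tau> i = min ((1 / (2::real)^(i+4)) powr (1/t)) \<delta>" for i
  have \<tau>0: "0 < \<tau> i" for i unfolding \<tau>_def using \<delta> by simp
  \<comment> \<open>The 2 in front of \<open>d i\<close> absorbs the factor sqrt 2 between
    \<open>rho\<close> and \<open>wave\<close>.\<close>
  define q where "q i = max (2 * d i) (\<tau> i)" for i
  have q0: "0 < q i" for i unfolding q_def using \<tau>0[of i] by (simp add: less_max_iff_disj)
  have qlt: "q i < 1 / 2^k0" for i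
  proof -
    have "q i \<le> 2 * \<delta>" unfolding q_def \<tau>_def d_def using dU[of i] \<delta> by auto
    also have "\<dots> < 1 / 2^k0" unfolding \<delta>_def by (simp add: field_simps)
    finally show ?thesis .
  qed
  have "\<forall>i. \<exists>k\<ge>k0. q i < 1 / 2^k \<and> 1 / 2^k \<le> 2 * q i" using dyadic_level[OF q0 qlt] by blast
  from choice[OF this] obtain \<kappa> where "\<forall>i. k0 \<le> \<kappa> i \<and> q i < 1 / 2^\<kappa> i \<and> 1 / 2^\<kappa> i \<le> 2 * q i" ..
  then have \<kappa>: "\<And>i. k0 \<le> \<kappa> i" "\<And>i. q i < 1 / 2^\<kappa> i" "\<And>i. 1 / 2^\<kappa> i \<le> 2 * q i" by blast+
  have wt: "(1 / 2^\<kappa> i) powr t \<le> 4 * d i powr t + (1/8) * (1/2)^i" for i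
  proof -
    have "(1 / 2^\<kappa> i) powr t \<le> (2 * q i) powr t" using \<kappa>(3)[of i] t by (intro powr_mono2) auto
    also have "\<dots> \<le> (4 * d i) powr t + (2 * \<tau> i) powr t"
    proof (cases "\<tau> i \<le> 2 * d i")
      case True
      then have "2 * q i = 4 * d i" unfolding q_def by simp
      then show ?thesis by simp
    next
      case False
      then have "q i = \<tau> i" unfolding q_def by simp
      then show ?thesis by simp
    qed
    also have "\<dots> = 4 powr t * d i powr t + 2 powr t * \<tau> i powr t"
      using d0[of i] \<tau>0[of i] by (simp add: powr_mult)
    also have "\<dots> \<le> 4 powr 1 * d i powr t + 2 powr 1 * \<tau> i powr t"
      using t by (intro add_mono mult_right_mono powr_mono) auto
    also have "\<tau> i powr t \<le> ((1 / (2::real)^(i+4)) powr (1/t)) powr t"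
      using \<tau>0[of i] t unfolding \<tau>_def by (intro powr_mono2) auto
    also have "\<dots> = 1 / 2^(i+4)" using t by (simp add: powr_powr)
    also have "4 powr 1 * d i powr t + 2 powr 1 * (1 / 2^(i+4)) = 4 * d i powr t + (1/8) * (1/2)^i"
      by (simp add: power_add power_one_over)
    finally show ?thesis by simp
  qed
  have sumle: "(\<Sum>i\<in>I0. (1 / 2^\<kappa> i) powr t) \<le> 1" if I0: "finite I0" "I0 \<subseteq> {i. U i \<noteq> {}}" for I0
  proof -
    have "ennreal (\<Sum>i\<in>I0. d i powr t) = (\<Sum>i\<in>I0. ennreal (d i powr t))" by (simp add: sum_ennreal)
    also have "\<dots> \<le> (\<Sum>i\<in>I0. diam_weight s (U i))"
    proof (rule sum_mono)
      fix i assume "i \<in> I0"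
      then have ne: "U i \<noteq> {}" using I0 by auto
      have "diameter (U i) \<le> 1" using dU[of i] \<delta> by linarith
      then show "ennreal (d i powr t) \<le> diam_weight s (U i)"
        unfolding d_def by (intro diameter_powr_le_weight ne bU s(1) st)
    qed
    also have "\<dots> \<le> (\<Sum>i. diam_weight s (U i))" by (rule sum_le_suminf) (use I0 in auto)
    also have "\<dots> \<le> ennreal (1/8)" using U(2) by simp
    finally have 1: "(\<Sum>i\<in>I0. d i powr t) \<le> 1/8" by (simp add: ennreal_le_iff)
    have "(\<Sum>i\<in>I0. (1/2::real)^i) \<le> (\<Sum>i. (1/2)^i)" by (rule sum_le_suminf) (use I0 in \<open>auto intro: summable_geometric\<close>)
    also have "\<dots> = 2" by (subst suminf_geometric) auto
    finally have 2: "(\<Sum>i\<in>I0. (1/2::real)^i) \<le> 2" .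
    \<comment> \<open>The total is at most 4 * (1/8) + (1/8) * 2 = 3/4.\<close>
    have "(\<Sum>i\<in>I0. (1 / 2^\<kappa> i) powr t) \<le> (\<Sum>i\<in>I0. 4 * d i powr t + (1/8) * (1/2)^i)" by (intro sum_mono wt)
    also have "\<dots> = 4 * (\<Sum>i\<in>I0. d i powr t) + (1/8) * (\<Sum>i\<in>I0. (1/2::real)^i)"
      by (simp only: sum.distrib sum_distrib_left)
    finally show ?thesis using 1 2 by linarith
  qed
  define y where "y i = sqrt 2 * (SOME u. u \<in> U i)" for i
  define V where "V i = {z. \<bar>wave z \<theta> - y i\<bar> < 1 / 2^\<kappa> i}" for i
  have "open (V i)" for i
  proof -
    have "continuous_on UNIV (\<lambda>z. \<bar>wave z \<theta> - y i\<bar>)" unfolding wave_def by (intro continuous_intros)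
    then show ?thesis unfolding V_def by (intro open_Collect_less) auto
  qed
  moreover have "C \<subseteq> (\<Union>i\<in>{i. U i \<noteq> {}}. V i)"
  proof
    fix z assume "z \<in> C"
    then obtain i where i: "rho \<theta> z \<in> U i" using cov by auto
    then have u: "(SOME u. u \<in> U i) \<in> U i" by (intro someI)
    have "\<bar>rho \<theta> z - (SOME u. u \<in> U i)\<bar> \<le> d i"
      using diameter_bounded_bound[OF bU i u] unfolding d_def dist_real_def .
    then have "sqrt 2 * \<bar>rho \<theta> z - (SOME u. u \<in> U i)\<bar> \<le> 2 * d i" using sqrt2_le_2 by (intro mult_mono) auto
    moreover have "wave z \<theta> - y i = sqrt 2 * (rho \<theta> z - (SOME u. u \<in> U i))"
      unfolding rho_wave y_def by (simp add: right_diff_distrib)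
    ultimately have "\<bar>wave z \<theta> - y i\<bar> \<le> 2 * d i" by (simp add: abs_mult)
    also have "\<dots> \<le> q i" unfolding q_def by simp
    also have "\<dots> < 1 / 2^\<kappa> i" by (rule \<kappa>(2))
    finally show "z \<in> (\<Union>i\<in>{i. U i \<noteq> {}}. V i)" using i unfolding V_def by blast
  qed
  ultimately obtain I0 where I0: "I0 \<subseteq> {i. U i \<noteq> {}}" "finite I0" "C \<subseteq> (\<Union>i\<in>I0. V i)"
    using compactE_image[OF C, of "{i. U i \<noteq> {}}" V] by metis
  define Y where "Y k = y ` {i \<in> I0. \<kappa> i = k}" for k
  have "finite (Y k)" for k unfolding Y_def using I0 by simp
  moreover have "real (card (Y k)) \<le> 2 powr (real k * t)" for k
  proof -
    let ?J = "{i \<in> I0. \<kappa> i = k}"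
    have "real (card ?J) * (1 / 2^k) powr t = (\<Sum>i\<in>?J. (1 / 2^\<kappa> i) powr t)" by simp
    also have "\<dots> \<le> 1" by (rule sumle) (use I0 in auto)
    finally have "real (card ?J) * (1 / 2^k) powr t \<le> 1" .
    moreover have "(1 / (2::real)^k) powr t = 1 / 2 powr (real k * t)"
      by (simp add: powr_divide powr_powr flip: powr_realpow)
    ultimately have "real (card ?J) \<le> 2 powr (real k * t)" by (simp add: divide_le_eq)
    moreover have "card (Y k) \<le> card ?J" unfolding Y_def using I0 by (intro card_image_le) simp
    ultimately show ?thesis by linarith
  qed
  moreover have "\<exists>k\<in>{k0..(\<Sum>i\<in>I0. \<kappa> i)}. \<exists>y\<in>Y k. \<bar>wave z \<theta> - y\<bar> < 1 / 2^k" if hz: "z \<in> C" for z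
  proof -
    obtain i where i: "i \<in> I0" "z \<in> V i" using I0 hz by blast
    have "\<kappa> i \<le> (\<Sum>i\<in>I0. \<kappa> i)" using i I0 by (intro member_le_sum) auto
    then show ?thesis using i \<kappa>(1)[of i] unfolding V_def Y_def by (intro bexI[of _ "\<kappa> i"] bexI[of _ "y i"]) auto
  qed
  ultimately show ?thesis unfolding thin_def by blast
qed

lemma hausdorff_dim_mono: "A \<subseteq> B \<Longrightarrow> hausdorff_dim A \<le> hausdorff_dim B"
proof -
  assume AB: "A \<subseteq> B"
  have "hausdorff_premeasure s \<delta> A \<le> hausdorff_premeasure s \<delta> B" for s \<delta>
    unfolding hausdorff_premeasure_def by (rule INF_superset_mono) (use AB in \<open>auto simp: delta_covers_def\<close>)
  then have "hausdorff_measure s A \<le> hausdorff_measure s B" for s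
    unfolding hausdorff_measure_def by (intro SUP_mono) auto
  then have "hausdorff_measure s B = 0 \<Longrightarrow> hausdorff_measure s A = 0" for s by (metis le_zero_eq)
  then show ?thesis unfolding hausdorff_dim_def by (intro INF_superset_mono) auto
qed

lemma ennreal_pos_witness: 
  assumes "(x::ennreal) \<noteq> 0" obtains c :: real where "0 < c" "ennreal c < x"
proof -
  have "0 < x" using assms by (simp add: zero_less_iff_neq_zero)
  then obtain y where y: "0 < y" "y < x" using dense by blast
  then obtain c where "y = ennreal c" "0 \<le> c" by (cases y) auto
  then show thesis using that[of c] y by (auto simp: less_le)
qed

text \<open>Telescoping weights of total mass 1 over all levels: pigeonholing with them costs a
  factor quadratic in the level that is found, independent of how many levels compete.\<close>

definition level_weight :: "nat \<Rightarrow> real" where "level_weight k = 1 / ((real k + 1) * (real k + 2))"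

lemma level_weight_pos: "0 < level_weight k" unfolding level_weight_def by simp

lemma sum_level_weight: "(\<Sum>k<n. level_weight k) = 1 - 1 / (real n + 1)"
proof -
  have "level_weight k = 1 / (real k + 1) - 1 / (real k + 2)" for k unfolding level_weight_def by (simp add: divide_simps)
  then show ?thesis by (induction n) (auto simp: add_ac)
qed

lemma level_pigeonhole:
  assumes fin: "finite Z" and w0: "\<And>x. 0 \<le> (w x :: real)" and pos: "0 < sum w Z"
    and cov: "\<And>z. z \<in> Z \<Longrightarrow> \<exists>k\<in>{k0..n}. P k z"
  shows "\<exists>k\<in>{k0..n}. sum w Z * level_weight k \<le> (\<Sum>z | z \<in> Z \<and> P k z. w z)"
proof (rule ccontr)
  assume "\<not> ?thesis"
  then have "\<forall>k\<in>{k0..n}. \<not> sum w Z * level_weight k \<le> (\<Sum>z | z \<in> Z \<and> P k z. w z)" by blast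
  then have lt: "(\<Sum>z | z \<in> Z \<and> P k z. w z) < sum w Z * level_weight k" if "k \<in> {k0..n}" for k
    using that unfolding not_le by (rule bspec)
  have "Z \<noteq> {}" using pos by auto
  then have ne: "{k0..n} \<noteq> {}" using cov by blast
  have "Z \<subseteq> (\<Union>k\<in>{k0..n}. {z. z \<in> Z \<and> P k z})" using cov by blast
  then have "Z = (\<Union>k\<in>{k0..n}. {z. z \<in> Z \<and> P k z})" by blast
  then have "sum w Z = sum w (\<Union>k\<in>{k0..n}. {z. z \<in> Z \<and> P k z})" by simp
  also have "\<dots> \<le> (\<Sum>k\<in>{k0..n}. \<Sum>z | z \<in> Z \<and> P k z. w z)"
    by (rule sum_UN_le[OF _ _ w0]) (use fin in auto)
  also have "\<dots> < (\<Sum>k\<in>{k0..n}. sum w Z * level_weight k)"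
    by (rule sum_strict_mono[OF _ ne lt]) auto
  also have "\<dots> = sum w Z * (\<Sum>k\<in>{k0..n}. level_weight k)" by (simp only: sum_distrib_left)
  also have "\<dots> \<le> sum w Z * (\<Sum>k<Suc n. level_weight k)"
    using pos by (intro mult_left_mono sum_mono2) (auto intro: less_imp_le[OF level_weight_pos])
  also have "\<dots> \<le> sum w Z * 1" unfolding sum_level_weight using pos by (intro mult_left_mono) auto
  finally show False by simp
qed

lemma eventually_no_loss:
  fixes A B g :: real
  assumes "0 < g"
  shows "\<exists>k0. \<forall>k\<ge>k0. A * (real k + 2)^4 * 2 powr (-(real k * g)) + B * (real k + 2)^8 * sqrt (2 powr (-(real k * g))) < 1/2"
proof -
  have "(\<lambda>k::nat. A * (real k + 2)^4 * 2 powr (-(real k * g)) + B * (real k + 2)^8 * sqrt (2 powr (-(real k * g)))) \<longlonglongrightarrow> 0"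
    using assms by real_asymp
  from order_tendstoD(2)[OF this, of "1/2"] show ?thesis by (simp add: eventually_sequentially)
qed

text \<open>Since \<open>p\<close> is at least \<open>1 / q^2\<close> and both masses are bounded
  below, all denominators can be cleared at polynomial cost. What is left is the exponential gain
  \<open>2 powr (-(k * (e - t)))\<close>, entering the second term through its square root.\<close>

lemma scale_contradiction:
  fixes W NN p e t g w0 v0 :: real and k :: nat
  defines "M0 \<equiv> W * p / (2 * 2 powr (real k * t))"
  assumes ineq: "NN * (W * p / 2) \<le> NN * W * (130 * 54 * (2 / 2^k) powr e / M0) +
     2 * real k ^ 2 * (sqrt (4 * 10^8 * 54^3 * (2 / 2^k) powr e / M0) * (real k + 1) * W)"
    and p: "p = level_weight k" and w0: "0 < w0" "w0 \<le> W" and v0: "0 < v0" "v0 * p \<le> NN" and e: "e \<le> 1"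
    and small: "28080 / w0 * (real k + 2)^4 * 2 powr (-(real k * (e - t))) +
      (2 / v0 * sqrt (16 * 10^8 * 54^3 / w0)) * (real k + 2)^8 * sqrt (2 powr (-(real k * (e - t)))) < 1/2"
  shows False
proof -
  define x where "x = 2 powr (-(real k * (e - t)))"
  define q where "q = real k + 2"
  have q: "q \<ge> 2" unfolding q_def by simp
  have x0: "x > 0" unfolding x_def by simp
  have p0: "p > 0" unfolding p by (rule level_weight_pos)
  have W0: "W > 0" using w0 by linarith
  have NN0: "NN > 0" using v0 mult_pos_pos[OF v0(1) p0] by linarith
  have pq: "1 \<le> q^2 * p"
  proof -
    have "(real k + 1) * (real k + 2) \<le> q^2" unfolding q_def power2_eq_square by (intro mult_right_mono) auto
    then show ?thesis unfolding p level_weight_def by (simp add: divide_simps)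
  qed
  have De: "(2 / 2^k) powr e / M0 \<le> 4 * x / (W * p)"
  proof -
    have "(2 / (2::real)^k) powr e = (2 powr (1 - real k)) powr e" by (simp add: powr_diff powr_realpow)
    also have "\<dots> = 2 powr e * 2 powr (-(real k * e))"
      unfolding powr_powr powr_add[symmetric] by (simp add: algebra_simps)
    also have "\<dots> \<le> 2 powr 1 * 2 powr (-(real k * e))" using e by (intro mult_right_mono powr_mono) auto
    finally have "(2 / 2^k) powr e / M0 \<le> 2 * 2 powr (-(real k * e)) / M0"
      unfolding M0_def using W0 p0 by (intro divide_right_mono) auto
    also have "\<dots> = 4 * (2 powr (-(real k * e)) * 2 powr (real k * t)) / (W * p)" unfolding M0_def by simp
    also have "2 powr (-(real k * e)) * 2 powr (real k * t) = x"
      unfolding x_def powr_add[symmetric] by (simp add: algebra_simps)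
    finally show ?thesis .
  qed
  have inv: "4 * x / (W * p) \<le> 4 * x * q^2 / w0"
  proof -
    have "w0 * 1 \<le> W * (q^2 * p)" using w0 pq by (intro mult_mono) auto
    then show ?thesis using W0 p0 w0 x0 by (simp add: field_simps mult_left_mono)
  qed
  \<comment> \<open>A bound for \<open>(2 / 2^k) powr e / M0\<close>. The constants come from 54 = 2
    * 3^3, 130 * 54 = 7020 and 4 * 7020 = 28080.\<close>
  define X where "X = 4 * x * q^2 / w0"
  have X: "(2 / 2^k) powr e / M0 \<le> X" using De inv unfolding X_def by linarith
  have X0: "X \<ge> 0" unfolding X_def using x0 w0 by simp
  have "NN * (W * p / 2) \<le> NN * W * (130 * 54 * X) + 2 * real k ^ 2 * (sqrt (4 * 10^8 * 54^3 * X) * (real k + 1) * W)"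
  proof (rule order_trans[OF ineq], rule add_mono)
    show "NN * W * (130 * 54 * (2 / 2^k) powr e / M0) \<le> NN * W * (130 * 54 * X)"
      using X NN0 W0 by (intro mult_left_mono) auto
    show "2 * real k ^ 2 * (sqrt (4 * 10^8 * 54^3 * (2 / 2^k) powr e / M0) * (real k + 1) * W)
       \<le> 2 * real k ^ 2 * (sqrt (4 * 10^8 * 54^3 * X) * (real k + 1) * W)"
      using X W0 by (intro mult_left_mono mult_right_mono real_sqrt_le_mono) auto
  qed
  also have "\<dots> = W * (NN * (7020 * X) + 2 * real k ^ 2 * (real k + 1) * sqrt (4 * 10^8 * 54^3 * X))"
    by (simp add: algebra_simps)
  finally have "W * (NN * p / 2) \<le> W * (NN * (7020 * X) + 2 * real k ^ 2 * (real k + 1) * sqrt (4 * 10^8 * 54^3 * X))"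
    by (simp add: mult_ac)
  then have "NN * p / 2 \<le> NN * (7020 * X) + 2 * real k ^ 2 * (real k + 1) * sqrt (4 * 10^8 * 54^3 * X)"
    using W0 by (simp only: mult_le_cancel_left_pos)
  also have "2 * real k ^ 2 * (real k + 1) * sqrt (4 * 10^8 * 54^3 * X) \<le> 2 * q^2 * q * sqrt (4 * 10^8 * 54^3 * X)"
    unfolding q_def using X0 by (intro mult_mono mult_left_mono power_mono) auto
  also have "\<dots> \<le> (NN * (q^2 / v0)) * (2 * q^3 * sqrt (4 * 10^8 * 54^3 * X))"
  proof -
    have "v0 * 1 \<le> v0 * (q^2 * p)" using v0 pq by (intro mult_left_mono) auto
    also have "\<dots> \<le> q^2 * NN" using mult_left_mono[OF v0(2), of "q^2"] by (simp add: mult_ac)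
    finally have "1 \<le> NN * (q^2 / v0)" using v0 by (simp add: field_simps)
    then have "1 * (2 * q^3 * sqrt (4 * 10^8 * 54^3 * X)) \<le> (NN * (q^2 / v0)) * (2 * q^3 * sqrt (4 * 10^8 * 54^3 * X))"
      using q X0 by (intro mult_right_mono) auto
    then show ?thesis by (simp add: power3_eq_cube power2_eq_square mult_ac)
  qed
  finally have "NN * (p / 2) \<le> NN * (7020 * X + (q^2 / v0) * (2 * q^3 * sqrt (4 * 10^8 * 54^3 * X)))"
    by (simp add: algebra_simps)
  then have "p / 2 \<le> 7020 * X + (q^2 / v0) * (2 * q^3 * sqrt (4 * 10^8 * 54^3 * X))"
    using NN0 by (simp only: mult_le_cancel_left_pos)
  then have "q^2 * (p / 2) \<le> q^2 * (7020 * X + (q^2 / v0) * (2 * q^3 * sqrt (4 * 10^8 * 54^3 * X)))"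
    by (intro mult_left_mono) auto
  moreover have "q^2 * (7020 * X) = 28080 / w0 * q^4 * x" unfolding X_def by (simp add: power4_eq_xxxx power2_eq_square)
  moreover have "sqrt (4 * 10^8 * 54^3 * X) = sqrt (16 * 10^8 * 54^3 / w0) * q * sqrt x"
  proof -
    have "4 * 10^8 * 54^3 * X = (16 * 10^8 * 54^3 / w0) * q^2 * x" unfolding X_def by simp
    then show ?thesis using q by (simp only: real_sqrt_mult) simp
  qed
  \<comment> \<open>Power count for \<open>q^8\<close>: two from clearing \<open>p\<close>, two from
    the lower bound for \<open>NN\<close>, three from the sum over classes with its factor
    \<open>k + 1\<close>, one from the square root.\<close>
  moreover have "q^2 * ((q^2 / v0) * (2 * q^3 * (sqrt (16 * 10^8 * 54^3 / w0) * q * sqrt x))) = (2 / v0 * sqrt (16 * 10^8 * 54^3 / w0)) * q^8 * sqrt x"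
    by (simp add: power_numeral_reduce)
  ultimately have "q^2 * p / 2 \<le> 28080 / w0 * q^4 * x + (2 / v0 * sqrt (16 * 10^8 * 54^3 / w0)) * q^8 * sqrt x"
    by (simp only: distrib_left times_divide_eq_right)
  then show False using small pq unfolding q_def[symmetric] x_def[symmetric] by linarith
qed

text \<open>The order of choices matters: first the lower bounds for the masses, then
  \<open>k0\<close>, then \<open>n\<close>, then weights at scale \<open>1 / 2^n\<close>. Two
  pigeonholes finally produce one level \<open>k\<close> at which many directions each see much of
  \<open>Z\<close> in few slabs.\<close>

lemma exceptional_set_null:
  fixes f :: "(nat \<Rightarrow> nat) \<Rightarrow> real ^ 3"
  assumes f: "continuous_on UNIV f" and te: "0 < t" "t < e" "e \<le> 1"
    and K: "hausdorff_measure e (range f) \<noteq> 0"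
    and E: "E \<subseteq> {0..<2 * pi}" "\<And>\<theta>. \<theta> \<in> E \<Longrightarrow> hausdorff_dim (rho \<theta> ` range f) < ennreal t"
  shows "hausdorff_measure e E = 0"
proof (rule ccontr)
  assume E0: "hausdorff_measure e E \<noteq> 0"
  have e0: "0 < e" using te by linarith
  have "net_content e (range f) \<noteq> 0" "net_content e E \<noteq> 0"
    using hausdorff_measure_eq_0[OF e0] K E0 by blast+
  then obtain cK cE where cK: "0 < cK" "ennreal cK < net_content e (range f)"
    and cE: "0 < cE" "ennreal cE < net_content e E"
    by (elim ennreal_pos_witness)
  from compact_capacity[OF f cK(2,1)]
  obtain C where "C \<subseteq> range f \<and> compact C \<and> (\<forall>n. cover_bound n e (cK / 3 ^ DIM(real ^ 3)) C)" ..
  then have C: "C \<subseteq> range f" "compact C" and covC: "\<And>n. cover_bound n e (cK / 3 ^ DIM(real ^ 3)) C" by simp_all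
  define c where "c = cK / 3 ^ DIM(real ^ 3)"
  have c0: "0 < c" unfolding c_def using cK by simp
  have bC: "bounded C" using C(2) by (rule compact_imp_bounded)
  have bT: "bounded {0..<2 * pi}" by simp
  define NK where "NK = card (cell 0 ` C)"
  \<comment> \<open>Counted for the whole interval of directions, so that \<open>v0\<close>, and
    with it \<open>k0\<close>, does not depend on the \<open>n\<close> found later.\<close>
  define NE where "NE = card (cell 0 ` {0..<2 * pi})"
  have "C \<noteq> {}"
  proof
    assume "C = {}"
    have "cover_bound 0 e c C" using covC unfolding c_def .
    then have "c \<le> 0" unfolding cover_bound_def \<open>C = {}\<close> by (elim allE[of _ "{}"]) simp
    then show False using c0 by simp
  qed
  then have NK: "0 < NK" unfolding NK_def using finite_cells_bounded[OF bC] by (simp add: card_gt_0_iff)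
  have NE: "0 < NE" unfolding NE_def using finite_cells_bounded[OF bT] by (simp add: card_gt_0_iff)
  define w0 where "w0 = c / NK"
  define v0 where "v0 = cE / NE"
  have w0: "0 < w0" and v0: "0 < v0" unfolding w0_def v0_def using NK NE c0 cE by auto
  obtain k0 where k0: "\<And>k. k0 \<le> k \<Longrightarrow> 28080 / w0 * (real k + 2)^4 * 2 powr (-(real k * (e - t))) +
      (2 / v0 * sqrt (16 * 10^8 * 54^3 / w0)) * (real k + 2)^8 * sqrt (2 powr (-(real k * (e - t)))) < 1/2"
    using eventually_no_loss[of "e - t" "28080 / w0" "2 / v0 * sqrt (16 * 10^8 * 54^3 / w0)"] te by auto
  define En where "En n = {\<theta> \<in> E. thin C t k0 n \<theta>}" for n
  have thinE: "\<exists>n. thin C t k0 n \<theta>" if "\<theta> \<in> E" for \<theta>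
  proof (rule small_projection_thin[OF C(2) te(1)])
    show "t \<le> 1" using te by linarith
    have "hausdorff_dim (rho \<theta> ` C) \<le> hausdorff_dim (rho \<theta> ` range f)" using C(1) by (intro hausdorff_dim_mono image_mono)
    then show "hausdorff_dim (rho \<theta> ` C) < ennreal t" using E(2)[OF that] by (rule le_less_trans)
  qed
  \<comment> \<open>This \<open>n\<close> serves twice: as the finest level of the covers of the
    projections and as the scale of both families of weights.\<close>
  have "\<exists>n. ennreal cE < net_content e (En n)"
  proof (rule ccontr)
    assume "\<not> ?thesis"
    then have le: "net_content e (En n) \<le> ennreal cE" for n by (simp add: not_less)
    have "incseq En" unfolding incseq_def En_def using thin_mono by blast
    then have "net_content e (\<Union>n. En n) \<le> ennreal cE" using le by (rule net_content_incseq)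
    moreover have "(\<Union>n. En n) = E" unfolding En_def using thinE by blast
    ultimately show False using cE(2) by simp
  qed
  then obtain n where n: "ennreal cE < net_content e (En n)" ..
  have EnT: "En n \<subseteq> {0..<2 * pi}" unfolding En_def using E(1) by blast
  have bE: "bounded (En n)" using bT EnT by (rule bounded_subset)
  have "cover_bound n e cE (En n)" by (rule cover_bound_net_content) (use n cE in auto)
  from frostman_exists[OF bE cE(1) e0 te(3) this] obtain \<Theta> \<nu>
    where \<Theta>: "\<Theta> \<subseteq> En n" and fr\<Theta>: "frostman \<Theta> \<nu> (1/2^n) e (2 * 3 ^ DIM(real))" and m\<Theta>: "cE / card (cell 0 ` En n) \<le> sum \<nu> \<Theta>"
    by blast
  from frostman_exists[OF bC c0 e0 te(3) covC[folded c_def], of n] obtain Z w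
    where Z: "Z \<subseteq> C" and frZ: "frostman Z w (1/2^n) e (2 * 3 ^ DIM(real ^ 3))" and mZ: "c / card (cell 0 ` C) \<le> sum w Z"
      and dZ: "\<forall>x\<in>Z. \<forall>y\<in>Z. dist x y \<le> sqrt (DIM(real ^ 3))"
    by blast
  have finZ: "finite Z" and fin\<Theta>: "finite \<Theta>" and wpos: "\<And>x. 0 \<le> w x" and \<nu>pos: "\<And>x. 0 \<le> \<nu> x"
    using frostmanD(1,2)[OF frZ] frostmanD(1,2)[OF fr\<Theta>] by blast+
  have "net_content e ({} :: real set) \<le> 0" using net_content_le[of "{}" "{}" e] by (simp add: cost_finite)
  then have "En n \<noteq> {}" using n by (metis not_less_zero le_zero_eq)
  then have "0 < card (cell 0 ` En n)" using finite_cells_bounded[OF bE] by (simp add: card_gt_0_iff)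
  moreover have "card (cell 0 ` En n) \<le> NE"
    unfolding NE_def by (intro card_mono finite_cells_bounded[OF bT] image_mono EnT)
  ultimately have "v0 \<le> cE / card (cell 0 ` En n)" unfolding v0_def using cE by (intro divide_left_mono) auto
  then have v\<Theta>: "v0 \<le> sum \<nu> \<Theta>" using m\<Theta> by linarith
  have wZ: "w0 \<le> sum w Z" using mZ unfolding w0_def NK_def .
  have "\<forall>\<theta>\<in>\<Theta>. \<exists>Y :: nat \<Rightarrow> real set. (\<forall>k. finite (Y k) \<and> real (card (Y k)) \<le> 2 powr (real k * t)) \<and>
     (\<forall>z\<in>C. \<exists>k\<in>{k0..n}. \<exists>y\<in>Y k. \<bar>wave z \<theta> - y\<bar> < 1 / 2^k)"
    using \<Theta> unfolding En_def thin_def by blast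
  from bchoice[OF this] obtain Y where "\<forall>\<theta>\<in>\<Theta>. (\<forall>k. finite (Y \<theta> k) \<and> real (card (Y \<theta> k)) \<le> 2 powr (real k * t)) \<and>
     (\<forall>z\<in>C. \<exists>k\<in>{k0..n}. \<exists>y\<in>Y \<theta> k. \<bar>wave z \<theta> - y\<bar> < 1 / 2^k)" ..
  then have Y: "\<And>\<theta> k. \<theta> \<in> \<Theta> \<Longrightarrow> finite (Y \<theta> k)" "\<And>\<theta> k. \<theta> \<in> \<Theta> \<Longrightarrow> real (card (Y \<theta> k)) \<le> 2 powr (real k * t)"
    and Yc: "\<And>\<theta> z. \<theta> \<in> \<Theta> \<Longrightarrow> z \<in> C \<Longrightarrow> \<exists>k\<in>{k0..n}. \<exists>y\<in>Y \<theta> k. \<bar>wave z \<theta> - y\<bar> < 1 / 2^k"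
    by blast+
  \<comment> \<open>The level still depends on the direction; the next pigeonhole, over the
    directions, makes it common.\<close>
  have heavy: "\<exists>k\<in>{k0..n}. sum w Z * level_weight k \<le> (\<Sum>z | z \<in> Z \<and> (\<exists>y\<in>Y \<theta> k. \<bar>wave z \<theta> - y\<bar> < 1 / 2^k). w z)" if "\<theta> \<in> \<Theta>" for \<theta>
    by (rule level_pigeonhole[OF finZ wpos]) (use wZ w0 Yc[OF that] Z in auto)
  have "\<exists>k\<in>{k0..n}. sum \<nu> \<Theta> * level_weight k \<le> (\<Sum>\<theta> | \<theta> \<in> \<Theta> \<and>
      sum w Z * level_weight k \<le> (\<Sum>z | z \<in> Z \<and> (\<exists>y\<in>Y \<theta> k. \<bar>wave z \<theta> - y\<bar> < 1 / 2^k). w z). \<nu> \<theta>)"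
    by (rule level_pigeonhole[OF fin\<Theta> \<nu>pos]) (use v\<Theta> v0 heavy in auto)
  then obtain k where k: "k0 \<le> k" "k \<le> n" and mk: "sum \<nu> \<Theta> * level_weight k \<le> (\<Sum>\<theta> | \<theta> \<in> \<Theta> \<and>
      sum w Z * level_weight k \<le> (\<Sum>z | z \<in> Z \<and> (\<exists>y\<in>Y \<theta> k. \<bar>wave z \<theta> - y\<bar> < 1 / 2^k). w z). \<nu> \<theta>)" by auto
  define \<Theta>k where "\<Theta>k = {\<theta> \<in> \<Theta>. sum w Z * level_weight k \<le> (\<Sum>z | z \<in> Z \<and> (\<exists>y\<in>Y \<theta> k. \<bar>wave z \<theta> - y\<bar> < 1 / 2^k). w z)}"
  have nk: "1 / (2::real)^n \<le> 1 / 2^k" using k by (intro divide_left_mono power_increasing) auto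
  \<comment> \<open>Coarsening the scale keeps the Frostman condition, and 54 = 2 * 3^3 also
    dominates the constant 6 of the line.\<close>
  have frZ': "frostman Z w (1 / 2^k) e 54" by (rule frostman_mono[OF frZ _ nk]) auto
  have fr\<Theta>': "frostman \<Theta>k \<nu> (1 / 2^k) e 54" by (rule frostman_mono[OF fr\<Theta> _ nk]) (auto simp: \<Theta>k_def)
  have "sqrt (DIM(real ^ 3)) \<le> 2" by (intro real_le_lsqrt) auto
  then have dZ': "dist a b \<le> 2" if "a \<in> Z" "b \<in> Z" for a b using dZ that by fastforce
  have \<Theta>kT: "\<Theta>k \<subseteq> {0..<2 * pi}" unfolding \<Theta>k_def using \<Theta> EnT by blast
  have ineq: "sum \<nu> \<Theta>k * (sum w Z * level_weight k / 2) \<le> sum \<nu> \<Theta>k * sum w Z * (130 * 54 * (2 / 2^k) powr e / (sum w Z * level_weight k / (2 * 2 powr (real k * t)))) +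
     2 * real k ^ 2 * (sqrt (4 * 10^8 * 54^3 * (2 / 2^k) powr e / (sum w Z * level_weight k / (2 * 2 powr (real k * t)))) * (real k + 1) * sum w Z)"
  proof (rule projection_inequality[where Y = "\<lambda>\<theta>. Y \<theta> k", OF frZ' fr\<Theta>' \<Theta>kT dZ' e0 te(3)])
    show "0 < level_weight k" by (rule level_weight_pos)
    show "0 < sum w Z" using wZ w0 by linarith
  qed (use Y in \<open>auto simp: \<Theta>k_def\<close>)
  show False
  proof (rule scale_contradiction[OF ineq refl w0 wZ v0 _ te(3) k0[OF k(1)]])
    have "v0 * level_weight k \<le> sum \<nu> \<Theta> * level_weight k" using v\<Theta> level_weight_pos[of k] by (intro mult_right_mono) auto
    also have "\<dots> \<le> sum \<nu> \<Theta>k" using mk unfolding \<Theta>k_def .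
    finally show "v0 * level_weight k \<le> sum \<nu> \<Theta>k" .
  qed
qed

text \<open>An exponent above \<open>t\<close> but below the dimensions of both sets would give both
  nonzero measure, since the dimension is the infimum of the null exponents;
  \<open>exceptional_set_null\<close> excludes this.\<close>

lemma exceptional_set_dim:
  fixes K :: "(real ^ 3) set"
  assumes K: "analytic_set K" and dim: "hausdorff_dim K \<le> 1" and t: "0 < t" "ennreal t < hausdorff_dim K"
  shows "hausdorff_dim {\<theta> \<in> {0..<2 * pi}. hausdorff_dim (rho \<theta> ` K) < ennreal t} \<le> ennreal t" (is "hausdorff_dim ?E \<le> _")
proof (rule ccontr)
  assume "\<not> ?thesis"
  then have "ennreal t < min (hausdorff_dim ?E) (hausdorff_dim K)" using t(2) by (simp add: not_le)
  then obtain x where x: "ennreal t < x" "x < min (hausdorff_dim ?E) (hausdorff_dim K)" using dense by blast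
  then have "x < hausdorff_dim K" by simp
  then have "x < 1" using dim by (rule less_le_trans)
  then obtain e where e: "x = ennreal e" "0 \<le> e" by (cases x) auto
  have te: "t < e" using x(1) t(1) unfolding e(1) by (simp add: ennreal_less_iff)
  have e1: "e \<le> 1" using \<open>x < 1\<close> e by (simp add: ennreal_less_iff flip: ennreal_1)
  have nz: "hausdorff_measure e A \<noteq> 0" if "ennreal e < hausdorff_dim A" for A :: "'b::metric_space set"
  proof
    assume "hausdorff_measure e A = 0"
    then have "hausdorff_dim A \<le> ennreal e" unfolding hausdorff_dim_def using e(2) by (intro INF_lower) simp
    then show False using that by simp
  qed
  have "K \<noteq> {}"
  proof
    assume "K = {}"
    then have "hausdorff_measure 1 K = 0" "hausdorff_measure e K = 0" by simp_all
    then show False using nz[of K] x(2) unfolding e(1) by simp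
  qed
  then obtain f :: "(nat \<Rightarrow> nat) \<Rightarrow> real ^ 3" where f: "continuous_on UNIV f" "K = range f"
    using K unfolding analytic_set_def by blast
  have "hausdorff_measure e ?E = 0"
  proof (rule exceptional_set_null[OF f(1) t(1) te e1])
    show "hausdorff_measure e (range f) \<noteq> 0" using nz[of K] x(2) unfolding e(1) f(2) by simp
  qed (auto simp: f(2))
  then show False using nz[of ?E] x(2) unfolding e(1) by simp
qed

theorem theorem1p3:
  fixes K :: "(real ^ 3) set" and t :: real
  assumes "analytic_set K"
    and "0 < hausdorff_dim K" and "hausdorff_dim K \<le> 1"
    and "0 \<le> t" and "ennreal t < hausdorff_dim K"
  shows "\<exists>E \<subseteq> {0..<2 * pi}.
           hausdorff_dim E \<le> (hausdorff_dim K + ennreal t) / (2 * hausdorff_dim K) \<and>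
           (hausdorff_dim K + ennreal t) / (2 * hausdorff_dim K) < 1 \<and>
           (\<forall>\<theta> \<in> {0..<2 * pi} - E. ennreal t \<le> hausdorff_dim (rho \<theta> ` K))"
proof -
  obtain s where s: "hausdorff_dim K = ennreal s" "0 \<le> s" using assms(3) by (cases "hausdorff_dim K") (auto simp: top_unique)
  have s1: "0 < s" "s \<le> 1" "t < s"
    using assms(2-5) unfolding s(1) by (simp_all add: ennreal_less_iff flip: ennreal_1)
  have ratio: "(hausdorff_dim K + ennreal t) / (2 * hausdorff_dim K) = ennreal ((s + t) / (2 * s))"
  proof -
    have "2 * ennreal s = ennreal (2 * s)" using s1 by (simp add: ennreal_mult)
    then show ?thesis unfolding s(1) using s1 assms(4) by (simp add: divide_ennreal flip: ennreal_plus)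
  qed
  have lt1: "ennreal ((s + t) / (2 * s)) < 1" using s1 assms(4) by (simp add: ennreal_less_iff divide_less_eq flip: ennreal_1)
  show ?thesis
  proof (cases "t = 0")
    case True
    have "hausdorff_dim ({} :: real set) \<le> ennreal 0" unfolding hausdorff_dim_def by (intro INF_lower) simp
    then show ?thesis using True lt1 unfolding ratio by (intro exI[of _ "{}"]) auto
  next
    case False
    let ?E = "{\<theta> \<in> {0..<2 * pi}. hausdorff_dim (rho \<theta> ` K) < ennreal t}"
    \<comment> \<open>Here \<open>s \<le> 1\<close> enters: one copy of \<open>t * s\<close> is
      bounded by \<open>s\<close>, using \<open>t \<le> 1\<close>, and the other by
      \<open>t\<close>.\<close>
    have "t * (2 * s) \<le> s + t"
    proof -
      have "t * s \<le> 1 * s" "t * s \<le> t * 1" using s1 assms(4) by (intro mult_right_mono mult_left_mono; simp)+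
      then show ?thesis by simp
    qed
    then have "t \<le> (s + t) / (2 * s)" using s1 by (simp add: le_divide_eq)
    moreover have "hausdorff_dim ?E \<le> ennreal t"
      by (rule exceptional_set_dim) (use assms False in auto)
    ultimately have "hausdorff_dim ?E \<le> ennreal ((s + t) / (2 * s))" by (meson ennreal_leI order_trans)
    then show ?thesis using lt1 unfolding ratio by (intro exI[of _ ?E]) (auto simp: not_less)
  qed
qed

end
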